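(* Fix $\alpha\in(0,1)\cup(1,2)$ and $\beta\in[-1,1]$, and set $\gamma=\alpha^{-1}$. Let $T$ be the Thaler map with parameter $\gamma$, let $Y=(x^\star,1]$ with probability measure $\mu_Y$, let $\tau_0,\tau_1,\dots$ be the successive return times to $Y$ (random variables on $(Y,\mu_Y)$), and let $d_\alpha,\ell_\alpha$ be the constants, all as defined in the context. Let $\delta$ be a random variable with $\mathbb{P}(\delta=\pm1)=\frac12(1\pm\beta)$ and let $\delta_0,\delta_1,\dots$ be independent copies of $\delta$, with the sequence $(\delta_j)_{j\ge0}$ independent of $(\tau_j)_{j\ge0}$. Then $$n^{-\gamma}\, d_\alpha^{-\gamma}\Big(\sum_{j=0}^{n-1}\delta_j\tau_j-n\beta\ell_\alpha\Big)\to_d X_{\alpha,1,\beta}\quad\text{as } n\to\infty .$$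
   Context: Stable laws: for $\alpha\in(0,1)\cup(1,2)$, $\eta>0$, $\beta\in[-1,1]$, $X_{\alpha,\eta,\beta}$ denotes a real random variable with characteristic function $$\mathbb{E}(e^{itX_{\alpha,\eta,\beta}})=\exp\Big\{-\eta^\alpha|t|^\alpha\Big(1-i\beta\,\mathrm{sgn}(t)\tan\frac{\alpha\pi}{2}\Big)\Big\},\quad t\in\mathbb{R}.$$ Thaler map: for $\gamma\in(0,1)\cup(1,\infty)$, $T:[0,1]\to[0,1]$ is $$Tx=x\Big(1+\Big(\frac{x}{1+x}\Big)^{\gamma-1}-x^{\gamma-1}\Big)^{1/(1-\gamma)}\bmod 1,$$ equivalently $Tx=(x^{1-\gamma}+(1+x)^{1-\gamma}-1)^{1/(1-\gamma)}\bmod 1$ (with $T0=0$). Let $x^\star\in(0,1)$ be the unique solution of ${x^\star}^{1-\gamma}+(1+x^\star)^{1-\gamma}=2$, and $Y=(x^\star,1]$. Measure: let $h(x)=x^{-\gamma}+(x+1)^{-\gamma}$, and let $\mu_Y$ be the probability measure on $Y$ with density $\frac{1-\gamma}{2^{1-\gamma}-1}\,h|_Y$ with respect to Lebesgue measure. Return times: for $y_0\in Y$ (defined $\mu_Y$-almost everywhere), $\tau_0\ge1$ is the least integer such that $T^{\tau_0}y_0\in Y$; inductively, given $\tau_0,\dots,\tau_{j-1}$, $\tau_j\ge1$ is the least integer such that $T^{\tau_0+\dots+\tau_j}y_0\in Y$. These are random variables on $(Y,\mu_Y)$, the randomness being the choice of $y_0$. Constants: with $\gamma=\alpha^{-1}$,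 $g_\alpha=\Gamma(1-\alpha)\cos\frac{\alpha\pi}{2}$, $d_\alpha=\alpha^\alpha\,\frac{1-\gamma}{2^{1-\gamma}-1}\,g_\alpha$, and $\ell_\alpha=0$ if $\alpha\in(0,1)$, $\ell_\alpha=(1-2^{\gamma-1})^{-1}$ if $\alpha\in(1,2)$. $\to_d$ denotes convergence in distribution. *)

theory Defs
  imports "HOL-Probability.Probability"
begin

definition stable_char :: "real \<Rightarrow> real \<Rightarrow> real \<Rightarrow> real \<Rightarrow> complex" where
  "stable_char \<alpha> \<eta> \<beta> t =
     exp (- (of_real (\<eta> powr \<alpha> * \<bar>t\<bar> powr \<alpha>)
             * (1 - \<i> * of_real (\<beta> * sgn t * tan (\<alpha> * pi / 2)))))"

text \<open>\<open>frac\<close> is reduction modulo 1; at \<open>x = 0\<close> the leading factor gives the value \<open>0\<close>.\<close>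

definition thaler_map :: "real \<Rightarrow> real \<Rightarrow> real" where
  "thaler_map \<gamma> x =
     frac (x * (1 + (x / (1 + x)) powr (\<gamma> - 1) - x powr (\<gamma> - 1)) powr (1 / (1 - \<gamma>)))"

definition thaler_xstar :: "real \<Rightarrow> real" where
  "thaler_xstar \<gamma> =
     (THE x. 0 < x \<and> x < 1 \<and> x powr (1 - \<gamma>) + (1 + x) powr (1 - \<gamma>) = 2)"

definition thaler_Y :: "real \<Rightarrow> real set" where
  "thaler_Y \<gamma> = {thaler_xstar \<gamma> <.. 1}"

definition thaler_h :: "real \<Rightarrow> real \<Rightarrow> real" where
  "thaler_h \<gamma> x = x powr (- \<gamma>) + (x + 1) powr (- \<gamma>)"

definition thaler_mu :: "real \<Rightarrow> real measure" where
  "thaler_mu \<gamma> =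
     density (restrict_space lborel (thaler_Y \<gamma>))
       (\<lambda>x. ennreal ((1 - \<gamma>) / (2 powr (1 - \<gamma>) - 1) * thaler_h \<gamma> x))"

text \<open>
  On the null set of points whose orbit visits \<open>Y\<close> only finitely often, the \<open>LEAST\<close> below
  is an unspecified constant from some index on.
\<close>

fun return_time :: "real \<Rightarrow> nat \<Rightarrow> real \<Rightarrow> nat" where
  "return_time \<gamma> j y =
     (LEAST k. 1 \<le> k \<and>
        (thaler_map \<gamma> ^^ ((\<Sum>i<j. return_time \<gamma> i y) + k)) y \<in> thaler_Y \<gamma>)"

text \<open>The defining equation is unconditional, so it would loop as a rewrite rule.\<close>

declare return_time.simps [simp del]

definition g_const :: "real \<Rightarrow> real" where
  "g_const \<alpha> = Gamma (1 - \<alpha>) * cos (\<alpha> * pi / 2)"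

definition d_const :: "real \<Rightarrow> real" where
  "d_const \<alpha> =
     (let \<gamma> = 1 / \<alpha> in \<alpha> powr \<alpha> * ((1 - \<gamma>) / (2 powr (1 - \<gamma>) - 1)) * g_const \<alpha>)"

definition ell_const :: "real \<Rightarrow> real" where
  "ell_const \<alpha> =
     (let \<gamma> = 1 / \<alpha> in if \<alpha> < 1 then 0 else inverse (1 - 2 powr (\<gamma> - 1)))"

end

theory Submission
  imports Defs "HOL-Real_Asymp.Real_Asymp"
begin

text \<open>
  Write \<open>z\<close> for \<open>pint\<close>, that is \<open>z(x) = (x\<^bsup>1-\<gamma>\<^esup> - 1)/(1 - \<gamma>)\<close>. The map satisfies \<open>z(Tx) = z(x) + z(1 + x)\<close> before reduction modulo 1,
  so the backward orbit \<open>x\<^sub>n\<close> of 1 along the left branch satisfies \<open>z(x\<^sub>n) - z(x\<^sub>n\<^sub>+\<^sub>1) = z(1 + x\<^sub>n\<^sub>+\<^sub>1)\<close>,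
  the return time has the explicit tail \<open>z(1 + x\<^sub>n)/z(2)\<close>, and the tail sums telescope.

  Independence of the return times fails, but read backwards in time they come from a Markov kernel on
  \<open>Y\<close>: from \<open>y\<close>, the return time is \<open>k + 1\<close> with probability \<open>Q\<^sub>k(y) - Q\<^sub>k\<^sub>+\<^sub>1(y)\<close>, and the new point is the
  preimage \<open>\<sigma>\<^sub>k(y)\<close>. This kernel is stochastically monotone, and from both end points of \<open>Y\<close> it crosses a
  common level with positive probability, so the oscillation of a monotone function contracts
  geometrically; no distortion estimate is needed. Hence the characteristic function of the sum differs by \<open>o(1)\<close> from
  the \<open>n\<close>-th power of that of a single term, and the asymptotics of the latter at 0 follow by comparing
  the tail with the coefficients of \<open>(1 - w)\<^bsup>a-1\<^esup>\<close>.
\<close>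

section \<open>Stochastically monotone kernels\<close>

text \<open>The kernel comes from a change of variables. Since \<open>lift\<close> has derivative
  \<open>h x * lift x powr \<gamma>\<close>, it carries the density \<open>h\<close> to
  \<open>z powr (- \<gamma>)\<close>. Modulo 1, the left and right preimages of \<open>z\<close>
  contribute \<open>z powr (- \<gamma>)\<close> and \<open>(1 + z) powr (- \<gamma>)\<close>, which
  add up to \<open>h z\<close> again. So \<open>lprob z\<close> is the conditional probability that
  \<open>z\<close> was reached through the left branch, and a return path read backwards is a run of
  left preimages closed by one right preimage.

  The obstacle is that contraction holds for real monotone functions, while the products to be
  averaged are complex and oscillate. Their increments are therefore dominated by those of a real
  monotone function built with the same kernel. Splitting off one factor then costs a covariance,
  bounded by a constant times the square of \<open>scale\<close> times the truncated mean return
  time from the worst starting point \<open>b\<close>. For \<alpha> > 1 this mean stays bounded, and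
  \<gamma> > 1/2 makes \<open>n\<close> such errors vanish. For \<alpha> < 1 it grows with the
  truncation level, which must therefore be balanced against the probability of truncating.\<close>

text \<open>From \<open>y\<close> an index is chosen that is at least \<open>k\<close> with probability \<open>Q k y\<close>; index \<open>k\<close> leads to \<open>\<sigma> k y\<close>.\<close>

locale monotone_kernel =
  fixes b t :: real and Q \<sigma> :: "nat \<Rightarrow> real \<Rightarrow> real" and e :: real
  assumes b_le_t: "b \<le> t"
    and Q_0: "\<And>y. y \<in> {b..t} \<Longrightarrow> Q 0 y = 1"
    and Q_nonneg: "\<And>k y. y \<in> {b..t} \<Longrightarrow> 0 \<le> Q k y"
    and Q_Suc_le: "\<And>k y. y \<in> {b..t} \<Longrightarrow> Q (Suc k) y \<le> Q k y"
    and Q_lim: "\<And>y. y \<in> {b..t} \<Longrightarrow> (\<lambda>k. Q k y) \<longlonglongrightarrow> 0"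
    and Q_anti: "\<And>k y y'. y \<in> {b..t} \<Longrightarrow> y' \<in> {b..t} \<Longrightarrow> y \<le> y' \<Longrightarrow> Q k y' \<le> Q k y"
    and \<sigma>_in: "\<And>k y. y \<in> {b..t} \<Longrightarrow> \<sigma> k y \<in> {b..t}"
    and \<sigma>_mono: "\<And>k y y'. y \<in> {b..t} \<Longrightarrow> y' \<in> {b..t} \<Longrightarrow> y \<le> y' \<Longrightarrow> \<sigma> k y \<le> \<sigma> k y'"
    and \<sigma>_Suc_le: "\<And>k y. y \<in> {b..t} \<Longrightarrow> \<sigma> (Suc k) y \<le> \<sigma> k y"
    and e_pos: "0 < e"
    and split_bot: "Q 1 b \<le> 1 - e"
    and split_top: "e \<le> Q 1 t"
    and split_point: "\<sigma> 1 t \<le> \<sigma> 0 b"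
begin

abbreviation mass :: "nat \<Rightarrow> real \<Rightarrow> real" where
  "mass k y \<equiv> Q k y - Q (Suc k) y"

definition E :: "(nat \<Rightarrow> real \<Rightarrow> 'a::real_normed_vector) \<Rightarrow> real \<Rightarrow> 'a" where
  "E H y = (\<Sum>k. mass k y *\<^sub>R H k (\<sigma> k y))"

lemma p_nonneg: "y \<in> {b..t} \<Longrightarrow> 0 \<le> Q k y - Q (Suc k) y"
  using Q_Suc_le by simp

lemma p_sums: "y \<in> {b..t} \<Longrightarrow> (\<lambda>k. Q k y - Q (Suc k) y) sums 1"
  using telescope_sums'[OF Q_lim] Q_0 by simp

lemma norm_summable_E:
  fixes H :: "nat \<Rightarrow> real \<Rightarrow> 'a::real_normed_vector"
  assumes H: "\<And>k z. z \<in> {b..t} \<Longrightarrow> norm (H k z) \<le> B" and y: "y \<in> {b..t}"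
  shows "summable (\<lambda>k. norm (mass k y *\<^sub>R H k (\<sigma> k y)))"
proof (rule summable_comparison_test')
  show "summable (\<lambda>k. mass k y * B)"
    using p_sums[OF y] by (intro summable_mult2) (auto simp: sums_iff)
  show "norm (norm (mass k y *\<^sub>R H k (\<sigma> k y))) \<le> mass k y * B" for k
    using H[OF \<sigma>_in[OF y]] p_nonneg[OF y] by (simp add: mult_left_mono)
qed

lemma summable_E:
  fixes H :: "nat \<Rightarrow> real \<Rightarrow> 'a::banach"
  assumes "\<And>k z. z \<in> {b..t} \<Longrightarrow> norm (H k z) \<le> B" "y \<in> {b..t}"
  shows "summable (\<lambda>k. mass k y *\<^sub>R H k (\<sigma> k y))"
  using norm_summable_E[OF assms] by (rule summable_norm_cancel)

lemma norm_E_le: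
  fixes H :: "nat \<Rightarrow> real \<Rightarrow> 'a::banach"
  assumes H: "\<And>k z. z \<in> {b..t} \<Longrightarrow> norm (H k z) \<le> B" and y: "y \<in> {b..t}"
  shows "norm (E H y) \<le> B"
proof -
  have "norm (E H y) \<le> (\<Sum>k. norm (mass k y *\<^sub>R H k (\<sigma> k y)))"
    unfolding E_def by (rule summable_norm[OF norm_summable_E[OF assms]])
  also have "\<dots> \<le> (\<Sum>k. mass k y * B)"
    using H[OF \<sigma>_in[OF y]] p_nonneg[OF y] p_sums[OF y]
    by (intro suminf_le norm_summable_E[OF assms] summable_mult2) (auto simp: sums_iff mult_left_mono)
  also have "\<dots> = B"
    using p_sums[OF y] by (simp add: suminf_mult2[symmetric] sums_iff)
  finally show ?thesis .
qed

lemma E_mono_pointwise: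
  fixes H K :: "nat \<Rightarrow> real \<Rightarrow> real"
  assumes H: "\<And>k z. z \<in> {b..t} \<Longrightarrow> norm (H k z) \<le> B"
    and K: "\<And>k z. z \<in> {b..t} \<Longrightarrow> norm (K k z) \<le> B'"
    and le: "\<And>k. H k (\<sigma> k y) \<le> K k (\<sigma> k y)" and y: "y \<in> {b..t}"
  shows "E H y \<le> E K y"
  unfolding E_def using le p_nonneg[OF y]
  by (intro suminf_le summable_E[OF H y] summable_E[OF K y]) (auto intro: mult_left_mono)

lemma E_add:
  fixes H K :: "nat \<Rightarrow> real \<Rightarrow> 'a::banach"
  assumes H: "\<And>k z. z \<in> {b..t} \<Longrightarrow> norm (H k z) \<le> B"
    and K: "\<And>k z. z \<in> {b..t} \<Longrightarrow> norm (K k z) \<le> B'" and y: "y \<in> {b..t}"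
  shows "E (\<lambda>k z. H k z + K k z) y = E H y + E K y"
  unfolding E_def
  by (subst suminf_add[OF summable_E[OF H y] summable_E[OF K y]]) (auto simp: scaleR_add_right)

text \<open>Monotonicity arguments need real values while the iterates are complex. This carries a
  real functional through a complex expectation, and also embeds real expectations into complex
  ones.\<close>

lemma E_bounded_linear:
  fixes H :: "nat \<Rightarrow> real \<Rightarrow> 'a::banach"
  assumes "bounded_linear T" and H: "\<And>k z. z \<in> {b..t} \<Longrightarrow> norm (H k z) \<le> B" and y: "y \<in> {b..t}"
  shows "T (E H y) = E (\<lambda>k z. T (H k z)) y"
proof -
  interpret T: bounded_linear T by fact
  show ?thesis unfolding E_def
    by (subst T.suminf[OF summable_E[OF H y]]) (simp_all add: T.scaleR)
qed

text \<open>Turns masses into the tail probabilities \<open>Q\<close>, which are the quantities that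
  are monotone in the starting point.\<close>

lemma summation_by_parts:
  fixes c q :: "nat \<Rightarrow> real"
  shows "(\<Sum>k<n. (q k - q (Suc k)) * c k) =
    q 0 * c 0 + (\<Sum>k<n. q (Suc k) * (c (Suc k) - c k)) - q n * c n"
  by (induction n) (auto simp: algebra_simps)

text \<open>From a smaller point the kernel takes stochastically more steps and arrives at a smaller
  point, so expectations of functions of this type decrease in the starting point.\<close>

lemma E_antimono:
  fixes H :: "nat \<Rightarrow> real \<Rightarrow> real"
  assumes H: "\<And>k z. z \<in> {b..t} \<Longrightarrow> norm (H k z) \<le> B"
    and incr: "\<And>k z. z \<in> {b..t} \<Longrightarrow> H k z \<le> H (Suc k) z"
    and decr: "\<And>k z z'. z \<in> {b..t} \<Longrightarrow> z' \<in> {b..t} \<Longrightarrow> z \<le> z' \<Longrightarrow> H k z' \<le> H k z"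
    and y: "y \<in> {b..t}" "y' \<in> {b..t}" "y \<le> y'"
  shows "E H y' \<le> E H y"
proof -
  \<comment> \<open>The comparison goes through an intermediate series with the masses of
    \<open>y'\<close> and the arrival points of \<open>y\<close>: one inequality changes the points,
    the next the masses.\<close>
  define c where "c k = H k (\<sigma> k y)" for k
  \<comment> \<open>Two effects push the same way: \<open>H\<close> grows with the index, and a
    larger index leads to a lower point, where \<open>H\<close> is larger.\<close>
  have c_inc: "c k \<le> c (Suc k)" for k
    unfolding c_def using incr[OF \<sigma>_in[OF y(1)], of k k]
      decr[OF \<sigma>_in[OF y(1)] \<sigma>_in[OF y(1)] \<sigma>_Suc_le[OF y(1)], of "Suc k" k] by linarith
  have c_bd: "norm (c k) \<le> B" for k
    unfolding c_def by (rule H[OF \<sigma>_in[OF y(1)]])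
  have s: "summable (\<lambda>k. mass k x * c k)" if "x \<in> {b..t}" for x
  proof (rule summable_comparison_test')
    show "summable (\<lambda>k. mass k x * B)"
      using p_sums[OF that] by (intro summable_mult2) (auto simp: sums_iff)
    show "norm (mass k x * c k) \<le> mass k x * B" for k
      using c_bd p_nonneg[OF that] by (simp add: abs_mult mult_left_mono)
  qed
  have "E H y' \<le> (\<Sum>k. mass k y' * c k)"
    unfolding E_def using p_nonneg[OF y(2)] decr[OF \<sigma>_in[OF y(1)] \<sigma>_in[OF y(2)] \<sigma>_mono[OF y]]
    by (intro suminf_le s[OF y(2)] summable_E[OF H y(2)]) (auto simp: c_def intro: mult_left_mono)
  also have "\<dots> \<le> (\<Sum>k. mass k y * c k)"
  proof (rule LIMSEQ_le)
    show "(\<lambda>n. \<Sum>k<n. mass k y' * c k) \<longlonglongrightarrow> (\<Sum>k. mass k y' * c k)"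
      by (rule summable_LIMSEQ[OF s[OF y(2)]])
    \<comment> \<open>The additional term pays for the boundary terms of both summations by parts
      and vanishes in the limit.\<close>
    have "(\<lambda>n. (\<Sum>k<n. mass k y * c k) + (Q n y + Q n y') * B)
       \<longlonglongrightarrow> (\<Sum>k. mass k y * c k) + (0 + 0) * B"
      by (intro tendsto_intros summable_LIMSEQ s Q_lim y)
    then show "(\<lambda>n. (\<Sum>k<n. mass k y * c k) + (Q n y + Q n y') * B)
       \<longlonglongrightarrow> (\<Sum>k. mass k y * c k)" by simp
    have "(\<Sum>k<n. mass k y' * c k) \<le>
        (\<Sum>k<n. mass k y * c k) + (Q n y + Q n y') * B" for n
    proof -
      have "(\<Sum>k<n. Q (Suc k) y' * (c (Suc k) - c k)) \<le> (\<Sum>k<n. Q (Suc k) y * (c (Suc k) - c k))"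
        using c_inc Q_anti[OF y] by (intro sum_mono mult_right_mono) auto
      moreover have bd: "\<bar>Q n x * c n\<bar> \<le> Q n x * B" if "x \<in> {b..t}" for x
        using c_bd[of n] Q_nonneg[OF that, of n] by (simp add: abs_mult mult_left_mono)
      ultimately show ?thesis
        using bd[OF y(1)] bd[OF y(2)] summation_by_parts[of "\<lambda>k. Q k y" c n]
          summation_by_parts[of "\<lambda>k. Q k y'" c n] Q_0[OF y(1)] Q_0[OF y(2)]
        unfolding distrib_right by simp
    qed
    then show "\<exists>N. \<forall>n\<ge>N. (\<Sum>k<n. mass k y' * c k) \<le>
        (\<Sum>k<n. mass k y * c k) + (Q n y + Q n y') * B" by blast
  qed
  also have "\<dots> = E H y" by (simp add: E_def c_def)
  finally show ?thesis .
qed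

text \<open>With probability at least \<open>e\<close> the kernel moves the bottom point above \<open>\<sigma> 0 b\<close>, and with
  probability at least \<open>e\<close> it moves the top point below it.\<close>

lemma E_osc_contraction:
  fixes u :: "real \<Rightarrow> real"
  assumes u: "\<And>z. z \<in> {b..t} \<Longrightarrow> norm (u z) \<le> B"
    and decr: "\<And>z z'. z \<in> {b..t} \<Longrightarrow> z' \<in> {b..t} \<Longrightarrow> z \<le> z' \<Longrightarrow> u z' \<le> u z"
  shows "E (\<lambda>_. u) b - E (\<lambda>_. u) t \<le> (1 - e) * (u b - u t)"
proof -
  define c where "c = \<sigma> 0 b"
  have bt: "b \<in> {b..t}" "t \<in> {b..t}" using b_le_t by auto
  have cin: "c \<in> {b..t}" unfolding c_def by (rule \<sigma>_in) (use bt in auto)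
  have sm: "summable (\<lambda>k. Q (Suc k) y - Q (Suc (Suc k)) y)"
    and sm': "(\<Sum>k. Q (Suc k) y - Q (Suc (Suc k)) y) = Q 1 y" if "y \<in> {b..t}" for y
    using telescope_sums'[OF LIMSEQ_Suc[OF Q_lim[OF that]]] by (auto simp: sums_iff)
  have spl: "E (\<lambda>_. u) y = (1 - Q 1 y) * u (\<sigma> 0 y) +
      (\<Sum>k. mass (Suc k) y * u (\<sigma> (Suc k) y))"
    and sm2: "summable (\<lambda>k. mass (Suc k) y * u (\<sigma> (Suc k) y))"
    if "y \<in> {b..t}" for y
  proof -
    have s: "summable (\<lambda>k. mass k y * u (\<sigma> k y))"
      using summable_E[of "\<lambda>_. u", OF u that] by simp
    show "E (\<lambda>_. u) y = (1 - Q 1 y) * u (\<sigma> 0 y) +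
      (\<Sum>k. mass (Suc k) y * u (\<sigma> (Suc k) y))"
      unfolding E_def using suminf_split_head[OF s] Q_0[OF that] by simp
    show "summable (\<lambda>k. mass (Suc k) y * u (\<sigma> (Suc k) y))"
      using s by (subst (asm) summable_Suc_iff[symmetric])
  qed
  have "(\<Sum>k. mass (Suc k) b * u (\<sigma> (Suc k) b))
     \<le> (\<Sum>k. mass (Suc k) b * u b)"
    using decr[OF bt(1) \<sigma>_in[OF bt(1)]] \<sigma>_in[OF bt(1)] p_nonneg[OF bt(1)]
    by (intro suminf_le sm2 bt summable_mult2 sm mult_left_mono) auto
  also have "\<dots> = Q 1 b * u b"
    by (subst suminf_mult2[symmetric]) (use sm sm' bt in auto)
  finally have "E (\<lambda>_. u) b \<le> (1 - Q 1 b) * u c + Q 1 b * u b"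
    unfolding spl[OF bt(1)] c_def by simp
  also have "\<dots> = u b - (1 - Q 1 b) * (u b - u c)" by (simp add: algebra_simps)
  also have "\<dots> \<le> u b - e * (u b - u c)"
    using decr[OF bt(1) cin] cin split_bot by (intro diff_left_mono mult_right_mono) auto
  finally have 1: "E (\<lambda>_. u) b \<le> u b - e * (u b - u c)" .
  have below: "\<sigma> (Suc k) t \<le> c" for k
  proof (induction k)
    case 0 then show ?case using split_point by (simp add: c_def)
  next
    case (Suc k) then show ?case using \<sigma>_Suc_le[OF bt(2), of "Suc k"] by linarith
  qed
  have "Q 1 t * u c = (\<Sum>k. mass (Suc k) t * u c)"
    by (subst suminf_mult2[symmetric]) (use sm sm' bt in auto)
  also have "\<dots> \<le> (\<Sum>k. mass (Suc k) t * u (\<sigma> (Suc k) t))"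
    using decr[OF \<sigma>_in[OF bt(2)] cin below] p_nonneg[OF bt(2)]
    by (intro suminf_le sm2 bt summable_mult2 sm mult_left_mono) auto
  finally have "E (\<lambda>_. u) t \<ge> (1 - Q 1 t) * u (\<sigma> 0 t) + Q 1 t * u c"
    unfolding spl[OF bt(2)] by simp
  moreover have "(1 - Q 1 t) * u (\<sigma> 0 t) \<ge> (1 - Q 1 t) * u t"
    using decr[OF \<sigma>_in[OF bt(2)] bt(2)] \<sigma>_in[OF bt(2)] p_nonneg[OF bt(2), of 0] Q_0[OF bt(2)]
    by (intro mult_left_mono) auto
  moreover have "Q 1 t * (u c - u t) \<ge> e * (u c - u t)"
    using decr[OF cin bt(2)] cin split_top by (intro mult_right_mono) auto
  \<comment> \<open>The level \<open>c\<close> is common to both bounds, so \<open>u c\<close>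
    cancels and only \<open>u b - u t\<close> remains.\<close>
  ultimately show ?thesis using 1 by (simp add: algebra_simps)
qed

text \<open>The mean of the product of \<open>g\<close> over the indices of \<open>m\<close>
  successive kernel steps. For \<open>g\<close> a character this is a characteristic function of the
  sum of the indices.\<close>

primrec iter :: "(nat \<Rightarrow> complex) \<Rightarrow> nat \<Rightarrow> real \<Rightarrow> complex" where
  "iter g 0 = (\<lambda>_. 1)"
| "iter g (Suc m) = E (\<lambda>k z. g k * iter g m z)"

lemma norm_iter_le:
  assumes "\<And>k. norm (g k) \<le> 1" "y \<in> {b..t}"
  shows "norm (iter g m y) \<le> 1"
  using assms(2)
proof (induction m arbitrary: y)
  case (Suc m)
  then show ?case
    using assms(1) unfolding iter.simps
    by (intro norm_E_le) (auto simp: norm_mult intro!: mult_le_one)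
qed simp

text \<open>The increments of \<open>iter g m\<close> are dominated by those of the decreasing function \<open>D\<close> that follows the
  same recursion additively, with \<open>G\<close> in place of \<open>g\<close>.\<close>

lemma iter_osc:
  assumes g: "\<And>k. norm (g k) \<le> 1"
    and G: "\<And>k. norm (g (Suc k) - g k) \<le> G (Suc k) - G k"
    and G0: "\<And>k. 0 \<le> G k" and GB: "\<And>k. G k \<le> B"
    and y: "y \<in> {b..t}" "y' \<in> {b..t}"
  shows "norm (iter g m y - iter g m y') \<le> E (\<lambda>k _. G k) b / e"
proof -
  have bt: "b \<in> {b..t}" "t \<in> {b..t}" using b_le_t by auto
  \<comment> \<open>\<open>D m z\<close> is the expected sum of \<open>G\<close> over
    \<open>m\<close> kernel steps from \<open>z\<close>. The recursor is needed because
    \<open>D\<close> is local to the proof.\<close>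
  define D where "D = rec_nat (\<lambda>_. 0 :: real) (\<lambda>_ d. E (\<lambda>k z. G k + d z))"
  have D_0: "D 0 = (\<lambda>_. 0)" and D_Suc: "D (Suc m) = E (\<lambda>k z. G k + D m z)" for m
    by (auto simp: D_def)
  have G_bd: "norm (G k) \<le> B" for k using G0[of k] GB[of k] by auto
  have G_inc: "G k \<le> G (Suc k)" for k using order_trans[OF norm_ge_zero G[of k]] by simp
  have D_bd: "norm (D m z) \<le> real m * B" if "z \<in> {b..t}" for m z
    using that
  proof (induction m arbitrary: z)
    case (Suc m)
    have "norm (G k + D m z) \<le> real (Suc m) * B" if "z \<in> {b..t}" for k z
      using norm_triangle_ineq[of "G k" "D m z"] G_bd[of k] Suc.IH[OF that] by (simp add: algebra_simps)
    then show ?case unfolding D_Suc using Suc.prems by (intro norm_E_le) auto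
  qed (simp add: D_0)
  have GD_bd: "norm (G k + D m z) \<le> B + real m * B" if "z \<in> {b..t}" for k m z
    using norm_triangle_ineq[of "G k" "D m z"] G_bd[of k] D_bd[OF that, of m] by linarith
  have D_anti: "D m z' \<le> D m z" if "z \<in> {b..t}" "z' \<in> {b..t}" "z \<le> z'" for m z z'
    using that
  proof (induction m arbitrary: z z')
    case (Suc m)
    show ?case unfolding D_Suc
      by (rule E_antimono[where B="B + real m * B"]) (use GD_bd G_inc Suc in auto)
  qed (simp add: D_0)
  have EG: "0 \<le> E (\<lambda>k _. G k) z" if "z \<in> {b..t}" for z
    using E_mono_pointwise[of "\<lambda>_ _. 0" 0 "\<lambda>k _. G k" B z] G0 G_bd that by (simp add: E_def)
  \<comment> \<open>One step adds at most the mean of \<open>G\<close> from \<open>b\<close> and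
    shrinks the earlier oscillation by \<open>1 - e\<close>; the geometric series gives the division
    by \<open>e\<close>.\<close>
  have D_osc: "D m b - D m t \<le> E (\<lambda>k _. G k) b / e" for m
  proof (induction m)
    case 0 then show ?case using EG[OF bt(1)] e_pos by (simp add: D_0)
  next
    case (Suc m)
    have DD: "D (Suc m) z = E (\<lambda>k _. G k) z + E (\<lambda>_. D m) z" if "z \<in> {b..t}" for z
      unfolding D_Suc by (rule E_add[OF _ _ that]) (use G_bd D_bd in auto)
    have "e \<le> 1" using split_top Q_Suc_le[OF bt(2), of 0] Q_0[OF bt(2)] by simp
    have "D (Suc m) b - D (Suc m) t \<le> E (\<lambda>k _. G k) b + (E (\<lambda>_. D m) b - E (\<lambda>_. D m) t)"
      using EG[OF bt(2)] unfolding DD[OF bt(1)] DD[OF bt(2)] by linarith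
    also have "\<dots> \<le> E (\<lambda>k _. G k) b + (1 - e) * (D m b - D m t)"
      by (intro add_left_mono E_osc_contraction[of _ "real m * B"] D_bd D_anti)
    also have "\<dots> \<le> E (\<lambda>k _. G k) b + (1 - e) * (E (\<lambda>k _. G k) b / e)"
      using Suc.IH \<open>e \<le> 1\<close> by (intro add_left_mono mult_left_mono) auto
    also have "\<dots> = E (\<lambda>k _. G k) b / e" using e_pos by (simp add: field_simps)
    finally show ?case .
  qed
  have dom: "norm (iter g m z - iter g m z') \<le> D m z - D m z'"
    if "z \<in> {b..t}" "z' \<in> {b..t}" "z \<le> z'" for m z z'
    using that
  proof (induction m arbitrary: z z')
    case (Suc m)
    \<comment> \<open>Rotating by the conjugate phase of the difference turns its norm into the
      value of a real functional, so the complex bound becomes monotonicity of a single real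
      function.\<close>
    define u where "u = cnj (sgn (iter g (Suc m) z - iter g (Suc m) z'))"
    have u: "norm u \<le> 1" by (simp add: u_def norm_sgn)
    have u_eq: "Re (u * (iter g (Suc m) z - iter g (Suc m) z')) = norm (iter g (Suc m) z - iter g (Suc m) z')"
    proof -
      have "cnj (sgn c) * c = of_real (norm c)" for c :: complex
      proof (cases "c = 0")
        case False
        then show ?thesis
          using complex_norm_square[of c]
          by (simp add: sgn_div_norm scaleR_conv_of_real power2_eq_square field_simps)
      qed simp
      then show ?thesis unfolding u_def by (metis Re_complex_of_real)
    qed
    define T where "T c = - Re (u * c)" for c
    have T_lin: "bounded_linear T" unfolding T_def
      by (intro bounded_linear_minus bounded_linear_compose[OF bounded_linear_Re] bounded_linear_mult_right)
    have T_le: "norm (T c) \<le> norm c" for c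
    proof -
      have "norm (T c) \<le> norm (u * c)" unfolding T_def real_norm_def abs_minus_cancel by (rule abs_Re_le_cmod)
      also have "\<dots> \<le> norm c" using u by (simp add: norm_mult mult_left_le_one_le)
      finally show ?thesis .
    qed
    have T_diff: "T c - T c' \<le> norm (c - c')" for c c'
    proof -
      have "T c - T c' = T (c - c')" by (simp add: T_def algebra_simps)
      then show ?thesis using T_le[of "c - c'"] by simp
    qed
    have gi: "norm (g k * iter g m x) \<le> 1" if "x \<in> {b..t}" for k x
      using g norm_iter_le[OF g that] by (auto simp: norm_mult intro!: mult_le_one)
    \<comment> \<open>The summand \<open>G k + D m x\<close> outweighs the fluctuation of
      \<open>g k * iter g m x\<close> in both variables, which is what \<open>E_antimono\<close>
      asks for.\<close>
    define H where "H k x = (G k + D m x) + T (g k * iter g m x)" for k x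
    have H_bd: "norm (H k x) \<le> (B + real m * B) + 1" if "x \<in> {b..t}" for k x
      unfolding H_def using GD_bd[OF that, of k m] order_trans[OF T_le gi[OF that, of k]] 
        norm_triangle_ineq[of "G k + D m x" "T (g k * iter g m x)"] by linarith
    have EH: "E H x = D (Suc m) x + T (iter g (Suc m) x)" if "x \<in> {b..t}" for x
    proof -
      have "E H x = E (\<lambda>k x. G k + D m x) x + E (\<lambda>k x. T (g k * iter g m x)) x"
        unfolding H_def
        by (rule E_add[where B="B + real m * B" and B'=1]) (use GD_bd order_trans[OF T_le gi] that in auto)
      then show ?thesis
        using E_bounded_linear[OF T_lin gi that] by (simp add: D_Suc)
    qed
    have "E H z' \<le> E H z"
    proof (rule E_antimono[OF H_bd])
      fix k x assume x: "x \<in> {b..t}"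
      have "norm (g k * iter g m x - g (Suc k) * iter g m x) \<le> G (Suc k) - G k"
        using G[of k] norm_iter_le[OF g x, where m=m] norm_minus_commute[of "g k" "g (Suc k)"]
          mult_mono[of "norm (g (Suc k) - g k)" "G (Suc k) - G k" "norm (iter g m x)" 1] G_inc[of k]
        by (simp add: left_diff_distrib[symmetric] norm_mult)
      then show "H k x \<le> H (Suc k) x"
        using T_diff[of "g k * iter g m x" "g (Suc k) * iter g m x"] unfolding H_def by linarith
    next
      fix k x x' assume x: "x \<in> {b..t}" "x' \<in> {b..t}" "x \<le> x'"
      have "norm (g k * iter g m x' - g k * iter g m x) \<le> norm (iter g m x - iter g m x')"
        using g[of k] by (simp add: right_diff_distrib[symmetric] norm_mult mult_left_le_one_le norm_minus_commute)
      then show "H k x' \<le> H k x"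
        using T_diff[of "g k * iter g m x'" "g k * iter g m x"] Suc.IH[OF x] unfolding H_def by linarith
    qed (use Suc.prems in auto)
    then have "T (iter g (Suc m) z') - T (iter g (Suc m) z) \<le> D (Suc m) z - D (Suc m) z'"
      using EH Suc.prems by simp
    moreover have "T (iter g (Suc m) z') - T (iter g (Suc m) z) = norm (iter g (Suc m) z - iter g (Suc m) z')"
      using u_eq by (simp add: T_def right_diff_distrib)
    ultimately show ?case by simp
  qed (simp add: D_0)
  have main: "norm (iter g m z - iter g m z') \<le> E (\<lambda>k _. G k) b / e"
    if "z \<in> {b..t}" "z' \<in> {b..t}" "z \<le> z'" for z z'
  proof -
    have "D m z \<le> D m b" "D m t \<le> D m z'" using that bt by (auto intro!: D_anti)
    then show ?thesis using dom[OF that, of m] D_osc[of m] by linarith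
  qed
  show ?thesis
  proof (cases "y \<le> y'")
    case True then show ?thesis using main y by blast
  next
    case False then show ?thesis using main[OF y(2,1)] by (simp add: norm_minus_commute)
  qed
qed

text \<open>A truncated mean is a sum of tail probabilities, because \<open>min (Suc k) M\<close>
  counts the \<open>j < M\<close> with \<open>j \<le> k\<close>.\<close>

lemma E_min:
  assumes "y \<in> {b..t}"
  shows "E (\<lambda>k _. s * real (min (Suc k) M)) y = s * (\<Sum>k<M. Q k y)"
proof -
  have tail: "(\<lambda>k. mass k y * (if j \<le> k then 1 else 0)) sums Q j y" for j
  proof -
    have "(\<lambda>k. Q (k + j) y - Q (Suc (k + j)) y) sums Q j y"
      using telescope_sums'[of "\<lambda>k. Q (k + j) y" 0] LIMSEQ_ignore_initial_segment[OF Q_lim[OF assms]]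
      by simp
    then have "(\<lambda>k. (\<lambda>k. mass k y * (if j \<le> k then 1 else 0)) (k + j)) sums Q j y"
      by simp
    then show ?thesis by (subst (asm) sums_iff_shift) simp
  qed
  have "(\<lambda>k. \<Sum>j<M. mass k y * (if j \<le> k then 1 else 0)) sums (\<Sum>j<M. Q j y)"
    by (intro sums_sum tail)
  moreover have "(\<Sum>j<M. mass k y * (if j \<le> k then 1 else 0)) =
      mass k y * real (min (Suc k) M)" for k
  proof -
    have "(\<Sum>j<M. if j \<le> k then 1 else (0::real)) = real (card ({..<M} \<inter> {j. j \<le> k}))"
      by (simp add: sum.If_cases)
    also have "{..<M} \<inter> {j. j \<le> k} = {..<min (Suc k) M}" by auto
    finally show ?thesis by (simp add: sum_distrib_left[symmetric])
  qed
  ultimately have "(\<lambda>k. s * (mass k y * real (min (Suc k) M))) sums (s * (\<Sum>j<M. Q j y))"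
    by (intro sums_mult) simp
  then show ?thesis unfolding E_def by (simp add: sums_iff mult_ac)
qed

end

section \<open>Characteristic functions of distributions with regularly varying tails\<close>

text \<open>Eventually the increments of \<open>x n - L * y n\<close> are at most
  \<open>r / 2\<close> times those of \<open>y\<close>; the initial error is swallowed by the growth
  of \<open>y\<close>.\<close>

lemma stolz_cesaro:
  fixes x y :: "nat \<Rightarrow> real"
  assumes mono: "\<And>n. y n < y (Suc n)" and top: "filterlim y at_top sequentially"
    and lim: "(\<lambda>n. (x (Suc n) - x n) / (y (Suc n) - y n)) \<longlonglongrightarrow> L"
  shows "(\<lambda>n. x n / y n) \<longlonglongrightarrow> L"
proof (rule LIMSEQ_I)
  fix r :: real assume r: "r > 0"
  define d where "d n = x n - L * y n" for n
  from lim r obtain N where N: "\<And>n. n \<ge> N \<Longrightarrow> \<bar>(x (Suc n) - x n) / (y (Suc n) - y n) - L\<bar> < r / 2"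
    using LIMSEQ_D[OF lim, of "r / 2"] by auto
  have incr: "\<bar>d (Suc n) - d n\<bar> \<le> r / 2 * (y (Suc n) - y n)" if "n \<ge> N" for n
  proof -
    have pos: "y (Suc n) - y n > 0" using mono[of n] by simp
    have "d (Suc n) - d n = ((x (Suc n) - x n) / (y (Suc n) - y n) - L) * (y (Suc n) - y n)"
      using pos by (simp add: d_def field_simps)
    then have "\<bar>d (Suc n) - d n\<bar> = \<bar>(x (Suc n) - x n) / (y (Suc n) - y n) - L\<bar> * (y (Suc n) - y n)"
      using pos by (simp add: abs_mult)
    then show ?thesis using N[OF that] pos by (simp add: mult_right_mono)
  qed
  have bound: "\<bar>d n\<bar> \<le> \<bar>d N\<bar> + r / 2 * (y n - y N)" if "n \<ge> N" for n
    using that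
  proof (induction n rule: dec_induct)
    case (step n)
    have "\<bar>d (Suc n)\<bar> \<le> \<bar>d n\<bar> + \<bar>d (Suc n) - d n\<bar>" by linarith
    also have "\<dots> \<le> \<bar>d N\<bar> + r / 2 * (y n - y N) + r / 2 * (y (Suc n) - y n)"
      using step by (intro add_mono incr) auto
    finally show ?case by (simp add: algebra_simps diff_divide_distrib)
  qed simp
  define C where "C = \<bar>d N\<bar> + r / 2 * \<bar>y N\<bar>"
  have "eventually (\<lambda>n. y n > max 1 (2 * C / r)) sequentially"
    using top unfolding filterlim_at_top_dense by blast
  then obtain N' where N': "\<And>n. n \<ge> N' \<Longrightarrow> y n > max 1 (2 * C / r)"
    by (auto simp: eventually_sequentially)
  have "norm (x n / y n - L) < r" if "n \<ge> max N N'" for n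
  proof -
    have y: "y n > 1" "y n > 2 * C / r" using N'[of n] that by auto
    have "\<bar>d n\<bar> \<le> C + r / 2 * y n"
      using bound[of n] that r abs_ge_minus_self[of "y N"]
        mult_left_mono[of "- y N" "\<bar>y N\<bar>" "r / 2"] unfolding C_def right_diff_distrib by linarith
    also have "\<dots> < r * y n" using y r by (simp add: field_simps)
    finally have "\<bar>d n\<bar> / y n < r" using y by (simp add: field_simps)
    moreover have "x n / y n - L = d n / y n" using y by (simp add: d_def field_simps)
    ultimately show ?thesis using y by simp
  qed
  then show "\<exists>no. \<forall>n\<ge>no. norm (x n / y n - L) < r" by blast
qed

text \<open>For the distribution on the positive integers with tail \<open>F\<close>, so that \<open>k + 1\<close> has mass
  \<open>F k - F (k + 1)\<close>, this is one minus the characteristic function.\<close>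

definition char_defect :: "(nat \<Rightarrow> real) \<Rightarrow> real \<Rightarrow> complex" where
  "char_defect F s = (\<Sum>k. (F k - F (Suc k)) *\<^sub>R (1 - cis s ^ Suc k))"

lemma norm_cis_diff_le: "norm (cis x - cis y) \<le> \<bar>x - y\<bar>"
proof -
  have "cis x - cis y = cis y * (cis (x - y) - 1)"
    by (simp add: algebra_simps cis_mult)
  then have "norm (cis x - cis y) = norm (exp (\<i> * of_real (x - y)) - 1)"
    by (simp add: norm_mult cis_conv_exp)
  also have "\<dots> \<le> \<bar>x - y\<bar>"
    unfolding dist_exp_i_1 using abs_sin_x_le_abs_x[of "(x - y) / 2"] by simp
  finally show ?thesis .
qed

lemma char_defect_summable:
  assumes "decseq F" "F \<longlonglongrightarrow> 0"
  shows "summable (\<lambda>k. norm ((F k - F (Suc k)) *\<^sub>R (1 - cis s ^ Suc k)))"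
proof (rule summable_comparison_test')
  show "summable (\<lambda>k. (F k - F (Suc k)) * 2)"
    using telescope_summable'[OF assms(2)] by (intro summable_mult2)
  fix k
  have le2: "norm (1 - cis s ^ Suc k) \<le> 2"
    using norm_triangle_ineq4[of 1 "cis s ^ Suc k"] by (simp only: norm_power norm_cis) simp
  show "norm (norm ((F k - F (Suc k)) *\<^sub>R (1 - cis s ^ Suc k))) \<le> (F k - F (Suc k)) * 2"
    using mult_left_mono[OF le2, of "F k - F (Suc k)"] decseq_SucD[OF assms(1), of k]
    by (simp del: power_Suc)
qed

text \<open>The series is cut at \<open>N\<close>. Below the cut, summation by parts exploits that
  consecutive powers of \<open>cis s\<close> differ by at most \<open>s\<close>; above it, each term
  is at most twice its mass. The factor 4 collects 2 from the boundary term and 2 from the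
  remainder.\<close>

lemma char_defect_diff_le:
  assumes F: "decseq F" "F \<longlonglongrightarrow> 0" "\<And>k. 0 \<le> F k"
    and A: "decseq A" "A \<longlonglongrightarrow> 0" "\<And>k. 0 \<le> A k"
    and c: "0 \<le> c" and s: "0 \<le> s"
  shows "norm (char_defect F s - c * char_defect A s) \<le>
    s * (\<Sum>k<N. \<bar>F k - c * A k\<bar>) + 4 * (F N + c * A N)"
proof -
  define d where "d k = F k - c * A k" for k
  define u where "u k = 1 - cis s ^ k" for k
  have u0: "u 0 = 0" and u2: "norm (u k) \<le> 2" for k
    using norm_triangle_ineq4[of 1 "cis s ^ k"] by (auto simp: u_def norm_power)
  have u_diff: "norm (u (Suc k) - u k) \<le> s" for k
    using norm_cis_diff_le[of "real k * s" "real (Suc k) * s"] s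
    unfolding u_def Complex.DeMoivre by (simp add: algebra_simps)
  have sF: "summable (\<lambda>k. (F k - F (Suc k)) *\<^sub>R u (Suc k))"
    unfolding u_def by (rule summable_norm_cancel[OF char_defect_summable[OF F(1,2)]])
  have sA: "summable (\<lambda>k. (A k - A (Suc k)) *\<^sub>R u (Suc k))"
    unfolding u_def by (rule summable_norm_cancel[OF char_defect_summable[OF A(1,2)]])
  have sd: "summable (\<lambda>k. (d k - d (Suc k)) *\<^sub>R u (Suc k))"
    and eq: "char_defect F s - c * char_defect A s = (\<Sum>k. (d k - d (Suc k)) *\<^sub>R u (Suc k))"
  proof -
    have "(\<lambda>k. (F k - F (Suc k)) *\<^sub>R u (Suc k) - c * ((A k - A (Suc k)) *\<^sub>R u (Suc k)))
      sums (char_defect F s - c * char_defect A s)"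
      unfolding char_defect_def u_def[symmetric]
      by (intro sums_diff sums_mult summable_sums sF sA)
    moreover have "(F k - F (Suc k)) *\<^sub>R u (Suc k) - c * ((A k - A (Suc k)) *\<^sub>R u (Suc k))
      = (d k - d (Suc k)) *\<^sub>R u (Suc k)" for k
      by (simp add: d_def scaleR_conv_of_real algebra_simps)
    ultimately show "summable (\<lambda>k. (d k - d (Suc k)) *\<^sub>R u (Suc k))"
      "char_defect F s - c * char_defect A s = (\<Sum>k. (d k - d (Suc k)) *\<^sub>R u (Suc k))"
      by (auto simp: sums_iff)
  qed
  have parts: "(\<Sum>k<N. (d k - d (Suc k)) *\<^sub>R u (Suc k)) =
      (\<Sum>k<N. d k *\<^sub>R (u (Suc k) - u k)) - d N *\<^sub>R u N" for N
    by (induction N) (auto simp: u0 algebra_simps)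
  have "norm (\<Sum>k<N. d k *\<^sub>R (u (Suc k) - u k)) \<le> (\<Sum>k<N. \<bar>d k\<bar> * s)"
    using u_diff by (intro sum_norm_le) (simp add: mult_left_mono)
  moreover have "norm (d N *\<^sub>R u N) \<le> (F N + c * A N) * 2"
  proof -
    have "\<bar>d N\<bar> \<le> F N + c * A N"
      using F(3)[of N] A(3)[of N] c mult_nonneg_nonneg[OF c A(3)[of N]] by (auto simp: d_def abs_le_iff)
    from mult_mono[OF this u2[of N]] this show ?thesis by (simp add: abs_le_iff)
  qed
  ultimately have 1: "norm (\<Sum>k<N. (d k - d (Suc k)) *\<^sub>R u (Suc k)) \<le>
      s * (\<Sum>k<N. \<bar>d k\<bar>) + 2 * (F N + c * A N)"
    unfolding parts using norm_triangle_ineq4[of "\<Sum>k<N. d k *\<^sub>R (u (Suc k) - u k)" "d N *\<^sub>R u N"]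
    by (simp add: sum_distrib_left mult.commute)
  define e where "e k = (F k - F (Suc k)) + c * (A k - A (Suc k))" for k
  have "(\<lambda>k. F (k + N) - F (Suc (k + N))) sums F N" "(\<lambda>k. A (k + N) - A (Suc (k + N))) sums A N"
    using telescope_sums'[OF LIMSEQ_ignore_initial_segment[OF F(2), of N]]
      telescope_sums'[OF LIMSEQ_ignore_initial_segment[OF A(2), of N]] by simp_all
  then have "(\<lambda>k. e (k + N)) sums (F N + c * A N)"
    unfolding e_def by (intro sums_add sums_mult)
  then have e: "summable (\<lambda>k. e (k + N) * 2)" "(\<Sum>k. e (k + N) * 2) = 2 * (F N + c * A N)"
    by (auto simp: sums_iff intro: summable_mult2 simp flip: suminf_mult2)
  have le: "norm ((d (k + N) - d (Suc (k + N))) *\<^sub>R u (Suc (k + N))) \<le> e (k + N) * 2" for k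
  proof -
    have "0 \<le> c * (A (k + N) - A (Suc (k + N)))"
      using c decseq_SucD[OF A(1), of "k + N"] by simp
    then have "\<bar>d (k + N) - d (Suc (k + N))\<bar> \<le> e (k + N)"
      using decseq_SucD[OF F(1), of "k + N"] unfolding d_def e_def right_diff_distrib by linarith
    then show ?thesis using u2[of "Suc (k + N)"] unfolding norm_scaleR
      by (intro mult_mono) auto
  qed
  have "norm (\<Sum>k. (d (k + N) - d (Suc (k + N))) *\<^sub>R u (Suc (k + N))) \<le> (\<Sum>k. e (k + N) * 2)"
    by (rule norm_suminf_le[OF le e(1)])
  then have 2: "norm (\<Sum>k. (d (k + N) - d (Suc (k + N))) *\<^sub>R u (Suc (k + N))) \<le> 2 * (F N + c * A N)"
    unfolding e(2) .
  have "char_defect F s - c * char_defect A s = (\<Sum>k. (d (k + N) - d (Suc (k + N))) *\<^sub>R u (Suc (k + N)))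
      + (\<Sum>k<N. (d k - d (Suc k)) *\<^sub>R u (Suc k))"
    unfolding eq using suminf_split_initial_segment[OF sd, of N] by simp
  then show ?thesis
    using norm_triangle_le[OF add_mono[OF 2 1]] by (simp add: d_def)
qed

text \<open>For \<open>a\<close> between 0 and 1 this is the tail of the Sibuya distribution, whose
  generating function is one minus the \<open>a\<close>-th power of \<open>1 - z\<close>. It is the
  model with an exactly known characteristic function.\<close>

definition binom_tail :: "real \<Rightarrow> nat \<Rightarrow> real" where
  "binom_tail a k = (-1) ^ k * ((a - 1) gchoose k)"

lemma binom_tail_0: "binom_tail a 0 = 1"
  by (simp add: binom_tail_def)

lemma binom_tail_Suc: "binom_tail a (Suc k) = binom_tail a k * ((real k + 1 - a) / (real k + 1))"
proof -
  have "real (Suc k) * ((a - 1) gchoose Suc k) = (a - 1 - real k) * ((a - 1) gchoose k)"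
    using gbinomial_mult_1[of "a - 1" k] unfolding left_diff_distrib by simp
  then have "((a - 1) gchoose Suc k) = (a - 1 - real k) / (real k + 1) * ((a - 1) gchoose k)"
    by (simp add: field_simps)
  moreover have "(-1) ^ Suc k * (x / r * b) = (-1) ^ k * b * (- x / r)" for x b r :: real by simp
  ultimately show ?thesis unfolding binom_tail_def by (simp only: minus_diff_eq) (simp add: algebra_simps)
qed

lemma binom_tail_diff: "binom_tail a k - binom_tail a (Suc k) = (-1) ^ k * (a gchoose Suc k)"
  using gbinomial_Suc_Suc[of "a - 1" k] by (simp add: binom_tail_def algebra_simps)

lemma binom_tail_asymp:
  "(\<lambda>k. binom_tail a k * real k powr a) \<longlonglongrightarrow> inverse (Gamma (1 - a))"
proof (rule Lim_transform_eventually)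
  show "(\<lambda>n. ((a - 1) gchoose n) / ((-1)^n / exp ((a - 1 + 1) * of_real (ln (real n))))) \<longlonglongrightarrow>
           inverse (Gamma (1 - a))"
    using gbinomial_asymptotic[of "a - 1"] by simp
  show "eventually (\<lambda>n. ((a - 1) gchoose n) / ((-1)^n / exp ((a - 1 + 1) * of_real (ln (real n)))) =
      binom_tail a n * real n powr a) sequentially"
    using eventually_gt_at_top[of 0]
    by eventually_elim (simp add: binom_tail_def powr_def field_simps)
qed

context
  fixes a :: real assumes a: "0 < a" "a < 1"
begin

lemma binom_tail_pos: "binom_tail a k > 0"
  by (induction k) (use a in \<open>auto simp: binom_tail_0 binom_tail_Suc intro!: mult_pos_pos divide_pos_pos\<close>)

lemma decseq_binom_tail: "decseq (binom_tail a)"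
proof (rule decseq_SucI)
  show "binom_tail a (Suc k) \<le> binom_tail a k" for k
    unfolding binom_tail_Suc using binom_tail_pos[of k] a
    by (intro mult_left_le) (auto simp: field_simps)
qed

end

lemma tendsto_0_of_powr_mult:
  fixes F :: "nat \<Rightarrow> real"
  assumes "0 < a" "(\<lambda>k. F k * real k powr a) \<longlonglongrightarrow> c"
  shows "F \<longlonglongrightarrow> 0"
proof (rule Lim_transform_eventually)
  have "(\<lambda>k. real k powr (- a)) \<longlonglongrightarrow> 0" using assms(1) by real_asymp
  then show "(\<lambda>k. F k * real k powr a * real k powr (- a)) \<longlonglongrightarrow> 0"
    using tendsto_mult[OF assms(2)] by fastforce
  show "eventually (\<lambda>k. F k * real k powr a * real k powr (- a) = F k) sequentially"
    using eventually_gt_at_top[of 0] by eventually_elim (simp add: powr_minus field_simps)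
qed

text \<open>The binomial series is only available inside the unit disc; Tannery's theorem carries it to the
  boundary, where it still converges absolutely.\<close>

lemma char_defect_binom_tail:
  assumes a: "0 < a" "a < 1" and s: "0 < s" "s < pi"
  shows "char_defect (binom_tail a) s = (1 - cis s) powr of_real a"
proof -
  let ?A = "binom_tail a"
  have lim0: "?A \<longlonglongrightarrow> 0" by (rule tendsto_0_of_powr_mult[OF a(1) binom_tail_asymp])
  have tele: "(\<lambda>k. ?A k - ?A (Suc k)) sums 1"
    using telescope_sums'[OF lim0] by (simp add: binom_tail_0)
  have inside: "(\<Sum>k. (?A k - ?A (Suc k)) *\<^sub>R (1 - z ^ Suc k)) = (1 - z) powr of_real a"
    if z: "norm z < 1" for z :: complex
  proof -
    have "(\<lambda>n. (of_real a gchoose n) * (- z) ^ n) sums (1 + - z) powr of_real a"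
      by (rule gen_binomial_complex) (use z in simp)
    then have "(\<lambda>n. (of_real a gchoose Suc n) * (- z) ^ Suc n) sums ((1 - z) powr of_real a - 1)"
      by (subst sums_Suc_iff) simp
    moreover have "(of_real a gchoose n :: complex) = of_real (a gchoose n)" for n
      by (simp add: gbinomial_prod_rev)
    ultimately have "(\<lambda>n. - ((?A n - ?A (Suc n)) *\<^sub>R z ^ Suc n)) sums ((1 - z) powr of_real a - 1)"
      by (simp add: binom_tail_diff scaleR_conv_of_real power_minus[of z] mult_ac)
    moreover have "(\<lambda>n. (?A n - ?A (Suc n)) *\<^sub>R (1::complex)) sums (1 *\<^sub>R 1)"
      by (intro sums_scaleR_left tele)
    ultimately have "(\<lambda>n. (?A n - ?A (Suc n)) *\<^sub>R (1::complex) + - ((?A n - ?A (Suc n)) *\<^sub>R z ^ Suc n))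
       sums (1 *\<^sub>R 1 + ((1 - z) powr of_real a - 1))"
      by (intro sums_add)
    then show ?thesis by (simp add: sums_iff algebra_simps)
  qed
  define f where "f r = of_real r * cis s" for r :: real
  have ev: "eventually (\<lambda>r::real. 0 < r \<and> r < 1) (at_left 1)"
    using eventually_at_left_real[of 0 1] by simp
  have "((\<lambda>r. \<Sum>k. (?A k - ?A (Suc k)) *\<^sub>R (1 - f r ^ Suc k)) \<longlongrightarrow>
      (\<Sum>k. (?A k - ?A (Suc k)) *\<^sub>R (1 - f 1 ^ Suc k))) (at_left 1)"
  proof -
    have "((\<lambda>r. (?A k - ?A (Suc k)) *\<^sub>R (1 - f r ^ Suc k)) \<longlongrightarrow> 
       (?A k - ?A (Suc k)) *\<^sub>R (1 - f 1 ^ Suc k)) (at_left 1)" for k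
      unfolding f_def by (intro tendsto_intros)
    moreover have "eventually (\<lambda>(k,r). norm ((?A k - ?A (Suc k)) *\<^sub>R (1 - f r ^ Suc k))
        \<le> (?A k - ?A (Suc k)) * 2) (at_top \<times>\<^sub>F at_left 1)"
    proof -
      have "norm ((?A k - ?A (Suc k)) *\<^sub>R (1 - f r ^ Suc k)) \<le> (?A k - ?A (Suc k)) * 2"
        if r: "0 < r \<and> r < 1" for k r
      proof -
        have "norm (f r ^ Suc k) \<le> 1"
          unfolding norm_power using r by (intro power_le_one) (auto simp: f_def norm_mult)
        then have le2: "norm (1 - f r ^ Suc k) \<le> 2"
          using norm_triangle_ineq4[of 1 "f r ^ Suc k"] by simp
        show ?thesis
          using mult_left_mono[OF le2, of "?A k - ?A (Suc k)"]
            decseq_SucD[OF decseq_binom_tail[OF a], of k] by (simp del: power_Suc)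
      qed
      then show ?thesis
        by (intro eventually_mono[OF eventually_prodI[OF eventually_True ev]])
           (auto simp: case_prod_beta simp del: power_Suc)
    qed
    moreover have "summable (\<lambda>k. (?A k - ?A (Suc k)) * 2)"
      using tele by (intro summable_mult2) (auto simp: sums_iff)
    ultimately show ?thesis
      using tannerys_theorem[of "\<lambda>k r. (?A k - ?A (Suc k)) *\<^sub>R (1 - f r ^ Suc k)" _ "at_left 1"] by simp
  qed
  moreover have "eventually (\<lambda>r. (\<Sum>k. (?A k - ?A (Suc k)) *\<^sub>R (1 - f r ^ Suc k)) = (1 - f r) powr of_real a)
      (at_left 1)"
    using ev by eventually_elim (rule inside, simp add: f_def norm_mult)
  ultimately have "((\<lambda>r. (1 - f r) powr of_real a) \<longlongrightarrow> (\<Sum>k. (?A k - ?A (Suc k)) *\<^sub>R (1 - f 1 ^ Suc k)))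
      (at_left 1)"
    by (rule Lim_transform_eventually)
  moreover have "((\<lambda>r. (1 - f r) powr of_real a) \<longlongrightarrow> (1 - f 1) powr of_real a) (at_left 1)"
  proof -
    \<comment> \<open>A positive real part keeps \<open>1 - f 1\<close> off the branch cut, so the
      complex power is continuous there.\<close>
    have "cos s < 1" using cos_monotone_0_pi[of 0 s] s by simp
    then have "1 - f 1 \<notin> \<real>\<^sub>\<le>\<^sub>0" by (auto simp: f_def complex_nonpos_Reals_iff)
    then show ?thesis unfolding f_def by (intro tendsto_powr_complex tendsto_intros) auto
  qed
  ultimately have "(\<Sum>k. (?A k - ?A (Suc k)) *\<^sub>R (1 - f 1 ^ Suc k)) = (1 - f 1) powr of_real a"
    by (intro tendsto_unique[of "at_left (1::real)"]) auto
  then show ?thesis by (simp add: char_defect_def f_def)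
qed

lemma one_minus_cis_over: "((\<lambda>s. (1 - cis s) / of_real s) \<longlongrightarrow> - \<i>) (at_right 0)"
proof -
  have "((\<lambda>s. (1 - cos s) / s) \<longlongrightarrow> (0::real)) (at_right 0)"
    "((\<lambda>s. - (sin s / s)) \<longlongrightarrow> (-1::real)) (at_right 0)" by real_asymp+
  then have "((\<lambda>s. Complex ((1 - cos s) / s) (- (sin s / s))) \<longlongrightarrow> Complex 0 (-1)) (at_right 0)"
    by (intro tendsto_Complex)
  moreover have "Complex ((1 - cos s) / s) (- (sin s / s)) = (1 - cis s) / of_real s" for s
    by (simp add: complex_eq_iff)
  moreover have "Complex 0 (-1) = - \<i>" by (simp add: complex_eq_iff)
  ultimately show ?thesis by simp
qed

lemma char_defect_binom_tail_asymp:
  assumes a: "0 < a" "a < 1"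
  shows "((\<lambda>s. char_defect (binom_tail a) s / of_real (s powr a)) \<longlongrightarrow> cis (- pi * a / 2)) (at_right 0)"
proof -
  have "((\<lambda>s. ((1 - cis s) / of_real s) powr of_real a) \<longlongrightarrow> (- \<i>) powr of_real a) (at_right 0)"
    by (intro tendsto_powr_complex one_minus_cis_over tendsto_intros) (auto simp: complex_nonpos_Reals_iff)
  moreover have "(- \<i>) powr of_real a = cis (- pi * a / 2)"
    by (simp add: powr_def cis_conv_exp mult_ac)
  moreover have "eventually (\<lambda>s. ((1 - cis s) / of_real s) powr of_real a =
      char_defect (binom_tail a) s / of_real (s powr a)) (at_right 0)"
  proof -
    have "eventually (\<lambda>s. s \<in> {0<..<pi}) (at_right 0)" by (rule eventually_at_right_real) simp
    then show ?thesis
    proof eventually_elim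
      case (elim s)
      then have "(1 - cis s) powr of_real a = (of_real s * ((1 - cis s) / of_real s)) powr of_real a"
        by simp
      also have "\<dots> = of_real s powr of_real a * ((1 - cis s) / of_real s) powr of_real a"
        using elim by (intro powr_times_real_left) auto
      also have "of_real s powr of_real a = (of_real (s powr a) :: complex)"
        using elim by (intro powr_of_real) auto
      finally show ?case
        using char_defect_binom_tail[OF a, of s] elim by simp
    qed
  qed
  ultimately show ?thesis by (simp add: Lim_transform_eventually)
qed

text \<open>An Abelian theorem by comparison with a multiple of \<open>binom_tail\<close>. The cut
  is placed at \<open>N\<close> near \<open>R / s\<close>: above it both tails are of order
  \<open>R powr (- a) * s powr a\<close>, small once \<open>R\<close> is large; below it the
  difference of the tails is small on average, once \<open>s\<close> is small for this fixed
  \<open>R\<close>.\<close>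

theorem char_defect_asymp:
  assumes a: "0 < a" "a < 1" and F: "decseq F" "\<And>k. 0 \<le> F k"
    and lim: "(\<lambda>k. F k * real k powr a) \<longlonglongrightarrow> c"
  shows "((\<lambda>s. char_defect F s / of_real (s powr a)) \<longlongrightarrow> of_real (c * Gamma (1 - a)) * cis (- pi * a / 2)) (at_right 0)"
proof -
  let ?A = "binom_tail a"
  have F0: "F \<longlonglongrightarrow> 0" by (rule tendsto_0_of_powr_mult[OF a(1) lim])
  have A0: "?A \<longlonglongrightarrow> 0" by (rule tendsto_0_of_powr_mult[OF a(1) binom_tail_asymp])
  \<comment> \<open>The factor that matches leading constants, as \<open>binom_tail a k\<close>
    behaves like \<open>k powr (- a)\<close> divided by \<open>Gamma (1 - a)\<close>.\<close>
  define c' where "c' = c * Gamma (1 - a)"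
  have G: "Gamma (1 - a) > 0" using a by (intro Gamma_real_pos) auto
  have "c \<ge> 0" by (rule LIMSEQ_le_const[OF lim]) (use F in auto)
  then have c': "c' \<ge> 0" using G by (simp add: c'_def)
  define d where "d k = \<bar>F k - c' * ?A k\<bar>" for k
  define S where "S N = (\<Sum>k<N. d k)" for N
  have "(\<lambda>k. F k * real k powr a - c' * (?A k * real k powr a)) \<longlonglongrightarrow> c - c' * inverse (Gamma (1 - a))"
    by (intro tendsto_intros lim binom_tail_asymp)
  then have abs_lim: "(\<lambda>k. \<bar>F k * real k powr a - c' * (?A k * real k powr a)\<bar>) \<longlonglongrightarrow> \<bar>c - c' * inverse (Gamma (1 - a))\<bar>"
    by (rule tendsto_rabs)
  have d_lim: "(\<lambda>k. d k * real k powr a) \<longlonglongrightarrow> 0"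
  proof -
    have "\<bar>F k * real k powr a - c' * (?A k * real k powr a)\<bar> = d k * real k powr a" for k
    proof -
      have "F k * real k powr a - c' * (?A k * real k powr a) = (F k - c' * ?A k) * real k powr a"
        by (simp add: algebra_simps)
      then show ?thesis by (simp add: d_def abs_mult)
    qed
    moreover have "c - c' * inverse (Gamma (1 - a)) = 0" using G by (simp add: c'_def)
    ultimately show ?thesis using abs_lim by simp
  qed
  have S_lim: "(\<lambda>N. S N / real N powr (1 - a)) \<longlonglongrightarrow> 0"
  proof (rule stolz_cesaro)
    show "filterlim (\<lambda>N. real N powr (1 - a)) at_top sequentially" using a by real_asymp
    show "real n powr (1 - a) < real (Suc n) powr (1 - a)" for n
      using a by (intro powr_less_mono2) auto
    have "(\<lambda>n. real n powr (- a) / (real (Suc n) powr (1 - a) - real n powr (1 - a))) \<longlonglongrightarrow> inverse (1 - a)"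
      using a by real_asymp
    then have "(\<lambda>n. d n * real n powr a * (real n powr (- a) / (real (Suc n) powr (1 - a) - real n powr (1 - a))))
       \<longlonglongrightarrow> 0"
      using tendsto_mult[OF d_lim] by fastforce
    moreover have "eventually (\<lambda>n. d n * real n powr a * (real n powr (- a) / (real (Suc n) powr (1 - a) - real n powr (1 - a)))
      = (S (Suc n) - S n) / (real (Suc n) powr (1 - a) - real n powr (1 - a))) sequentially"
      using eventually_gt_at_top[of 0] by eventually_elim (simp add: S_def powr_minus)
    ultimately show "(\<lambda>n. (S (Suc n) - S n) / (real (Suc n) powr (1 - a) - real n powr (1 - a))) \<longlonglongrightarrow> 0"
      by (rule Lim_transform_eventually)
  qed
  have "(\<lambda>k. F k * real k powr a + c' * (?A k * real k powr a)) \<longlonglongrightarrow> c + c' * inverse (Gamma (1 - a))"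
    by (intro tendsto_intros lim binom_tail_asymp)
  then have "convergent (\<lambda>k. F k * real k powr a + c' * (?A k * real k powr a))"
    by (rule convergentI)
  then have "Bseq (\<lambda>k. F k * real k powr a + c' * (?A k * real k powr a))" by (rule convergent_imp_Bseq)
  then obtain K where K: "K > 0" "\<And>k. norm (F k * real k powr a + c' * (?A k * real k powr a)) \<le> K"
    by (auto simp: Bseq_def)
  have FA: "F k + c' * ?A k \<le> K * real k powr (- a)" if "k > 0" for k
    using K(2)[of k] that by (simp add: powr_minus field_simps abs_le_iff)
  have "((\<lambda>s. char_defect F s / of_real (s powr a) - c' * (char_defect ?A s / of_real (s powr a))) \<longlongrightarrow> 0) (at_right 0)"
  proof (rule tendstoI)
    fix \<epsilon> :: real assume \<epsilon>: "\<epsilon> > 0"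
    have "((\<lambda>R. 4 * K * R powr (- a)) \<longlongrightarrow> 0) at_top" using a K by real_asymp
    then have "eventually (\<lambda>R. 4 * K * R powr (- a) < \<epsilon> / 2 \<and> R > 0) at_top"
      using \<epsilon> by (intro eventually_conj order_tendstoD eventually_gt_at_top) auto
    then obtain R where R: "4 * K * R powr (- a) < \<epsilon> / 2" "R > 0"
      using eventually_happens by force
    \<comment> \<open>Chosen so that \<open>s * (\<eta> * (2 * R / s) powr (1 - a))\<close>, the
      part below the cut, equals \<open>\<epsilon> / 2 * s powr a\<close>.\<close>
    define \<eta> where "\<eta> = \<epsilon> / 2 / (2 * R) powr (1 - a)"
    have \<eta>: "\<eta> > 0" using \<epsilon> R by (simp add: \<eta>_def)
    obtain N0 where N0: "\<And>N. N \<ge> N0 \<Longrightarrow> S N / real N powr (1 - a) < \<eta>"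
      using order_tendstoD(2)[OF S_lim \<eta>] by (auto simp: eventually_sequentially)
    have "eventually (\<lambda>s. s \<in> {0<..<R / real (Suc N0)}) (at_right 0)"
      by (rule eventually_at_right_real) (use R in auto)
    then show "eventually (\<lambda>s. dist (char_defect F s / of_real (s powr a) - c' * (char_defect ?A s / of_real (s powr a))) 0 < \<epsilon>) (at_right 0)"
    proof eventually_elim
      case (elim s)
      define N where "N = nat \<lceil>R / s\<rceil>"
      have s: "s > 0" and sR: "real (Suc N0) < R / s"
        using elim R by (auto simp: field_simps)
      have N: "R / s \<le> real N" "real N \<le> R / s + 1"
        using s R unfolding N_def by (auto simp: real_nat_ceiling_ge) 
      have N_ge: "N \<ge> N0" "N > 0" using N(1) sR by linarith+
      have N2: "real N \<le> 2 * R / s" using N(2) sR by linarith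
      have "norm (char_defect F s - c' * char_defect ?A s) \<le> s * S N + 4 * (F N + c' * ?A N)"
        unfolding S_def d_def using s c' binom_tail_pos[OF a] decseq_binom_tail[OF a]
        by (intro char_defect_diff_le F F0 A0) (auto intro: less_imp_le)
      also have "S N \<le> \<eta> * real N powr (1 - a)"
        using N0[OF N_ge(1)] N_ge by (simp add: field_simps)
      also have "\<eta> * real N powr (1 - a) \<le> \<eta> * (2 * R / s) powr (1 - a)"
        using N2 \<eta> a by (intro mult_left_mono powr_mono2) auto
      also have "\<dots> = \<epsilon> / 2 * s powr (a - 1)"
        using s R by (simp add: \<eta>_def powr_divide powr_diff)
      also have "F N + c' * ?A N \<le> K * real N powr (- a)" using FA N_ge by simp
      also have "K * real N powr (- a) \<le> K * (R / s) powr (- a)"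
        using N K a s R by (intro mult_left_mono powr_mono2') auto
      also have "(R / s) powr (- a) = R powr (- a) * s powr a"
        using s R by (simp add: powr_divide powr_minus field_simps)
      finally have "norm (char_defect F s - c' * char_defect ?A s) \<le>
          s * (\<epsilon> / 2 * s powr (a - 1)) + 4 * (K * (R powr (- a) * s powr a))"
        using s K by (simp add: mult_left_mono)
      also have "s * (\<epsilon> / 2 * s powr (a - 1)) = \<epsilon> / 2 * s powr a"
        using s by (simp add: powr_diff)
      also have "\<epsilon> / 2 * s powr a + 4 * (K * (R powr (- a) * s powr a)) = (\<epsilon> / 2 + 4 * K * R powr (- a)) * s powr a"
        by (simp add: algebra_simps)
      also have "\<dots> < \<epsilon> * s powr a" using R s by (intro mult_strict_right_mono) auto
      finally have "norm ((char_defect F s - c' * char_defect ?A s) / of_real (s powr a)) < \<epsilon>"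
        using s by (simp add: norm_divide field_simps)
      then show ?case by (simp add: diff_divide_distrib)
    qed
  qed
  from tendsto_add[OF this tendsto_mult[OF tendsto_const char_defect_binom_tail_asymp[OF a]], of "of_real c'"]
  show ?thesis by (simp add: c'_def)
qed

lemma char_defect_sums:
  assumes "decseq F" "F \<longlonglongrightarrow> 0" "F 0 = 1"
  shows "(\<lambda>k. (F k - F (Suc k)) *\<^sub>R cis s ^ Suc k) sums (1 - char_defect F s)"
proof -
  have "(\<lambda>k. (F k - F (Suc k)) *\<^sub>R (1::complex)) sums (1 *\<^sub>R 1)"
    using telescope_sums'[OF assms(2)] assms(3) by (intro sums_scaleR_left) simp
  moreover have "(\<lambda>k. (F k - F (Suc k)) *\<^sub>R (1 - cis s ^ Suc k)) sums char_defect F s"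
    unfolding char_defect_def
    by (rule summable_sums[OF summable_norm_cancel[OF char_defect_summable[OF assms(1,2)]]])
  ultimately have "(\<lambda>k. (F k - F (Suc k)) *\<^sub>R 1 - (F k - F (Suc k)) *\<^sub>R (1 - cis s ^ Suc k))
      sums (1 *\<^sub>R 1 - char_defect F s)"
    by (rule sums_diff)
  then show ?thesis by (simp add: algebra_simps)
qed

text \<open>Summation by parts passes from the tail of a distribution of finite mean to its
  integrated tail \<open>G\<close>.\<close>

lemma char_defect_integrated_tail:
  assumes F: "decseq F" "F \<longlonglongrightarrow> 0" "F 0 = 1"
    and G: "decseq G" "G \<longlonglongrightarrow> 0" and FG: "\<And>k. F (Suc k) = G k - G (Suc k)"
  shows "char_defect F s = (1 - cis s) * (of_real (1 + G 0) - char_defect G s)"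
proof -
  define z where "z = cis s"
  have zk: "norm (z ^ k) = 1" for k by (simp add: z_def norm_power)
  have parts: "(\<Sum>k<n. (F k - F (Suc k)) *\<^sub>R z ^ Suc k) =
    z - (1 - z) * (\<Sum>k<n. F (Suc k) *\<^sub>R z ^ Suc k) - F n *\<^sub>R z ^ Suc n" for n
    by (induction n) (auto simp: F(3) scaleR_conv_of_real algebra_simps)
  have "(\<lambda>n. z - (1 - z) * (\<Sum>k<n. F (Suc k) *\<^sub>R z ^ Suc k) - F n *\<^sub>R z ^ Suc n)
      \<longlonglongrightarrow> z - (1 - z) * (of_real (G 0) - char_defect G s) - 0"
  proof (intro tendsto_intros)
    have "(\<lambda>k. (G k - G (Suc k)) *\<^sub>R (1::complex)) sums (G 0 *\<^sub>R 1)"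
      using telescope_sums'[OF G(2)] by (intro sums_scaleR_left) simp
    moreover have "(\<lambda>k. (G k - G (Suc k)) *\<^sub>R (1 - z ^ Suc k)) sums char_defect G s"
      unfolding char_defect_def z_def
      by (rule summable_sums[OF summable_norm_cancel[OF char_defect_summable[OF G]]])
    ultimately have "(\<lambda>k. (G k - G (Suc k)) *\<^sub>R 1 - (G k - G (Suc k)) *\<^sub>R (1 - z ^ Suc k))
        sums (G 0 *\<^sub>R 1 - char_defect G s)"
      by (rule sums_diff)
    then have "(\<lambda>k. F (Suc k) *\<^sub>R z ^ Suc k) sums (of_real (G 0) - char_defect G s)"
      by (simp add: FG algebra_simps scaleR_conv_of_real)
    then show "(\<lambda>n. \<Sum>k<n. F (Suc k) *\<^sub>R z ^ Suc k) \<longlonglongrightarrow> of_real (G 0) - char_defect G s"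
      by (simp add: sums_def)
    show "(\<lambda>n. F n *\<^sub>R z ^ Suc n) \<longlonglongrightarrow> 0"
    proof (rule Lim_null_comparison[OF _ F(2)])
      show "eventually (\<lambda>n. norm (F n *\<^sub>R z ^ Suc n) \<le> F n) sequentially"
        using decseq_ge[OF F(1,2)] zk by (intro always_eventually) (simp del: power_Suc)
    qed
  qed
  then have "(\<lambda>k. (F k - F (Suc k)) *\<^sub>R z ^ Suc k) sums (z - (1 - z) * (of_real (G 0) - char_defect G s))"
    unfolding sums_def parts by simp
  with char_defect_sums[OF F, of s]
  have "1 - char_defect F s = z - (1 - z) * (of_real (G 0) - char_defect G s)"
    unfolding z_def by (rule sums_unique2)
  then show ?thesis unfolding z_def[symmetric] by (simp add: algebra_simps)
qed

text \<open>Here \<open>1 + G 0\<close> is the mean, the sum of all \<open>F k\<close>. Once this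
  drift is removed, the main term is \<open>- (1 - cis s) * char_defect G s\<close>, of order
  \<open>s powr \<alpha>\<close>, while the quadratic error of \<open>1 - cis s\<close> is
  negligible because \<alpha> < 2.\<close>

lemma char_defect_asymp_finite_mean:
  assumes \<alpha>: "1 < \<alpha>" "\<alpha> < 2" and F: "decseq F" "F \<longlonglongrightarrow> 0" "F 0 = 1"
    and G: "decseq G" "\<And>k. 0 \<le> G k" and FG: "\<And>k. F (Suc k) = G k - G (Suc k)"
    and lim: "(\<lambda>k. G k * real k powr (\<alpha> - 1)) \<longlonglongrightarrow> c"
  shows "((\<lambda>s. (char_defect F s + \<i> * of_real ((1 + G 0) * s)) / of_real (s powr \<alpha>)) \<longlongrightarrow>
    of_real (c * (\<alpha> - 1) * Gamma (1 - \<alpha>)) * cis (- pi * \<alpha> / 2)) (at_right 0)"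
proof -
  let ?a = "\<alpha> - 1"
  have G0: "G \<longlonglongrightarrow> 0" by (rule tendsto_0_of_powr_mult[OF _ lim]) (use \<alpha> in simp)
  have 1: "((\<lambda>s. char_defect G s / of_real (s powr ?a)) \<longlongrightarrow>
      of_real (c * Gamma (1 - ?a)) * cis (- pi * ?a / 2)) (at_right 0)"
    by (rule char_defect_asymp[OF _ _ G lim]) (use \<alpha> in auto)
  have 2: "((\<lambda>s. (1 - cis s + \<i> * of_real s) / of_real (s powr \<alpha>)) \<longlongrightarrow> 0) (at_right 0)"
  proof -
    have "((\<lambda>s. (1 - cos s) / s powr \<alpha>) \<longlongrightarrow> 0) (at_right 0)" using \<alpha> by real_asymp
    moreover have "((\<lambda>s. (s - sin s) / s powr \<alpha>) \<longlongrightarrow> 0) (at_right 0)" using \<alpha> by real_asymp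
    ultimately have "((\<lambda>s. Complex ((1 - cos s) / s powr \<alpha>) ((s - sin s) / s powr \<alpha>)) \<longlongrightarrow> Complex 0 0) (at_right 0)"
      by (intro tendsto_Complex)
    moreover have "Complex ((1 - cos s) / s powr \<alpha>) ((s - sin s) / s powr \<alpha>) =
        (1 - cis s + \<i> * of_real s) / of_real (s powr \<alpha>)" for s
      by (simp add: complex_eq_iff)
    ultimately show ?thesis by (simp add: zero_complex.code[symmetric])
  qed
  have 3: "((\<lambda>s. of_real (1 + G 0) * ((1 - cis s + \<i> * of_real s) / of_real (s powr \<alpha>))
      - (1 - cis s) / of_real s * (char_defect G s / of_real (s powr ?a))) \<longlongrightarrow>
      of_real (1 + G 0) * 0 - (- \<i>) * (of_real (c * Gamma (1 - ?a)) * cis (- pi * ?a / 2))) (at_right 0)"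
    by (intro tendsto_intros 1 2 one_minus_cis_over)
  have 4: "eventually (\<lambda>s. of_real (1 + G 0) * ((1 - cis s + \<i> * of_real s) / of_real (s powr \<alpha>))
      - (1 - cis s) / of_real s * (char_defect G s / of_real (s powr ?a)) =
      (char_defect F s + \<i> * of_real ((1 + G 0) * s)) / of_real (s powr \<alpha>)) (at_right 0)"
    using eventually_at_right_less[of 0]
  proof eventually_elim
    case (elim s)
    then have p: "s powr \<alpha> = s * s powr ?a" by (simp add: powr_diff)
    have "complex_of_real (s powr ?a) \<noteq> 0" "complex_of_real s \<noteq> 0" using elim by auto
    then show ?case
      unfolding char_defect_integrated_tail[OF F G(1) G0 FG] p by (simp add: field_simps)
  qed
  \<comment> \<open>The recurrence of \<open>Gamma\<close> and a quarter turn absorbed by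
    \<open>cis\<close> give the constant the same shape as for exponents below 1.\<close>
  have 5: "of_real (1 + G 0) * 0 - (- \<i>) * (of_real (c * Gamma (1 - ?a)) * cis (- pi * ?a / 2)) =
      of_real (c * (\<alpha> - 1) * Gamma (1 - \<alpha>)) * cis (- pi * \<alpha> / 2)"
  proof -
    have "1 - \<alpha> \<notin> \<int>\<^sub>\<le>\<^sub>0"
    proof
      assume "1 - \<alpha> \<in> \<int>\<^sub>\<le>\<^sub>0"
      then obtain n where "1 - \<alpha> = of_int n" by (auto elim!: nonpos_Ints_cases)
      then have "-1 < n" "n < 0" using \<alpha> by linarith+
      then show False by simp
    qed
    then have Gam: "Gamma (1 - ?a) = (1 - \<alpha>) * Gamma (1 - \<alpha>)"
      using Gamma_plus1[of "1 - \<alpha>"] by simp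
    have "cis (- pi * ?a / 2) = \<i> * cis (- pi * \<alpha> / 2)"
    proof -
      have "- pi * ?a / 2 = pi / 2 + (- pi * \<alpha> / 2)" by (simp add: field_simps)
      then show ?thesis by (simp only: cis_mult[symmetric] cis_pi_half)
    qed
    then show ?thesis unfolding Gam by (simp only: of_real_mult) (simp add: algebra_simps)
  qed
  show ?thesis by (rule Lim_transform_eventually[OF 3 4, unfolded 5])
qed

section \<open>Powers of characteristic functions and centring\<close>

lemma power_tendsto_exp:
  fixes a :: "nat \<Rightarrow> complex"
  assumes norm_a: "\<And>n. norm (a n) \<le> 1" and lim: "(\<lambda>n. of_nat n * (a n - 1)) \<longlonglongrightarrow> z"
  shows "(\<lambda>n. a n ^ n) \<longlonglongrightarrow> exp z"
proof -
  \<comment> \<open>This puts \<open>exp (z / of_nat n)\<close> into the closed unit disc, so that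
    its \<open>n\<close>-th power and that of \<open>a n\<close> differ by at most \<open>n\<close>
    times the difference of the bases.\<close>
  have Re: "Re z \<le> 0"
  proof (rule LIMSEQ_le_const2[OF tendsto_Re[OF lim]])
    have "Re (a n) \<le> 1" for n using complex_Re_le_cmod[of "a n"] norm_a[of n] by linarith
    then show "\<exists>N. \<forall>n\<ge>N. Re (of_nat n * (a n - 1)) \<le> 0"
      by (auto simp: mult_nonneg_nonpos)
  qed
  have exp_lim: "(\<lambda>n. of_nat n * (exp (z / of_nat n) - 1)) \<longlonglongrightarrow> z"
  proof -
    have "((\<lambda>h. (exp (z * h) - exp (z * 0)) / h) \<longlongrightarrow> z) (at (0::complex))"
    proof -
      have "((\<lambda>h. exp (z * h)) has_field_derivative z) (at 0)"
        by (auto intro!: derivative_eq_intros)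
      from DERIV_D[OF this] show ?thesis by simp
    qed
    moreover have "filterlim (\<lambda>n. inverse (of_nat n :: complex)) (at 0) sequentially"
      unfolding filterlim_at using eventually_gt_at_top[of 0]
      by (intro conjI lim_inverse_n) (auto elim!: eventually_mono)
    ultimately have "(\<lambda>n. (exp (z * inverse (of_nat n)) - exp (z * 0)) / inverse (of_nat n)) \<longlonglongrightarrow> z"
      by (rule filterlim_compose)
    then show ?thesis by (simp add: divide_inverse mult_ac)
  qed
  have "(\<lambda>n. a n ^ n - exp z) \<longlonglongrightarrow> 0"
  proof (rule Lim_null_comparison)
    show "eventually (\<lambda>n. norm (a n ^ n - exp z) \<le>
        norm (of_nat n * (a n - 1) - of_nat n * (exp (z / of_nat n) - 1))) sequentially"
      using eventually_gt_at_top[of 0]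
    proof eventually_elim
      case (elim n)
      have "exp z = exp (z / of_nat n) ^ n"
        using elim by (simp flip: exp_of_nat_mult)
      then have "norm (a n ^ n - exp z) \<le> real n * norm (a n - exp (z / of_nat n))"
        using norm_power_diff[OF norm_a[of n], of "exp (z / of_nat n)" n] Re elim
        by (simp add: divide_nonpos_nonneg Re_divide_of_nat)
      also have "\<dots> = norm (of_nat n * (a n - 1) - of_nat n * (exp (z / of_nat n) - 1))"
      proof -
        have "of_nat n * (a n - 1) - of_nat n * (exp (z / of_nat n) - 1) = of_nat n * (a n - exp (z / of_nat n))"
          by (simp add: algebra_simps)
        then show ?thesis by (simp only: norm_mult norm_of_nat)
      qed
      finally show ?case .
    qed
    have "(\<lambda>n. norm (of_nat n * (a n - 1) - of_nat n * (exp (z / of_nat n) - 1))) \<longlonglongrightarrow> norm (z - z)"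
      by (intro tendsto_intros lim exp_lim)
    then show "(\<lambda>n. norm (of_nat n * (a n - 1) - of_nat n * (exp (z / of_nat n) - 1))) \<longlonglongrightarrow> 0" by simp
  qed
  then show ?thesis by (rule LIM_zero_cancel)
qed

text \<open>A random sign replaces the defect \<open>D\<close> by a weighted mean of
  \<open>D\<close> and its conjugate, which keeps \<open>Re \<kappa>\<close> and multiplies
  \<open>Im \<kappa>\<close> by \<beta>. The centring removes the drift \<open>\<beta> * l\<close>
  up to an error quadratic in \<open>s\<close>, negligible against \<open>s powr \<alpha>\<close>.
  With \<open>l = 0\<close> this also covers infinite mean.\<close>

lemma signed_char_power_tendsto:
  fixes D :: "real \<Rightarrow> complex" and \<alpha> \<beta> d l t :: real
  assumes \<alpha>: "0 < \<alpha>" "\<alpha> < 2" and d: "0 < d" and t: "0 < t"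
    and lim: "((\<lambda>s. (D s + \<i> * of_real (l * s)) / of_real (s powr \<alpha>)) \<longlongrightarrow> \<kappa>) (at_right 0)"
  defines "p x \<equiv> 1 - (of_real ((1 + \<beta>) / 2) * D x + of_real ((1 - \<beta>) / 2) * cnj (D x))"
  defines "s n \<equiv> t * (real n * d) powr (- 1 / \<alpha>)"
  assumes norm_p: "\<And>n. norm (p (s n)) \<le> 1"
  shows "(\<lambda>n. cis (- real n * s n * \<beta> * l) * p (s n) ^ n)
    \<longlonglongrightarrow> exp (- of_real (t powr \<alpha> / d) * (of_real (Re \<kappa>) + \<i> * of_real (\<beta> * Im \<kappa>)))"
proof -
  define \<kappa>' where "\<kappa>' = of_real (Re \<kappa>) + \<i> * of_real (\<beta> * Im \<kappa>)"
  define q where "q s = cis (- (\<beta> * l) * s) * p s" for s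
  have 1: "((\<lambda>s. (1 - p s + \<i> * of_real (\<beta> * l * s)) / of_real (s powr \<alpha>)) \<longlongrightarrow> \<kappa>') (at_right 0)"
  proof -
    have "((\<lambda>s. of_real ((1 + \<beta>) / 2) * ((D s + \<i> * of_real (l * s)) / of_real (s powr \<alpha>)) +
        of_real ((1 - \<beta>) / 2) * cnj ((D s + \<i> * of_real (l * s)) / of_real (s powr \<alpha>))) \<longlongrightarrow>
        of_real ((1 + \<beta>) / 2) * \<kappa> + of_real ((1 - \<beta>) / 2) * cnj \<kappa>) (at_right 0)"
      by (intro tendsto_intros lim)
    moreover have "of_real ((1 + \<beta>) / 2) * \<kappa> + of_real ((1 - \<beta>) / 2) * cnj \<kappa> = \<kappa>'"
      by (simp add: \<kappa>'_def complex_eq_iff field_simps)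
    moreover have "of_real ((1 + \<beta>) / 2) * ((D s + \<i> * of_real (l * s)) / of_real (s powr \<alpha>)) +
        of_real ((1 - \<beta>) / 2) * cnj ((D s + \<i> * of_real (l * s)) / of_real (s powr \<alpha>)) =
        (1 - p s + \<i> * of_real (\<beta> * l * s)) / of_real (s powr \<alpha>)" for s
    proof -
      have "1 - p s + \<i> * of_real (\<beta> * l * s) = of_real ((1 + \<beta>) / 2) * (D s + \<i> * of_real (l * s)) +
        of_real ((1 - \<beta>) / 2) * cnj (D s + \<i> * of_real (l * s))"
        by (simp add: p_def complex_eq_iff field_simps)
      then show ?thesis
        by (simp only: complex_cnj_divide complex_cnj_complex_of_real times_divide_eq_right
            add_divide_distrib[symmetric])
    qed
    ultimately show ?thesis by simp
  qed
  have 2: "((\<lambda>s. (cis (- b * s) * (1 + \<i> * of_real (b * s)) - 1) / of_real (s powr \<alpha>)) \<longlongrightarrow> 0) (at_right 0)"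
    for b :: real
  proof -
    have "norm ((cis (- b * s) * (1 + \<i> * of_real (b * s)) - 1) / of_real (s powr \<alpha>)) \<le> b\<^sup>2 / 2 * s powr (2 - \<alpha>)"
      if s: "s > 0" for s
    proof -
      have "cis (- b * s) * (1 + \<i> * of_real (b * s)) - 1 = - (cis (- b * s) * (cis (b * s) - (1 + \<i> * of_real (b * s))))"
        by (simp add: algebra_simps cis_mult)
      then have "norm (cis (- b * s) * (1 + \<i> * of_real (b * s)) - 1) = norm (cis (b * s) - (1 + \<i> * of_real (b * s)))"
        by (simp only: norm_minus_cancel norm_mult norm_cis mult_1)
      also have "\<dots> \<le> (b * s)\<^sup>2 / 2"
        using iexp_approx1[of "b * s" 1] by (simp add: cis_conv_exp power2_eq_square)
      finally have "norm ((cis (- b * s) * (1 + \<i> * of_real (b * s)) - 1) / of_real (s powr \<alpha>)) \<le> (b * s)\<^sup>2 / 2 / s powr \<alpha>"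
        unfolding norm_divide using s by (intro frac_le) auto
      also have "(b * s)\<^sup>2 / 2 / s powr \<alpha> = b\<^sup>2 / 2 * s powr (2 - \<alpha>)"
        using s by (simp add: powr_diff power_mult_distrib)
      finally show ?thesis .
    qed
    then have "eventually (\<lambda>s. norm ((cis (- b * s) * (1 + \<i> * of_real (b * s)) - 1) / of_real (s powr \<alpha>))
        \<le> b\<^sup>2 / 2 * s powr (2 - \<alpha>)) (at_right 0)"
      using eventually_at_right_less[of "0::real"] by (rule eventually_mono[rotated])
    moreover have "((\<lambda>s. b\<^sup>2 / 2 * s powr (2 - \<alpha>)) \<longlongrightarrow> 0) (at_right 0)"
    proof -
      have "((\<lambda>s. s powr (2 - \<alpha>)) \<longlongrightarrow> 0) (at_right 0)" using \<alpha> by real_asymp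
      from tendsto_mult[OF tendsto_const this, of "b\<^sup>2 / 2"] show ?thesis by simp
    qed
    ultimately show ?thesis by (rule Lim_null_comparison)
  qed
  have 3: "((\<lambda>s. (q s - 1) / of_real (s powr \<alpha>)) \<longlongrightarrow> - \<kappa>') (at_right 0)"
  proof -
    have "((\<lambda>s. (cis (- (\<beta> * l) * s) * (1 + \<i> * of_real (\<beta> * l * s)) - 1) / of_real (s powr \<alpha>) -
        cis (- (\<beta> * l) * s) * ((1 - p s + \<i> * of_real (\<beta> * l * s)) / of_real (s powr \<alpha>))) \<longlongrightarrow>
        0 - cis (- (\<beta> * l) * 0) * \<kappa>') (at_right 0)"
      by (intro tendsto_intros 1 2)
    moreover have "(cis (- (\<beta> * l) * s) * (1 + \<i> * of_real (\<beta> * l * s)) - 1) / of_real (s powr \<alpha>) -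
        cis (- (\<beta> * l) * s) * ((1 - p s + \<i> * of_real (\<beta> * l * s)) / of_real (s powr \<alpha>)) =
        (q s - 1) / of_real (s powr \<alpha>)" for s
      unfolding q_def times_divide_eq_right diff_divide_distrib[symmetric]
      by (simp add: algebra_simps)
    ultimately show ?thesis by simp
  qed
  have s_pos: "s n > 0" if "n > 0" for n using that t d by (simp add: s_def)
  have s_lim: "filterlim s (at_right 0) sequentially"
    unfolding s_def using \<alpha> d t by real_asymp
  have ns: "real n * s n powr \<alpha> = t powr \<alpha> / d" if "n > 0" for n
  proof -
    have "s n powr \<alpha> = t powr \<alpha> * ((real n * d) powr (- 1 / \<alpha>)) powr \<alpha>"
      using t d by (simp add: s_def powr_mult)
    also have "((real n * d) powr (- 1 / \<alpha>)) powr \<alpha> = inverse (real n * d)"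
      using that d \<alpha> powr_minus[of "real n * d" 1] unfolding powr_powr by simp
    finally show ?thesis using that d by (simp add: field_simps)
  qed
  have "(\<lambda>n. of_real (t powr \<alpha> / d) * ((q (s n) - 1) / of_real (s n powr \<alpha>))) \<longlonglongrightarrow> of_real (t powr \<alpha> / d) * (- \<kappa>')"
    by (intro tendsto_intros filterlim_compose[OF 3 s_lim])
  moreover have "eventually (\<lambda>n. of_real (t powr \<alpha> / d) * ((q (s n) - 1) / of_real (s n powr \<alpha>)) =
      of_nat n * (q (s n) - 1)) sequentially"
    using eventually_gt_at_top[of 0]
  proof eventually_elim
    case (elim n)
    then show ?case using s_pos[of n] by (simp flip: ns[of n])
  qed
  ultimately have "(\<lambda>n. of_nat n * (q (s n) - 1)) \<longlonglongrightarrow> of_real (t powr \<alpha> / d) * (- \<kappa>')"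
    by (rule Lim_transform_eventually)
  then have "(\<lambda>n. q (s n) ^ n) \<longlonglongrightarrow> exp (of_real (t powr \<alpha> / d) * (- \<kappa>'))"
    by (intro power_tendsto_exp) (simp add: q_def norm_mult norm_p)
  moreover have "q (s n) ^ n = cis (- real n * s n * \<beta> * l) * p (s n) ^ n" for n
    by (simp add: q_def power_mult_distrib Complex.DeMoivre mult_ac)
  moreover have "of_real (t powr \<alpha> / d) * (- \<kappa>') = - of_real (t powr \<alpha> / d) * \<kappa>'" by simp
  ultimately show ?thesis by (simp only: \<kappa>'_def)
qed

section \<open>The Thaler map\<close>

locale thaler =
  fixes \<gamma> :: real
  assumes \<gamma>_pos: "0 < \<gamma>" and \<gamma>_neq_1: "\<gamma> \<noteq> 1"
begin

text \<open>The integral of \<open>t\<^sup>-\<^sup>\<gamma>\<close> from 1 to \<open>x\<close>. It linearises the map: \<open>pint (lift x) = pint x + pint (1 + x)\<close>.\<close>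

definition pint :: "real \<Rightarrow> real" where
  "pint x = (x powr (1 - \<gamma>) - 1) / (1 - \<gamma>)"

abbreviation h :: "real \<Rightarrow> real" where "h \<equiv> thaler_h \<gamma>"

definition lift :: "real \<Rightarrow> real" where
  "lift x = (x powr (1 - \<gamma>) + (1 + x) powr (1 - \<gamma>) - 1) powr (1 / (1 - \<gamma>))"

lemma pint_1: "pint 1 = 0" by (simp add: pint_def)

lemma pint_deriv: "0 < x \<Longrightarrow> (pint has_real_derivative x powr (- \<gamma>)) (at x)"
  unfolding pint_def using \<gamma>_neq_1 by (auto intro!: derivative_eq_intros)

lemma pint_less:
  assumes "0 < x" "x < y" shows "pint x < pint y"
proof (rule DERIV_pos_imp_increasing[OF assms(2)])
  fix z assume "x \<le> z" "z \<le> y"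
  then show "\<exists>d. (pint has_real_derivative d) (at z) \<and> 0 < d"
    using pint_deriv[of z] assms(1) by (intro exI[of _ "z powr (- \<gamma>)"]) auto
qed

lemma pint_less_iff: "0 < x \<Longrightarrow> 0 < y \<Longrightarrow> pint x < pint y \<longleftrightarrow> x < y"
  using pint_less[of x y] pint_less[of y x] by (cases x y rule: linorder_cases) auto

lemma pint_le_iff: "0 < x \<Longrightarrow> 0 < y \<Longrightarrow> pint x \<le> pint y \<longleftrightarrow> x \<le> y"
  using pint_less_iff[of y x] by (simp add: not_less[symmetric])

lemma pint_inj: "0 < x \<Longrightarrow> 0 < y \<Longrightarrow> pint x = pint y \<longleftrightarrow> x = y"
  using pint_le_iff[of x y] pint_le_iff[of y x] by auto

lemma pint_mvt:
  assumes "0 < x" "x < y"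
  shows "\<exists>z. x < z \<and> z < y \<and> pint y - pint x = (y - x) * z powr (- \<gamma>)"
  using MVT2[OF assms(2), of pint "\<lambda>z. z powr (- \<gamma>)"] pint_deriv assms(1) by auto

lemma pint_diff_le:
  assumes "0 < x" "x \<le> y" shows "pint y - pint x \<le> (y - x) * x powr (- \<gamma>)"
proof (cases "x = y")
  case False
  then obtain z where z: "x < z" "pint y - pint x = (y - x) * z powr (- \<gamma>)"
    using pint_mvt[of x y] assms by auto
  then show ?thesis using assms \<gamma>_pos by (auto intro!: mult_left_mono powr_mono2')
qed simp

lemma pint_diff_ge:
  assumes "0 < x" "x \<le> y" shows "(y - x) * y powr (- \<gamma>) \<le> pint y - pint x"
proof (cases "x = y")
  case False
  then obtain z where z: "x < z" "z < y" "pint y - pint x = (y - x) * z powr (- \<gamma>)"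
    using pint_mvt[of x y] assms by auto
  then show ?thesis using assms \<gamma>_pos by (auto intro!: mult_left_mono powr_mono2')
qed simp

lemma pint_pos: "1 < x \<Longrightarrow> 0 < pint x"
  using pint_less[of 1 x] by (simp add: pint_1)

lemma lift_base_pos:
  assumes "0 < x" "x \<le> 1" shows "0 < x powr (1 - \<gamma>) + (1 + x) powr (1 - \<gamma>) - 1"
proof (cases "\<gamma> < 1")
  case True
  have "(1 + x) powr (1 - \<gamma>) \<ge> 1" using True assms by (intro ge_one_powr_ge_zero) auto
  then show ?thesis using assms by (smt (verit) powr_gt_zero)
next
  case False
  have "x powr (1 - \<gamma>) \<ge> 1 powr (1 - \<gamma>)" using False assms by (intro powr_mono2') auto
  then show ?thesis using assms by (smt (verit) powr_gt_zero powr_one_eq_one)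
qed

lemma lift_pos: "0 < x \<Longrightarrow> x \<le> 1 \<Longrightarrow> 0 < lift x"
  using lift_base_pos[of x] by (simp add: lift_def)

lemma pint_lift:
  assumes "0 < x" "x \<le> 1" shows "pint (lift x) = pint x + pint (1 + x)"
  using lift_base_pos[OF assms] \<gamma>_neq_1
  by (simp add: lift_def pint_def powr_powr add_divide_distrib[symmetric])

lemma thaler_map_eq:
  assumes "0 < x" "x \<le> 1" shows "thaler_map \<gamma> x = frac (lift x)"
proof -
  let ?q = "1 + (x / (1 + x)) powr (\<gamma> - 1) - x powr (\<gamma> - 1)"
  have 1: "x powr (1 - \<gamma>) * ?q = x powr (1 - \<gamma>) + (1 + x) powr (1 - \<gamma>) - 1"
  proof -
    have "x powr (1 - \<gamma>) * x powr (\<gamma> - 1) = 1" "(1 + x) powr (1 - \<gamma>) * (1 + x) powr (\<gamma> - 1) = 1"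
      using assms by (simp_all flip: powr_add)
    then show ?thesis using assms by (simp add: powr_divide field_simps)
  qed
  then have "?q > 0" using lift_base_pos[OF assms] assms
    by (metis powr_gt_zero zero_less_mult_pos less_irrefl)
  then have "lift x = (x powr (1 - \<gamma>)) powr (1 / (1 - \<gamma>)) * ?q powr (1 / (1 - \<gamma>))"
    unfolding lift_def 1[symmetric] using assms by (simp add: powr_mult)
  then show ?thesis using assms \<gamma>_neq_1 by (simp add: thaler_map_def powr_powr)
qed

text \<open>Differentiating \<open>pint (lift x) = pint x + pint (1 + x)\<close> explains the form:
  \<open>h\<close> is the derivative of the right-hand side.\<close>

lemma lift_deriv:
  assumes "0 < x" "x \<le> 1"
  shows "(lift has_real_derivative h x * lift x powr \<gamma>) (at x)"
proof -
  let ?b = "x powr (1 - \<gamma>) + (1 + x) powr (1 - \<gamma>) - 1"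
  have b: "?b > 0" by (rule lift_base_pos[OF assms])
  have "(lift has_real_derivative (1 / (1 - \<gamma>)) * ?b powr (1 / (1 - \<gamma>) - 1) *
      ((1 - \<gamma>) * x powr (- \<gamma>) + (1 - \<gamma>) * (1 + x) powr (- \<gamma>))) (at x)"
    unfolding lift_def using b assms by (auto intro!: derivative_eq_intros)
  moreover have "?b powr (1 / (1 - \<gamma>) - 1) = lift x powr \<gamma>"
    using b \<gamma>_neq_1 by (simp add: lift_def powr_powr field_simps)
  moreover have "(1 / (1 - \<gamma>)) * z * ((1 - \<gamma>) * x powr (- \<gamma>) + (1 - \<gamma>) * (1 + x) powr (- \<gamma>)) = h x * z" for z
    using \<gamma>_neq_1 by (simp add: thaler_h_def distrib_left[symmetric] add.commute)
  ultimately show ?thesis by simp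
qed

lemma lift_cont: "0 < a \<Longrightarrow> b \<le> 1 \<Longrightarrow> continuous_on {a..b} lift"
  by (intro continuous_at_imp_continuous_on ballI DERIV_isCont[OF lift_deriv]) auto

lemma lift_less_iff:
  assumes "0 < x" "x \<le> 1" "0 < y" "y \<le> 1" shows "lift x < lift y \<longleftrightarrow> x < y"
proof -
  have *: "pint u + pint (1 + u) < pint v + pint (1 + v)" if "0 < u" "u < v" for u v
    using pint_less[of u v] pint_less[of "1 + u" "1 + v"] that by simp
  have "lift x < lift y \<longleftrightarrow> pint (lift x) < pint (lift y)"
    using lift_pos assms by (simp add: pint_less_iff)
  also have "\<dots> \<longleftrightarrow> x < y"
    unfolding pint_lift[OF assms(1,2)] pint_lift[OF assms(3,4)]
    using *[of x y] *[of y x] assms by (cases x y rule: linorder_cases) auto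
  finally show ?thesis .
qed

lemma lift_inj:
  assumes "0 < x" "x \<le> 1" "0 < y" "y \<le> 1" shows "lift x = lift y \<longleftrightarrow> x = y"
  using lift_less_iff[OF assms] lift_less_iff[OF assms(3,4,1,2)] by (cases x y rule: linorder_cases) auto

lemma lift_1: "lift 1 = 2"
  using pint_lift[of 1] pint_inj[of "lift 1" 2] lift_pos[of 1] by (simp add: pint_1)

lemma less_lift:
  assumes "0 < x" "x \<le> 1" shows "x < lift x"
  using pint_less_iff[of x "lift x"] pint_lift[OF assms] pint_pos[of "1 + x"] lift_pos[OF assms] assms by simp

lemma pint_1_plus_le: "0 < x \<Longrightarrow> pint (1 + x) \<le> x"
  using pint_diff_le[of 1 "1 + x"] by (simp add: pint_1)

text \<open>Between \<open>x\<close> and \<open>2 * x\<close> the integrand of \<open>pint\<close>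
  is at least 1, so doubling gains at least \<open>x\<close>, hence at least
  \<open>pint (1 + x)\<close>. This provides small values of \<open>lift\<close> and localises mean
  value points near 0.\<close>

lemma lift_le_double:
  assumes "0 < x" "x \<le> 1 / 2" shows "lift x \<le> 2 * x"
proof -
  have "pint (1 + x) \<le> x * (2 * x) powr (- \<gamma>)"
  proof -
    have "1 powr (- \<gamma>) \<le> (2 * x) powr (- \<gamma>)" using assms \<gamma>_pos by (intro powr_mono2') auto
    then have "x * 1 \<le> x * (2 * x) powr (- \<gamma>)" using assms by (intro mult_left_mono) auto
    then show ?thesis using pint_1_plus_le[OF assms(1)] by simp
  qed
  also have "\<dots> \<le> pint (2 * x) - pint x" using pint_diff_ge[of x "2 * x"] assms by simp
  finally have "pint (lift x) \<le> pint (2 * x)" using pint_lift[of x] assms by simp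
  then show ?thesis using pint_le_iff[of "lift x" "2 * x"] lift_pos[of x] assms by simp
qed

lemma lift_surj:
  assumes "0 < y" "y \<le> 2" shows "\<exists>x. 0 < x \<and> x \<le> 1 \<and> lift x = y"
proof -
  define a where "a = min (1 / 2) (y / 2)"
  have a: "0 < a" "a \<le> 1 / 2" "2 * a \<le> y" using assms by (auto simp: a_def)
  have "\<exists>x\<ge>a. x \<le> 1 \<and> lift x = y"
  proof (rule IVT')
    show "lift a \<le> y" using lift_le_double[OF a(1,2)] a(3) by simp
    show "y \<le> lift 1" using assms lift_1 by simp
    show "continuous_on {a..1} lift" by (rule lift_cont) (use a in auto)
  qed (use a in auto)
  then obtain x where "a \<le> x" "x \<le> 1" "lift x = y" by blast
  then show ?thesis using a(1) by (intro exI[of _ x]) auto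
qed

text \<open>\<open>lift\<close> contains both branches of the map in one increasing function onto
  (0,2]; the left and right preimages of \<open>y\<close> are then \<open>linv y\<close> and
  \<open>linv (1 + y)\<close>.\<close>

definition linv :: "real \<Rightarrow> real" where
  "linv y = (THE x. 0 < x \<and> x \<le> 1 \<and> lift x = y)"

lemma linv_lift: "0 < x \<Longrightarrow> x \<le> 1 \<Longrightarrow> linv (lift x) = x"
  unfolding linv_def by (rule the_equality) (auto simp: lift_inj)

lemma linv:
  assumes "0 < y" "y \<le> 2" shows "0 < linv y" "linv y \<le> 1" "lift (linv y) = y"
  using lift_surj[OF assms] linv_lift by auto

lemma linv_less_iff:
  assumes "0 < y" "y \<le> 2" "0 < z" "z \<le> 2" shows "linv y < linv z \<longleftrightarrow> y < z"
  using lift_less_iff[of "linv y" "linv z"] linv[OF assms(1,2)] linv[OF assms(3,4)] by simp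

lemma linv_le_iff:
  assumes "0 < y" "y \<le> 2" "0 < z" "z \<le> 2" shows "linv y \<le> linv z \<longleftrightarrow> y \<le> z"
  using linv_less_iff[OF assms(3,4,1,2)] by (simp add: not_less[symmetric])

lemma linv_less: "0 < y \<Longrightarrow> y \<le> 2 \<Longrightarrow> linv y < y"
  using less_lift[of "linv y"] linv[of y] by simp

lemma pint_linv: "0 < y \<Longrightarrow> y \<le> 2 \<Longrightarrow> pint y = pint (linv y) + pint (1 + linv y)"
  using pint_lift[of "linv y"] linv[of y] by simp

section \<open>The backward orbit of 1 and its decay\<close>

fun xs :: "nat \<Rightarrow> real" where
  "xs 0 = 1"
| "xs (Suc n) = linv (xs n)"

lemma xs_pos: "0 < xs n" and xs_le_1: "xs n \<le> 1"
proof -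
  have "0 < xs n \<and> xs n \<le> 1"
    by (induction n) (use linv in auto)
  then show "0 < xs n" "xs n \<le> 1" by auto
qed

lemma xs_le_2: "xs n \<le> 2" using xs_le_1[of n] by simp

lemma lift_xs: "lift (xs (Suc n)) = xs n"
  using linv(3)[OF xs_pos xs_le_2] by simp

lemma xs_Suc_less: "xs (Suc n) < xs n"
  using linv_less[OF xs_pos xs_le_2] by simp

declare xs.simps(2) [simp del]

lemma xs_less: "m < n \<Longrightarrow> xs n < xs m"
proof (induction n)
  case (Suc n)
  then show ?case using xs_Suc_less[of n] by (cases "m = n") auto
qed simp

lemma xs_le: "m \<le> n \<Longrightarrow> xs n \<le> xs m"
  using xs_less[of m n] by (cases "m = n") auto

lemma pint_xs: "pint (xs n) - pint (xs (Suc n)) = pint (1 + xs (Suc n))"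
  using pint_linv[OF xs_pos xs_le_2, of n] by (simp add: xs.simps)

text \<open>With a positive limit \<open>L\<close>, each step would raise
  \<open>- pint (xs n)\<close> by at least \<open>pint (1 + L)\<close>, although it never exceeds
  \<open>- pint L\<close>.\<close>

lemma xs_lim: "xs \<longlonglongrightarrow> 0"
proof -
  have dec: "decseq xs" by (intro decseq_SucI less_imp_le xs_Suc_less)
  then obtain L where L: "xs \<longlonglongrightarrow> L" "\<And>n. L \<le> xs n"
    using decseq_convergent[OF dec, of 0] xs_pos less_imp_le by metis
  have "0 \<le> L" by (rule LIMSEQ_le_const[OF L(1)]) (use xs_pos less_imp_le in blast)
  moreover have "\<not> 0 < L"
  proof
    assume Lp: "0 < L"
    have "real n * pint (1 + L) \<le> - pint (xs n)" for n
    proof (induction n)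
      case (Suc n)
      have "pint (1 + L) \<le> pint (1 + xs (Suc n))"
        using pint_le_iff[of "1 + L" "1 + xs (Suc n)"] L(2)[of "Suc n"] Lp xs_pos[of "Suc n"] by simp
      then show ?case using Suc pint_xs[of n] by (simp add: algebra_simps)
    qed (simp add: pint_1)
    moreover have "pint L \<le> pint (xs n)" for n
      using pint_le_iff[of L "xs n"] L(2) Lp xs_pos by simp
    ultimately have "real n * pint (1 + L) \<le> - pint L" for n by (smt (verit))
    moreover have "pint (1 + L) > 0" using pint_pos Lp by simp
    ultimately show False
      using reals_Archimedean3[of "pint (1 + L)"] by (metis not_less)
  qed
  ultimately show ?thesis using L(1) by simp
qed

text \<open>Cauchy's mean value theorem against \<open>pint\<close>: the derivatives of
  \<open>- (t powr (- \<gamma>))\<close> and \<open>pint t\<close> have ratio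
  \<open>\<gamma> / t\<close>, so the difference is \<open>\<gamma> * pint (1 + x) / z\<close> with
  \<open>z\<close> between \<open>x\<close> and \<open>lift x\<close>. Both bounds tend to \<gamma>
  as \<open>x\<close> tends to 0.\<close>

lemma powr_neg_diff_lift:
  assumes "0 < x" "x \<le> 1 / 2"
  shows "x powr (- \<gamma>) - lift x powr (- \<gamma>) \<le> \<gamma>"
    and "\<gamma> * (1 + x) powr (- \<gamma>) / (1 + (2 * x) powr \<gamma>) \<le> x powr (- \<gamma>) - lift x powr (- \<gamma>)"
proof -
  let ?y = "lift x"
  have x1: "x \<le> 1" using assms by simp
  have xy: "x < ?y" by (rule less_lift[OF assms(1) x1])
  have y: "?y > 0" "?y \<le> 2 * x" using lift_pos[OF assms(1) x1] lift_le_double[OF assms] by auto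
  obtain z where z: "x < z" "z < ?y" and
    eq: "(x powr (- \<gamma>) - ?y powr (- \<gamma>)) * (z powr (- \<gamma>)) = (pint ?y - pint x) * (\<gamma> * z powr (- \<gamma> - 1))"
  proof -
    have "\<exists>z. z > x \<and> z < ?y \<and> ((- (?y powr (- \<gamma>))) - (- (x powr (- \<gamma>)))) * z powr (- \<gamma>) =
        (pint ?y - pint x) * (\<gamma> * z powr (- \<gamma> - 1))"
      using assms
      by (intro GMVT'[OF xy]) (auto intro!: derivative_eq_intros pint_deriv DERIV_isCont[OF pint_deriv] continuous_intros simp: field_simps)
    then show ?thesis using that by auto
  qed
  have zp: "z > 0" using z assms by simp
  have "z powr (- \<gamma> - 1) = z powr (- \<gamma>) / z" using zp by (simp add: powr_diff)
  then have "(x powr (- \<gamma>) - ?y powr (- \<gamma>)) * z powr (- \<gamma>) = (\<gamma> * pint (1 + x) / z) * z powr (- \<gamma>)"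
    using eq pint_lift[OF assms(1) x1] by simp
  then have D: "x powr (- \<gamma>) - ?y powr (- \<gamma>) = \<gamma> * pint (1 + x) / z"
    using zp by (subst (asm) mult_right_cancel) auto
  have "pint (1 + x) / z \<le> 1"
    using pint_1_plus_le[OF assms(1)] z zp by simp
  then show "x powr (- \<gamma>) - ?y powr (- \<gamma>) \<le> \<gamma>"
    unfolding D using \<gamma>_pos by (simp add: mult_left_le flip: times_divide_eq_right)
  have "(?y - x) * ?y powr (- \<gamma>) \<le> x"
    using pint_diff_ge[of x ?y] xy assms pint_lift[OF assms(1) x1] pint_1_plus_le[OF assms(1)] by simp
  then have "?y - x \<le> x * ?y powr \<gamma>" using y by (simp add: powr_minus field_simps)
  also have "\<dots> \<le> x * (2 * x) powr \<gamma>" using y assms \<gamma>_pos by (intro mult_left_mono powr_mono2) auto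
  finally have "z \<le> x * (1 + (2 * x) powr \<gamma>)" using z by (simp add: algebra_simps)
  moreover have "x * (1 + x) powr (- \<gamma>) \<le> pint (1 + x)"
    using pint_diff_ge[of 1 "1 + x"] assms by (simp add: pint_1)
  ultimately have "(x * (1 + x) powr (- \<gamma>)) / (x * (1 + (2 * x) powr \<gamma>)) \<le> pint (1 + x) / z"
    using zp assms pint_pos[of "1 + x"] by (intro frac_le) auto
  then have "(1 + x) powr (- \<gamma>) / (1 + (2 * x) powr \<gamma>) \<le> pint (1 + x) / z"
    using assms by simp
  from mult_left_mono[OF this, of \<gamma>]
  show "\<gamma> * (1 + x) powr (- \<gamma>) / (1 + (2 * x) powr \<gamma>) \<le> x powr (- \<gamma>) - ?y powr (- \<gamma>)"
    unfolding D using \<gamma>_pos by simp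
qed

text \<open>In the coordinate \<open>x powr (- \<gamma>)\<close> the orbit is asymptotically an
  arithmetic progression with step \<gamma>.\<close>

lemma xs_asymp: "(\<lambda>n. xs n * real n powr (1 / \<gamma>)) \<longlonglongrightarrow> \<gamma> powr (- 1 / \<gamma>)"
proof -
  define u where "u n = xs n powr (- \<gamma>)" for n
  have half: "eventually (\<lambda>n. xs (Suc n) < 1 / 2) sequentially"
    using order_tendstoD(2)[OF LIMSEQ_Suc[OF xs_lim], of "1/2"] by simp
  have "(\<lambda>n. u (Suc n) - u n) \<longlonglongrightarrow> \<gamma>"
  proof (rule tendsto_sandwich)
    show "eventually (\<lambda>n. u (Suc n) - u n \<le> \<gamma>) sequentially"
      using half
    proof eventually_elim
      case (elim n)
      show ?case
        using powr_neg_diff_lift(1)[OF xs_pos less_imp_le[OF elim]] unfolding u_def lift_xs .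
    qed
    show "eventually (\<lambda>n. \<gamma> * (1 + xs (Suc n)) powr (- \<gamma>) / (1 + (2 * xs (Suc n)) powr \<gamma>) \<le> u (Suc n) - u n) sequentially"
      using half
    proof eventually_elim
      case (elim n)
      show ?case
        using powr_neg_diff_lift(2)[OF xs_pos less_imp_le[OF elim]] unfolding u_def lift_xs .
    qed
    have 0: "(\<lambda>n. (2 * xs (Suc n)) powr \<gamma>) \<longlonglongrightarrow> (2 * 0) powr \<gamma>"
      using \<gamma>_pos xs_pos[THEN less_imp_le]
      by (intro tendsto_powr' tendsto_intros LIMSEQ_Suc[OF xs_lim]) auto
    have "(\<lambda>n. \<gamma> * (1 + xs (Suc n)) powr (- \<gamma>) / (1 + (2 * xs (Suc n)) powr \<gamma>)) \<longlonglongrightarrow>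
        \<gamma> * (1 + 0) powr (- \<gamma>) / (1 + (2 * 0) powr \<gamma>)"
      by (intro tendsto_divide tendsto_mult tendsto_const tendsto_add tendsto_powr 0 LIMSEQ_Suc[OF xs_lim]) auto
    then show "(\<lambda>n. \<gamma> * (1 + xs (Suc n)) powr (- \<gamma>) / (1 + (2 * xs (Suc n)) powr \<gamma>)) \<longlonglongrightarrow> \<gamma>"
      by simp
  qed simp
  then have "(\<lambda>n. u n / real n) \<longlonglongrightarrow> \<gamma>"
    using stolz_cesaro[of real u \<gamma>] by (simp add: filterlim_real_sequentially)
  then have "(\<lambda>n. (u n / real n) powr (- 1 / \<gamma>)) \<longlonglongrightarrow> \<gamma> powr (- 1 / \<gamma>)"
    using \<gamma>_pos by (intro tendsto_powr tendsto_const) auto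
  moreover have "eventually (\<lambda>n. (u n / real n) powr (- 1 / \<gamma>) = xs n * real n powr (1 / \<gamma>)) sequentially"
    using eventually_gt_at_top[of 0]
  proof eventually_elim
    case (elim n)
    have "(u n / real n) powr (- 1 / \<gamma>) = u n powr (- 1 / \<gamma>) / real n powr (- 1 / \<gamma>)"
      using elim by (simp add: u_def powr_divide)
    also have "u n powr (- 1 / \<gamma>) = xs n"
      using xs_pos[of n] \<gamma>_pos by (simp add: u_def powr_powr)
    finally show ?case by (simp add: powr_minus_divide)
  qed
  ultimately show ?thesis by (rule Lim_transform_eventually)
qed


section \<open>Branch probabilities of the time-reversed map\<close>

definition lprob :: "real \<Rightarrow> real" where
  "lprob z = z powr (- \<gamma>) / h z"

text \<open>The probability that \<open>m\<close> successive backward steps from \<open>y\<close>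
  all choose the left preimage.\<close>

definition Q :: "nat \<Rightarrow> real \<Rightarrow> real" where
  "Q m y = (\<Prod>i<m. lprob ((linv ^^ i) y))"

text \<open>\<open>m\<close> left preimages followed by a right one: the starting point in
  \<open>Y\<close> of an excursion that returns at \<open>y\<close> after \<open>m + 1\<close>
  steps.\<close>

definition \<sigma> :: "nat \<Rightarrow> real \<Rightarrow> real" where
  "\<sigma> m y = linv (1 + (linv ^^ m) y)"

abbreviation b :: real where "b \<equiv> linv 1"

abbreviation mass :: "nat \<Rightarrow> real \<Rightarrow> real" where
  "mass k y \<equiv> Q k y - Q (Suc k) y"

lemma h_pos: "0 < z \<Longrightarrow> 0 < h z"
  by (simp add: thaler_h_def add_pos_nonneg)

lemma lprob_h: "0 < z \<Longrightarrow> lprob z * h z = z powr (- \<gamma>)"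
  using h_pos[of z] by (simp add: lprob_def)

lemma lprob_h': "0 < z \<Longrightarrow> (1 - lprob z) * h z = (1 + z) powr (- \<gamma>)"
  using lprob_h[of z] by (simp add: left_diff_distrib thaler_h_def add.commute)

lemma lprob_pos: "0 < z \<Longrightarrow> 0 < lprob z"
  using h_pos[of z] by (simp add: lprob_def)

lemma lprob_less_1: "0 < z \<Longrightarrow> lprob z < 1"
  using h_pos[of z] by (simp add: lprob_def thaler_h_def)

text \<open>Dividing out, \<open>lprob z\<close> is
  \<open>1 / (1 + (z / (1 + z)) powr \<gamma>)\<close>, and \<open>z / (1 + z)\<close>
  increases.\<close>

lemma lprob_anti:
  assumes "0 < z" "z \<le> z'" shows "lprob z' \<le> lprob z"
proof -
  have "z * (1 + z') \<le> z' * (1 + z)" "0 < z * (1 + z')"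
    using assms by (simp add: algebra_simps) (intro mult_pos_pos, use assms in auto)
  then have "(z' * (1 + z)) powr (- \<gamma>) \<le> (z * (1 + z')) powr (- \<gamma>)"
    using \<gamma>_pos by (intro powr_mono2') auto
  then have "z' powr (- \<gamma>) * (1 + z) powr (- \<gamma>) \<le> z powr (- \<gamma>) * (1 + z') powr (- \<gamma>)"
    using assms by (simp only: powr_mult)
  then have "z' powr (- \<gamma>) * h z \<le> z powr (- \<gamma>) * h z'"
    by (simp add: thaler_h_def algebra_simps)
  then show ?thesis
    using h_pos[of z] h_pos[of z'] assms by (simp add: lprob_def field_simps)
qed

lemma b_bounds: "0 < b" "b < 1"
  using linv[of 1] linv_less[of 1] by auto

lemma linv_pow:
  assumes "0 < y" "y \<le> 1" shows "0 < (linv ^^ m) y" "(linv ^^ m) y \<le> 1"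
proof -
  have "0 < (linv ^^ m) y \<and> (linv ^^ m) y \<le> 1"
    by (induction m) (use assms linv in auto)
  then show "0 < (linv ^^ m) y" "(linv ^^ m) y \<le> 1" by auto
qed

lemma linv_pow_mono:
  assumes "0 < y" "y \<le> y'" "y' \<le> 1" shows "(linv ^^ m) y \<le> (linv ^^ m) y'"
proof (induction m)
  case (Suc m)
  have "(linv ^^ m) y \<le> 2" "(linv ^^ m) y' \<le> 2"
    using linv_pow[of y m] linv_pow[of y' m] assms by simp_all
  then show ?case
    using Suc linv_le_iff[of "(linv ^^ m) y" "(linv ^^ m) y'"] linv_pow[of y m] linv_pow[of y' m] assms
    by simp
qed (use assms in simp)

lemma linv_pow_Suc_le:
  assumes "0 < y" "y \<le> 1" shows "(linv ^^ Suc m) y \<le> (linv ^^ m) y"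
  using linv_less[of "(linv ^^ m) y"] linv_pow[OF assms, of m] by simp

lemma Q_0: "Q 0 y = 1" by (simp add: Q_def)

lemma Q_Suc: "Q (Suc m) y = Q m y * lprob ((linv ^^ m) y)" by (simp add: Q_def)

lemma Q_Suc_shift: "Q (Suc m) y = lprob y * Q m (linv y)"
  unfolding Q_def by (subst prod.lessThan_Suc_shift) (simp add: funpow_swap1)

lemma Q_pos: "0 < y \<Longrightarrow> y \<le> 1 \<Longrightarrow> 0 < Q m y"
  unfolding Q_def by (intro prod_pos ballI lprob_pos linv_pow)

lemma Q_Suc_le: "0 < y \<Longrightarrow> y \<le> 1 \<Longrightarrow> Q (Suc m) y \<le> Q m y"
  unfolding Q_Suc using Q_pos[of y m] lprob_less_1[OF linv_pow(1), of y m]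
  by (intro mult_left_le) auto

lemma Q_anti: "0 < y \<Longrightarrow> y \<le> y' \<Longrightarrow> y' \<le> 1 \<Longrightarrow> Q m y' \<le> Q m y"
  unfolding Q_def
  by (intro prod_mono conjI lprob_anti linv_pow_mono linv_pow less_imp_le[OF lprob_pos]) auto

section \<open>Measurability and changes of variables\<close>

lemma linv_measurable [measurable]: "linv \<in> borel_measurable borel"
proof -
  have "mono_on {0<..2} linv"
    by (intro mono_onI) (simp add: linv_le_iff)
  then have 1: "linv \<in> borel_measurable (restrict_space borel {0<..2})"
    by (rule borel_measurable_mono_on_fnc)
  \<comment> \<open>Outside (0,2] no point fits the description, so there \<open>linv\<close> equals
    one fixed unspecified value.\<close>
  define c where "c = (THE x::real. False)"
  have "linv y = c" if "y \<notin> {0<..2}" for y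
  proof -
    have no: "(0 < x \<and> x \<le> 1 \<and> lift x = y) = False" for x
      using lift_pos[of x] lift_less_iff[of 1 x] lift_1 that by force
    show ?thesis unfolding linv_def c_def by (simp only: no)
  qed
  then have 2: "linv = (\<lambda>y. if y \<in> {0<..2} then linv y else c)" by (intro ext) (simp only: if_splits, blast)
  show ?thesis
    by (subst 2, subst measurable_If_restrict_space_iff) (use 1 in \<open>simp_all add: greaterThanAtMost_def greaterThan_def atMost_def Collect_conj_eq\<close>)
qed

lemma h_measurable [measurable]: "h \<in> borel_measurable borel"
  unfolding thaler_h_def by measurable

lemma lprob_measurable [measurable]: "lprob \<in> borel_measurable borel"
  unfolding lprob_def by measurable

lemma Q_measurable [measurable]: "Q m \<in> borel_measurable borel"
  unfolding Q_def by measurable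

lemma \<sigma>_measurable [measurable]: "\<sigma> m \<in> borel_measurable borel"
  unfolding \<sigma>_def by measurable

lemma lift_measurable [measurable]: "lift \<in> borel_measurable borel"
  unfolding lift_def by measurable

lemma lift_pow_measurable [measurable]: "(lift ^^ m) \<in> borel_measurable borel"
  by (rule measurable_compose_n) measurable

text \<open>The factor \<open>lift x powr \<gamma>\<close> of the derivative is cancelled by the new
  density, so \<open>h\<close> is carried exactly to \<open>z powr (- \<gamma>)\<close>.\<close>

lemma lift_substitution:
  assumes V[measurable]: "V \<in> borel_measurable borel" and a: "0 < a" "a \<le> c" "c \<le> 1"
  shows "(\<integral>\<^sup>+x. ennreal (V (lift x) * h x * indicator {a..c} x) \<partial>lborel) =
    (\<integral>\<^sup>+z. ennreal (V z * z powr (- \<gamma>) * indicator {lift a..lift c} z) \<partial>lborel)"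
proof -
  have "(\<integral>\<^sup>+z. ennreal (V z * z powr (- \<gamma>) * indicator {lift a..lift c} z) \<partial>lborel) =
    (\<integral>\<^sup>+x. ennreal (V (lift x) * lift x powr (- \<gamma>) * (h x * lift x powr \<gamma>) * indicator {a..c} x) \<partial>lborel)"
  proof (rule nn_integral_substitution)
    show "set_borel_measurable borel {lift a..lift c} (\<lambda>z. V z * z powr (- \<gamma>))"
      unfolding set_borel_measurable_def by measurable
    show "(lift has_real_derivative h x * lift x powr \<gamma>) (at x)" if "x \<in> {a..c}" for x
      using that a by (intro lift_deriv) auto
    show "continuous_on {a..c} (\<lambda>x. h x * lift x powr \<gamma>)"
    proof (unfold thaler_h_def, intro continuous_on_mult continuous_on_add continuous_on_powr
        continuous_on_const continuous_on_id lift_cont ballI)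
      show "lift x \<noteq> 0" if "x \<in> {a..c}" for x using lift_pos[of x] a that by force
    qed (use a in auto)
    show "0 \<le> h x * lift x powr \<gamma>" if "x \<in> {a..c}" for x
      using h_pos[of x] that a by simp
  qed (use a in simp)
  also have "\<dots> = (\<integral>\<^sup>+x. ennreal (V (lift x) * h x * indicator {a..c} x) \<partial>lborel)"
  proof (rule nn_integral_cong)
    fix x
    show "ennreal (V (lift x) * lift x powr (- \<gamma>) * (h x * lift x powr \<gamma>) * indicator {a..c} x) =
      ennreal (V (lift x) * h x * indicator {a..c} x)"
    proof (cases "x \<in> {a..c}")
      case True
      then have "lift x > 0" using a by (intro lift_pos) auto
      then have "lift x powr (- \<gamma>) * lift x powr \<gamma> = 1" by (simp flip: powr_add)
      then have "V (lift x) * lift x powr (- \<gamma>) * (h x * lift x powr \<gamma>) = V (lift x) * h x"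
        by (simp add: mult_ac)
      then show ?thesis by (simp only:)
    qed simp
  qed
  finally show ?thesis by simp
qed

lemma linv_pow_lift_pow:
  assumes "xs (Suc m) \<le> z" "z \<le> xs m"
  shows "(linv ^^ m) ((lift ^^ m) z) = z" "xs 1 \<le> (lift ^^ m) z" "(lift ^^ m) z \<le> 1"
proof -
  have "(linv ^^ m) ((lift ^^ m) z) = z \<and> xs 1 \<le> (lift ^^ m) z \<and> (lift ^^ m) z \<le> 1"
    using assms
  proof (induction m arbitrary: z)
    case (Suc m)
    have z: "0 < z" "z \<le> 1" using Suc.prems xs_pos[of "Suc (Suc m)"] xs_le_1[of "Suc m"] by linarith+
    have "xs (Suc m) \<le> lift z" "lift z \<le> xs m"
      using lift_less_iff[of z "xs (Suc (Suc m))"] lift_less_iff[of "xs (Suc m)" z] z Suc.prems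
        xs_pos xs_le_1 lift_xs by (metis not_less)+
    from Suc.IH[OF this] show ?case using linv_lift[OF z]
      by (simp add: funpow_swap1[of lift])
  qed auto
  then show "(linv ^^ m) ((lift ^^ m) z) = z" "xs 1 \<le> (lift ^^ m) z" "(lift ^^ m) z \<le> 1" by auto
qed

text \<open>Every left step turns the density \<open>h z\<close> into
  \<open>z powr (- \<gamma>)\<close>, which is \<open>lprob z * h z\<close>. Written in terms of the
  end point \<open>y\<close>, the \<open>m\<close> factors form \<open>Q m y\<close>.\<close>

lemma left_steps:
  assumes V[measurable]: "V \<in> borel_measurable borel"
  shows "(\<integral>\<^sup>+z. ennreal (V ((lift ^^ m) z) * h z * indicator {xs (Suc m)..xs m} z) \<partial>lborel) =
    (\<integral>\<^sup>+y. ennreal (V y * Q m y * h y * indicator {b..1} y) \<partial>lborel)"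
  using V
proof (induction m arbitrary: V)
  case 0
  then show ?case by (simp add: Q_0 xs.simps)
next
  case (Suc m)
  note [measurable] = Suc.prems
  have "(\<integral>\<^sup>+z. ennreal (V ((lift ^^ Suc m) z) * h z * indicator {xs (Suc (Suc m))..xs (Suc m)} z) \<partial>lborel) =
     (\<integral>\<^sup>+x. ennreal ((\<lambda>w. V ((lift ^^ m) w)) (lift x) * h x * indicator {xs (Suc (Suc m))..xs (Suc m)} x) \<partial>lborel)"
    by (simp add: funpow_swap1[of lift])
  also have "\<dots> = (\<integral>\<^sup>+z. ennreal (V ((lift ^^ m) z) * z powr (- \<gamma>) * indicator {xs (Suc m)..xs m} z) \<partial>lborel)"
    by (subst lift_substitution) (use xs_pos xs_le_1 less_imp_le[OF xs_Suc_less] lift_xs in \<open>auto\<close>)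
  also have "\<dots> = (\<integral>\<^sup>+z. ennreal ((\<lambda>y. V y * lprob ((linv ^^ m) y)) ((lift ^^ m) z) * h z
      * indicator {xs (Suc m)..xs m} z) \<partial>lborel)"
  proof (rule nn_integral_cong)
    fix z
    show "ennreal (V ((lift ^^ m) z) * z powr (- \<gamma>) * indicator {xs (Suc m)..xs m} z) =
      ennreal ((\<lambda>y. V y * lprob ((linv ^^ m) y)) ((lift ^^ m) z) * h z * indicator {xs (Suc m)..xs m} z)"
    proof (cases "z \<in> {xs (Suc m)..xs m}")
      case True
      then have "z > 0" using xs_pos[of "Suc m"] by auto
      then show ?thesis
        using True linv_pow_lift_pow(1)[of m z] lprob_h[of z] by (simp add: mult.assoc)
    qed simp
  qed
  also have "\<dots> = (\<integral>\<^sup>+y. ennreal (V y * lprob ((linv ^^ m) y) * Q m y * h y * indicator {b..1} y) \<partial>lborel)"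
    by (rule Suc.IH) measurable
  finally show ?case by (simp add: Q_Suc mult_ac)
qed

text \<open>From here the first step lands between \<open>xs (Suc m)\<close> and
  \<open>xs m\<close>, and \<open>m\<close> left steps lead back to \<open>Y\<close>. The intervals
  are closed for the sake of substitution; neighbours share an end point.\<close>

definition branch :: "nat \<Rightarrow> real set" where
  "branch m = {linv (1 + xs (Suc m))..linv (1 + xs m)}"

definition branch_map :: "nat \<Rightarrow> real \<Rightarrow> real" where
  "branch_map m y = (lift ^^ m) (lift y - 1)"

lemma branch_measurable [measurable]: "branch m \<in> sets borel"
  by (simp add: branch_def)

lemma branch_map_measurable [measurable]: "branch_map m \<in> borel_measurable borel"
  unfolding branch_map_def by measurable

text \<open>The initial right step produces \<open>(1 + z) powr (- \<gamma>)\<close>, which is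
  \<open>(1 - lprob z) * h z\<close>, and the \<open>m\<close> left steps produce
  \<open>Q m\<close>. Their product is the mass of index \<open>m\<close>.\<close>

lemma branch_transfer:
  assumes V[measurable]: "V \<in> borel_measurable borel"
  shows "(\<integral>\<^sup>+y. ennreal (V (branch_map m y) * h y * indicator (branch m) y) \<partial>lborel) =
    (\<integral>\<^sup>+y. ennreal (V y * mass m y * h y * indicator {b..1} y) \<partial>lborel)"
proof -
  have p: "0 < 1 + xs n" "1 + xs n \<le> 2" for n using xs_pos[of n] xs_le_1[of n] by auto
  have "(\<integral>\<^sup>+y. ennreal (V (branch_map m y) * h y * indicator (branch m) y) \<partial>lborel) =
     (\<integral>\<^sup>+x. ennreal ((\<lambda>w. V ((lift ^^ m) (w - 1))) (lift x) * h x * indicator {linv (1 + xs (Suc m))..linv (1 + xs m)} x) \<partial>lborel)"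
    by (simp add: branch_map_def branch_def)
  also have "\<dots> = (\<integral>\<^sup>+z. ennreal (V ((lift ^^ m) (z - 1)) * z powr (- \<gamma>) * indicator {1 + xs (Suc m)..1 + xs m} z) \<partial>lborel)"
    by (subst lift_substitution)
      (use linv[OF p] linv_le_iff[OF p p] less_imp_le[OF xs_Suc_less] in \<open>auto\<close>)
  also have "\<dots> = (\<integral>\<^sup>+z. ennreal (V ((lift ^^ m) z) * (1 + z) powr (- \<gamma>) * indicator {xs (Suc m)..xs m} z) \<partial>lborel)"
    by (subst nn_integral_real_affine[where c=1 and t=1])
      (auto simp: indicator_def intro!: nn_integral_cong)
  also have "\<dots> = (\<integral>\<^sup>+z. ennreal ((\<lambda>y. V y * (1 - lprob ((linv ^^ m) y))) ((lift ^^ m) z) * h z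
      * indicator {xs (Suc m)..xs m} z) \<partial>lborel)"
  proof (rule nn_integral_cong)
    fix z
    show "ennreal (V ((lift ^^ m) z) * (1 + z) powr (- \<gamma>) * indicator {xs (Suc m)..xs m} z) =
      ennreal ((\<lambda>y. V y * (1 - lprob ((linv ^^ m) y))) ((lift ^^ m) z) * h z * indicator {xs (Suc m)..xs m} z)"
    proof (cases "z \<in> {xs (Suc m)..xs m}")
      case True
      then have "z > 0" using xs_pos[of "Suc m"] by auto
      then show ?thesis
        using True linv_pow_lift_pow(1)[of m z] lprob_h'[of z] by (simp add: mult.assoc)
    qed simp
  qed
  also have "\<dots> = (\<integral>\<^sup>+y. ennreal (V y * (1 - lprob ((linv ^^ m) y)) * Q m y * h y * indicator {b..1} y) \<partial>lborel)"
    by (rule left_steps) measurable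
  finally show ?thesis by (simp add: Q_Suc algebra_simps)
qed

text \<open>By \<open>left_steps\<close> this is the integral of \<open>h\<close> between
  \<open>xs (Suc m)\<close> and \<open>xs m\<close>. A primitive of \<open>h\<close> is
  \<open>pint x + pint (1 + x)\<close>, and the recursion \<open>pint_xs\<close> cancels all but one
  term. The case \<open>m = 0\<close> gives the normalising constant \<open>pint 2\<close>.\<close>

lemma left_mass:
  "(\<integral>\<^sup>+y. ennreal (Q m y * h y * indicator {b..1} y) \<partial>lborel) = ennreal (pint (1 + xs m))"
proof -
  have "(\<integral>\<^sup>+y. ennreal (Q m y * h y * indicator {b..1} y) \<partial>lborel) =
      (\<integral>\<^sup>+z. ennreal (h z) * indicator {xs (Suc m)..xs m} z \<partial>lborel)"
    using left_steps[of "\<lambda>_. 1" m] by (simp add: ennreal_mult'' ennreal_indicator)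
  also have "\<dots> = ennreal ((pint (xs m) + pint (1 + xs m)) - (pint (xs (Suc m)) + pint (1 + xs (Suc m))))"
  proof (rule nn_integral_FTC_Icc)
    show "xs (Suc m) \<le> xs m" by (rule less_imp_le[OF xs_Suc_less])
    fix x assume x: "x \<in> {xs (Suc m)..xs m}"
    then have "x > 0" using xs_pos[of "Suc m"] by auto
    then show "0 \<le> h x" using h_pos[of x] by simp
    have "((\<lambda>x. pint x + pint (1 + x)) has_real_derivative (x powr - \<gamma> + (1 + x) powr - \<gamma> * (0 + 1))) (at x)"
      using \<open>x > 0\<close> by (intro DERIV_add DERIV_chain2[OF pint_deriv] pint_deriv DERIV_const DERIV_ident) auto
    then show "((\<lambda>x. pint x + pint (1 + x)) has_real_derivative h x) (at x)"
      by (simp add: thaler_h_def add.commute)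
  qed measurable
  also have "(pint (xs m) + pint (1 + xs m)) - (pint (xs (Suc m)) + pint (1 + xs (Suc m))) = pint (1 + xs m)"
    using pint_xs[of m] by linarith
  finally show ?thesis .
qed

end

section \<open>Return times\<close>

context thaler
begin

abbreviation \<mu> :: "real measure" where "\<mu> \<equiv> thaler_mu \<gamma>"

lemma xstar_eq: "thaler_xstar \<gamma> = b"
  unfolding thaler_xstar_def
proof (rule the_equality)
  have lift_1_iff: "lift x = 1 \<longleftrightarrow> x powr (1 - \<gamma>) + (1 + x) powr (1 - \<gamma>) = 2" if "0 < x" "x \<le> 1" for x
  proof -
    have "lift x = 1 \<longleftrightarrow> pint x + pint (1 + x) = 0"
      using pint_inj[of "lift x" 1] lift_pos[OF that] pint_lift[OF that] by (simp add: pint_1)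
    also have "\<dots> \<longleftrightarrow> x powr (1 - \<gamma>) + (1 + x) powr (1 - \<gamma>) = 2"
      unfolding pint_def add_divide_distrib[symmetric] using \<gamma>_neq_1 by auto
    finally show ?thesis .
  qed
  show "0 < b \<and> b < 1 \<and> b powr (1 - \<gamma>) + (1 + b) powr (1 - \<gamma>) = 2"
    using lift_1_iff[OF b_bounds(1) less_imp_le[OF b_bounds(2)]] linv(3)[of 1] b_bounds(1,2) by simp
  fix x assume "0 < x \<and> x < 1 \<and> x powr (1 - \<gamma>) + (1 + x) powr (1 - \<gamma>) = 2"
  then show "x = b" using lift_1_iff[of x] linv_lift[of x] by auto
qed

lemma Y_eq: "thaler_Y \<gamma> = {b<..1}"
  by (simp add: thaler_Y_def xstar_eq)

lemma space_mu: "space \<mu> = {b<..1}"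
  by (simp add: thaler_mu_def space_restrict_space Y_eq)

lemma sets_mu: "sets \<mu> = sets (restrict_space borel {b<..1})"
  by (simp add: thaler_mu_def Y_eq sets_restrict_space)

lemma measurable_mu [measurable (raw)]:
  "f \<in> borel \<rightarrow>\<^sub>M N \<Longrightarrow> f \<in> \<mu> \<rightarrow>\<^sub>M N"
  unfolding measurable_cong_sets[OF sets_mu refl] by (rule measurable_restrict_space1)

lemma density_const: "(1 - \<gamma>) / (2 powr (1 - \<gamma>) - 1) = 1 / pint 2"
  using \<gamma>_neq_1 by (simp add: pint_def)

lemma nn_integral_mu:
  assumes V[measurable]: "V \<in> borel_measurable borel" and V0: "\<And>x. 0 \<le> V x"
  shows "(\<integral>\<^sup>+y. ennreal (V y) \<partial>\<mu>) =
    ennreal (1 / pint 2) * (\<integral>\<^sup>+y. ennreal (V y * h y * indicator {b..1} y) \<partial>lborel)"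
proof -
  have p2: "1 / pint 2 \<ge> 0" using pint_pos[of 2] by simp
  have "(\<integral>\<^sup>+y. ennreal (V y) \<partial>\<mu>) =
    (\<integral>\<^sup>+y. ennreal (1 / pint 2 * h y) * ennreal (V y) * indicator {b<..1} y \<partial>lborel)"
    unfolding thaler_mu_def Y_eq density_const
    by (subst nn_integral_density) (auto simp: nn_integral_restrict_space intro!: measurable_restrict_space1)
  also have "\<dots> = (\<integral>\<^sup>+y. ennreal (1 / pint 2) * ennreal (V y * h y * indicator {b..1} y) \<partial>lborel)"
  proof (rule nn_integral_cong_AE)
    \<comment> \<open>\<open>Y\<close> omits its left end point, whereas the substitutions use
      closed intervals; the single point \<open>b\<close> is null.\<close>
    have "ennreal (1 / pint 2 * h y) * ennreal (V y) * indicator {b<..1} y =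
      ennreal (1 / pint 2) * ennreal (V y * h y * indicator {b..1} y)" if "y \<noteq> b" for y
    proof (cases "y \<in> {b..1}")
      case True
      then have "0 \<le> h y" using h_pos[of y] b_bounds(1) by simp
      then have "ennreal (1 / pint 2 * h y) * ennreal (V y) = ennreal (1 / pint 2) * ennreal (V y * h y)"
        using p2 V0[of y] by (simp only: ennreal_mult mult_ac)
      then show ?thesis using True that by simp
    qed simp
    then show "AE y in lborel. ennreal (1 / pint 2 * h y) * ennreal (V y) * indicator {b<..1} y =
      ennreal (1 / pint 2) * ennreal (V y * h y * indicator {b..1} y)"
      using AE_lborel_singleton[of b] by (auto elim!: eventually_mono)
  qed
  also have "\<dots> = ennreal (1 / pint 2) * (\<integral>\<^sup>+y. ennreal (V y * h y * indicator {b..1} y) \<partial>lborel)"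
    by (rule nn_integral_cmult) measurable
  finally show ?thesis .
qed

section \<open>The law of the first return time and the monotone kernel\<close>

definition tail :: "nat \<Rightarrow> real" where
  "tail m = pint (1 + xs m) / pint 2"

lemma tail_0: "tail 0 = 1"
  using pint_pos[of 2] by (simp add: tail_def)

lemma tail_pos: "0 < tail m"
  using pint_pos[of 2] pint_pos[of "1 + xs m"] xs_pos[of m] by (simp add: tail_def)

lemma decseq_tail: "decseq tail"
proof (rule decseq_SucI)
  fix m
  have "pint (1 + xs (Suc m)) \<le> pint (1 + xs m)"
    using pint_le_iff[of "1 + xs (Suc m)" "1 + xs m"] xs_pos[of m] xs_pos[of "Suc m"] xs_Suc_less[of m] by simp
  then show "tail (Suc m) \<le> tail m"
    using pint_pos[of 2] by (simp add: tail_def divide_right_mono)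
qed

lemma tail_lim: "tail \<longlonglongrightarrow> 0"
proof (rule Lim_null_comparison)
  have "\<bar>tail m\<bar> \<le> xs m / pint 2" for m
  proof -
    have "tail m \<le> xs m / pint 2"
      unfolding tail_def using pint_1_plus_le[OF xs_pos, of m] pint_pos[of 2]
      by (intro divide_right_mono) auto
    then show ?thesis using tail_pos[of m] by simp
  qed
  then show "eventually (\<lambda>m. norm (tail m) \<le> xs m / pint 2) sequentially" by simp
  show "(\<lambda>m. xs m / pint 2) \<longlonglongrightarrow> 0"
    using tendsto_divide[OF xs_lim tendsto_const, of "pint 2"] pint_pos[of 2] by simp
qed

lemma nn_integral_Q: "(\<integral>\<^sup>+y. ennreal (Q m y) \<partial>\<mu>) = ennreal (tail m)"
proof -
  \<comment> \<open>Absolute values are inserted because \<open>nn_integral_mu\<close> requires an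
    integrand that is non-negative off \<open>Y\<close> as well.\<close>
  have "(\<integral>\<^sup>+y. ennreal (Q m y) \<partial>\<mu>) = (\<integral>\<^sup>+y. ennreal (\<bar>Q m y\<bar>) \<partial>\<mu>)"
    using b_bounds(1,2)
    by (intro nn_integral_cong arg_cong[where f = ennreal] abs_of_pos[symmetric] Q_pos) (auto simp: space_mu)
  also have "\<dots> = ennreal (1 / pint 2) * (\<integral>\<^sup>+y. ennreal (\<bar>Q m y\<bar> * h y * indicator {b..1} y) \<partial>lborel)"
    by (rule nn_integral_mu) auto
  also have "(\<integral>\<^sup>+y. ennreal (\<bar>Q m y\<bar> * h y * indicator {b..1} y) \<partial>lborel) =
      (\<integral>\<^sup>+y. ennreal (Q m y * h y * indicator {b..1} y) \<partial>lborel)"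
    using Q_pos b_bounds(1,2) by (intro nn_integral_cong) (auto simp: indicator_def less_imp_le)
  also have "\<dots> = ennreal (pint (1 + xs m))" by (rule left_mass)
  also have "ennreal (1 / pint 2) * \<dots> = ennreal (tail m)"
    using pint_pos[of 2] pint_pos[of "1 + xs m"] xs_pos[of m]
    by (subst ennreal_mult[symmetric]) (auto simp: tail_def)
  finally show ?thesis .
qed

lemma prob_space_mu: "prob_space \<mu>"
  using nn_integral_Q[of 0] by (intro prob_spaceI) (simp add: Q_0 tail_0)

lemma integrable_Q: "integrable \<mu> (Q m)"
  using nn_integral_Q[of m] Q_pos b_bounds(1,2)
  by (intro integrableI_nonneg) (auto simp: space_mu less_imp_le intro!: AE_I2)

lemma integral_Q: "(\<integral>y. Q m y \<partial>\<mu>) = tail m"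
  using nn_integral_Q[of m] Q_pos b_bounds(1,2) tail_pos[of m]
  by (intro integral_eq_nn_integral[THEN trans]) (auto simp: space_mu less_imp_le intro!: AE_I2)

lemma Q_1_le_tail: "Q m 1 \<le> tail m"
proof -
  interpret prob_space \<mu> by (rule prob_space_mu)
  have "(\<integral>y. Q m 1 \<partial>\<mu>) \<le> (\<integral>y. Q m y \<partial>\<mu>)"
    using integrable_Q Q_anti[of _ 1 m] b_bounds(1,2) by (intro integral_mono) (auto simp: space_mu)
  then show ?thesis by (simp add: integral_Q prob_space)
qed

text \<open>\<open>Q m\<close> is largest at \<open>b\<close> and smallest at 1, but
  \<open>b\<close> is the left preimage of 1, so the value at \<open>b\<close> is the next value at
  1 divided by \<open>lprob 1\<close>. As the smallest value lies below the mean, the mean alone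
  bounds all tails uniformly.\<close>

lemma Q_b_le: "Q m b \<le> tail (Suc m) / lprob 1"
  using Q_1_le_tail[of "Suc m"] lprob_pos[of 1] unfolding Q_Suc_shift by (simp add: field_simps)

lemma Q_lim:
  assumes "y \<in> {b..1}" shows "(\<lambda>m. Q m y) \<longlonglongrightarrow> 0"
proof (rule Lim_null_comparison)
  have "norm (Q m y) \<le> tail (Suc m) / lprob 1" for m
    using Q_b_le[of m] Q_anti[of b y m] Q_pos[of y m] assms b_bounds(1,2) by auto
  then show "eventually (\<lambda>m. norm (Q m y) \<le> tail (Suc m) / lprob 1) sequentially" by simp
  show "(\<lambda>m. tail (Suc m) / lprob 1) \<longlonglongrightarrow> 0"
    using tendsto_divide[OF LIMSEQ_Suc[OF tail_lim] tendsto_const, of "lprob 1"] lprob_pos[of 1] by simp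
qed

text \<open>The probability of a positive index from the top point 1, and that of index 0 from the
  bottom point \<open>b\<close>.\<close>

definition gap :: real where "gap = min (lprob 1) (1 - lprob b)"

sublocale kernel: monotone_kernel b 1 Q \<sigma> gap
proof
  have m: "0 < y" "y \<le> 1" if "y \<in> {b..1}" for y using that b_bounds(1,2) by auto
  have s: "0 < 1 + (linv ^^ k) y" "1 + (linv ^^ k) y \<le> 2" if "y \<in> {b..1}" for k y
    using linv_pow[OF m[OF that], of k] by auto
  show "b \<le> 1" using b_bounds(1,2) by simp
  show "Q 0 y = 1" if "y \<in> {b..1}" for y by (rule Q_0)
  show "0 \<le> Q k y" if "y \<in> {b..1}" for k y using Q_pos[OF m[OF that]] by (rule less_imp_le)
  show "Q (Suc k) y \<le> Q k y" if "y \<in> {b..1}" for k y using Q_Suc_le[OF m[OF that]] .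
  show "(\<lambda>k. Q k y) \<longlonglongrightarrow> 0" if "y \<in> {b..1}" for y using that by (rule Q_lim)
  show "Q k y' \<le> Q k y" if "y \<in> {b..1}" "y' \<in> {b..1}" "y \<le> y'" for k y y'
    using Q_anti[of y y' k] m[OF that(1)] m[OF that(2)] that(3) by simp
  show "\<sigma> k y \<in> {b..1}" if "y \<in> {b..1}" for k y
  proof -
    have "b \<le> linv (1 + (linv ^^ k) y)"
      using linv_le_iff[of 1 "1 + (linv ^^ k) y"] s[OF that] linv_pow(1)[OF m[OF that], of k] by simp
    then show ?thesis using linv(2)[OF s[OF that]] by (simp add: \<sigma>_def)
  qed
  show "\<sigma> k y \<le> \<sigma> k y'" if "y \<in> {b..1}" "y' \<in> {b..1}" "y \<le> y'" for k y y'
    unfolding \<sigma>_def linv_le_iff[OF s[OF that(1)] s[OF that(2)]]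
    using linv_pow_mono[of y y' k] m[OF that(1)] m[OF that(2)] that(3) by simp
  show "\<sigma> (Suc k) y \<le> \<sigma> k y" if "y \<in> {b..1}" for k y
    unfolding \<sigma>_def linv_le_iff[OF s[OF that] s[OF that]] using linv_pow_Suc_le[OF m[OF that], of k] by simp
  show "0 < gap" using lprob_pos[of 1] lprob_less_1[of b] b_bounds(1,2) by (simp add: gap_def)
  show "Q 1 b \<le> 1 - gap" "gap \<le> Q 1 1" using Q_Suc[of 0 b] Q_Suc[of 0 1] Q_0 by (simp_all add: gap_def)
  \<comment> \<open>Both sides equal \<open>linv (1 + b)\<close>: this is the level that is crossed
    from both end points.\<close>
  show "\<sigma> 1 1 \<le> \<sigma> 0 b" by (simp add: \<sigma>_def)
qed

text \<open>\<open>ret\<close> counts return times from 0.\<close>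

definition ret :: "real \<Rightarrow> nat" where "ret y = return_time \<gamma> 0 y - 1"

definition ret_map :: "real \<Rightarrow> real" where
  "ret_map y = (thaler_map \<gamma> ^^ return_time \<gamma> 0 y) y"

abbreviation ret_at :: "nat \<Rightarrow> real \<Rightarrow> nat" where
  "ret_at j y \<equiv> ret ((ret_map ^^ j) y)"

lemma return_time_0: "return_time \<gamma> 0 y = (LEAST k. 1 \<le> k \<and> (thaler_map \<gamma> ^^ k) y \<in> thaler_Y \<gamma>)"
  by (subst return_time.simps) simp

text \<open>After the first \<open>j\<close> return times the orbit stands at the
  \<open>j\<close>-th iterate of the first return map. This holds for every \<open>y\<close>, since
  an unspecified \<open>LEAST\<close> is unspecified in the same way on both sides.\<close>

lemma return_time_iterate: "return_time \<gamma> j y = return_time \<gamma> 0 ((ret_map ^^ j) y)"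
proof -
  have eq: "(thaler_map \<gamma> ^^ (\<Sum>i<j. return_time \<gamma> i y)) y = (ret_map ^^ j) y \<and>
      return_time \<gamma> j y = return_time \<gamma> 0 ((ret_map ^^ j) y)" for j
  proof (induction j)
    case (Suc j)
    have 1: "(thaler_map \<gamma> ^^ (\<Sum>i<Suc j. return_time \<gamma> i y)) y = (ret_map ^^ Suc j) y"
      using Suc by (simp add: ret_map_def[of "(ret_map ^^ j) y"] add.commute[of "sum _ _"] funpow_add)
    moreover have "return_time \<gamma> (Suc j) y = return_time \<gamma> 0 ((ret_map ^^ Suc j) y)"
      unfolding return_time_0 1[symmetric]
      by (subst return_time.simps) (simp only: funpow_add add.commute[of "sum _ _"] comp_def)
    ultimately show ?case by blast
  qed simp
  then show ?thesis by blast
qed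

lemma thaler_map_measurable [measurable]: "thaler_map \<gamma> \<in> borel_measurable borel"
  unfolding thaler_map_def frac_def by measurable

lemma return_time_0_measurable [measurable]: "return_time \<gamma> 0 \<in> borel \<rightarrow>\<^sub>M count_space UNIV"
proof -
  have "return_time \<gamma> 0 = (\<lambda>y. LEAST k. 1 \<le> k \<and> (thaler_map \<gamma> ^^ k) y \<in> {b<..1})"
    by (rule ext) (simp add: return_time_0 Y_eq)
  then show ?thesis by simp
qed

lemma ret_map_measurable [measurable]: "ret_map \<in> borel_measurable borel"
  unfolding ret_map_def by (rule measurable_compose_countable) measurable

lemma return_time_measurable [measurable]: "return_time \<gamma> j \<in> borel \<rightarrow>\<^sub>M count_space UNIV"
proof -
  have "return_time \<gamma> j = (\<lambda>y. return_time \<gamma> 0 ((ret_map ^^ j) y))"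
    by (rule ext) (rule return_time_iterate)
  then show ?thesis by (rule ssubst) measurable
qed

lemma ret_measurable [measurable]: "ret \<in> borel \<rightarrow>\<^sub>M count_space UNIV"
  unfolding ret_def by measurable


section \<open>Branches of the first return map\<close>

lemma lift_pow_between:
  assumes "xs (Suc (k + i)) < z" "z < xs (k + i)"
  shows "xs (Suc i) < (lift ^^ k) z \<and> (lift ^^ k) z < xs i \<and> (thaler_map \<gamma> ^^ k) z = (lift ^^ k) z"
  using assms
proof (induction k arbitrary: z)
  case (Suc k)
  have z: "0 < z" "z \<le> 1"
    using Suc.prems xs_pos[of "Suc (Suc k + i)"] xs_le_1[of "Suc k + i"] by linarith+
  have "xs (Suc (k + i)) < lift z" "lift z < xs (k + i)"
    using lift_less_iff[OF xs_pos xs_le_1 z, of "Suc (Suc (k + i))"]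
      lift_less_iff[OF z xs_pos xs_le_1, of "Suc (k + i)"] Suc.prems lift_xs
    by (simp_all)
  moreover have "thaler_map \<gamma> z = lift z"
    using thaler_map_eq[OF z] \<open>lift z < xs (k + i)\<close> xs_le_1[of "k + i"] lift_pos[OF z]
    by (simp add: frac_eq)
  ultimately show ?case using Suc.IH[of "lift z"]
    by (simp add: funpow_Suc_right del: funpow.simps)
qed auto

text \<open>The inequalities are strict because the orbit of an end point reaches a place where
  \<open>lift\<close> is an integer, and reduction modulo 1 sends it to 0.\<close>

lemma branch_interior:
  assumes "linv (1 + xs (Suc m)) < y" "y < linv (1 + xs m)"
  shows "ret y = m" "return_time \<gamma> 0 y = Suc m" "ret_map y = branch_map m y" "branch_map m y \<in> {b<..1}"
    "\<sigma> m (branch_map m y) = y" "\<And>k. y \<in> branch k \<longleftrightarrow> k = m"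
proof -
  have p: "0 < 1 + xs n" "1 + xs n \<le> 2" for n using xs_pos[of n] xs_le_1[of n] by auto
  have y: "0 < y" "y \<le> 1" using assms linv[OF p, of "Suc m"] linv[OF p, of m] by linarith+
  define z where "z = lift y - 1"
  have z: "xs (Suc m) < z" "z < xs m"
    using lift_less_iff[OF linv(1,2)[OF p] y, of "Suc m"] lift_less_iff[OF y linv(1,2)[OF p], of m]
      assms linv(3)[OF p]
    by (simp_all add: z_def)
  have Ty: "thaler_map \<gamma> y = z"
  proof -
    have "frac (lift y) = lift y - 1"
      using z xs_pos[of "Suc m"] xs_le_1[of m] unfolding z_def
      by (intro frac_unique_iff[THEN iffD2]) auto
    then show ?thesis using thaler_map_eq[OF y] by (simp add: z_def)
  qed
  have iter: "xs (Suc (m - k)) < (lift ^^ k) z \<and> (lift ^^ k) z < xs (m - k) \<and> (thaler_map \<gamma> ^^ Suc k) y = (lift ^^ k) z"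
    if "k \<le> m" for k
    using lift_pow_between[of k "m - k" z] z that
    by (simp add: Ty funpow_Suc_right del: funpow.simps)
  have bm: "branch_map m y = (lift ^^ m) z" by (simp add: branch_map_def z_def)
  have xs1: "xs (Suc 0) = b" by (simp add: xs.simps)
  show in_Y: "branch_map m y \<in> {b<..1}"
    using iter[of m] xs1 unfolding bm by simp
  show rt: "return_time \<gamma> 0 y = Suc m"
    unfolding return_time_0
  proof (rule Least_equality)
    show "1 \<le> Suc m \<and> (thaler_map \<gamma> ^^ Suc m) y \<in> thaler_Y \<gamma>"
      using iter[of m] in_Y unfolding bm Y_eq by (simp del: funpow.simps)
    fix j assume j: "1 \<le> j \<and> (thaler_map \<gamma> ^^ j) y \<in> thaler_Y \<gamma>"
    show "Suc m \<le> j"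
    proof (rule ccontr)
      assume "\<not> Suc m \<le> j"
      then obtain k where k: "j = Suc k" "k < m" using j by (cases j) auto
      then have "(thaler_map \<gamma> ^^ j) y < xs (m - k)" using iter[of k] by (simp del: funpow.simps)
      also have "\<dots> \<le> xs (Suc 0)" using k by (intro xs_le) auto
      finally show False using j xs1 by (simp add: Y_eq)
    qed
  qed
  then show "ret y = m" by (simp add: ret_def)
  show "ret_map y = branch_map m y"
    unfolding ret_map_def rt bm using iter[of m] by (simp del: funpow.simps)
  show "\<sigma> m (branch_map m y) = y"
    unfolding bm \<sigma>_def using linv_pow_lift_pow(1)[of m z] z linv_lift[OF y] by (simp add: z_def)
  show "y \<in> branch k \<longleftrightarrow> k = m" for k
  proof (cases k m rule: linorder_cases)
    case less
    then have "linv (1 + xs m) \<le> linv (1 + xs (Suc k))"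
      using linv_le_iff[OF p p, of m "Suc k"] xs_le[of "Suc k" m] by simp
    then show ?thesis using less assms by (auto simp: branch_def)
  next
    case greater
    then have "linv (1 + xs k) \<le> linv (1 + xs (Suc m))"
      using linv_le_iff[OF p p, of k "Suc m"] xs_le[of "Suc m" k] by simp
    then show ?thesis using greater assms by (auto simp: branch_def)
  qed (use assms in \<open>auto simp: branch_def\<close>)
qed

text \<open>\<open>lift y - 1\<close> lies in (0,1], which the sequence \<open>xs\<close> decreasing
  to 0 cuts into intervals. Only the countably many cut points are lost.\<close>

lemma AE_branch_interior:
  "AE y in \<mu>. \<exists>m. linv (1 + xs (Suc m)) < y \<and> y < linv (1 + xs m)"
proof -
  define N where "N = range (\<lambda>m. linv (1 + xs m))"
  have "countable N" by (simp add: N_def)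
  then have "AE y in lborel. y \<notin> N"
    by (intro AE_not_in countable_imp_null_set_lborel)
  moreover have "\<exists>m. linv (1 + xs (Suc m)) < y \<and> y < linv (1 + xs m)" if y: "y \<in> {b<..1}" "y \<notin> N" for y
  proof -
    have p: "0 < 1 + xs n" "1 + xs n \<le> 2" for n using xs_pos[of n] xs_le_1[of n] by auto
    have y': "0 < y" "y \<le> 1" using y b_bounds(1) by auto
    define z where "z = lift y - 1"
    have z: "0 < z" "z \<le> 1"
      using lift_less_iff[of b y] linv[of 1] lift_less_iff[of 1 y] lift_1 y y' by (auto simp: z_def)
    have cmp: "linv (1 + xs n) < y \<longleftrightarrow> xs n < z" "y < linv (1 + xs n) \<longleftrightarrow> z < xs n" for n
      using lift_less_iff[OF linv(1,2)[OF p] y', of n] lift_less_iff[OF y' linv(1,2)[OF p], of n] linv(3)[OF p, of n]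
      by (simp_all add: z_def less_diff_eq diff_less_eq add.commute)
    have ne: "z \<noteq> xs n" for n
    proof
      assume "z = xs n"
      then have "lift y = 1 + xs n" by (simp add: z_def)
      then have "y = linv (1 + xs n)" using linv_lift[OF y'] by simp
      then show False using y(2) by (simp add: N_def)
    qed
    obtain n where n: "xs n < z"
      using order_tendstoD(2)[OF xs_lim z(1)] by (auto simp: eventually_sequentially)
    define m where "m = (LEAST n. xs (Suc n) < z)"
    have "xs (Suc n) < z" using n xs_Suc_less[of n] by linarith
    then have m1: "xs (Suc m) < z" unfolding m_def by (rule LeastI)
    have m2: "z < xs m"
    proof (cases m)
      case 0
      then show ?thesis using z ne[of 0] by simp
    next
      case (Suc k)
      then have "\<not> xs (Suc k) < z" using not_less_Least[of k "\<lambda>n. xs (Suc n) < z"] by (simp add: m_def)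
      then show ?thesis using Suc ne[of "Suc k"] by simp
    qed
    show ?thesis using m1 m2 cmp by blast
  qed
  ultimately have "AE y in lborel. y \<in> {b<..1} \<longrightarrow> (\<exists>m. linv (1 + xs (Suc m)) < y \<and> y < linv (1 + xs m))"
    by (auto elim!: eventually_mono)
  then show ?thesis
    unfolding thaler_mu_def Y_eq
    by (subst AE_density) (auto simp: AE_restrict_space_iff intro!: measurable_restrict_space1 elim!: eventually_mono)
qed

section \<open>Duality between the first return map and the kernel\<close>

lemma Q_diff_nonneg: "y \<in> {b..1} \<Longrightarrow> 0 \<le> Q k y - Q (Suc k) y"
  by (rule kernel.p_nonneg)

text \<open>\<open>branch_transfer\<close> is about non-negative integrals; read as the equality of
  two measures, it extends to complex \<open>U\<close>.\<close>

lemma branch_integral: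
  fixes U :: "real \<Rightarrow> complex"
  assumes U[measurable]: "U \<in> borel_measurable borel"
  shows "(\<integral>y. indicator (branch k) y *\<^sub>R U (branch_map k y) \<partial>\<mu>) = (\<integral>y. mass k y *\<^sub>R U y \<partial>\<mu>)"
proof -
  \<comment> \<open>The indicator makes the masses non-negative everywhere, as a density must
    be.\<close>
  define p where "p y = mass k y * indicator {b..1} y" for y
  have p0: "0 \<le> p y" for y using Q_diff_nonneg[of y k] by (cases "y \<in> {b..1}") (auto simp: p_def)
  have [measurable]: "p \<in> borel_measurable borel" unfolding p_def by measurable
  have "distr (density \<mu> (\<lambda>y. ennreal (indicator (branch k) y))) borel (branch_map k) =
      distr (density \<mu> (\<lambda>y. ennreal (p y))) borel (\<lambda>y. y)"
  proof (rule measure_eqI)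
    fix A assume "A \<in> sets (distr (density \<mu> (\<lambda>y. ennreal (indicator (branch k) y))) borel (branch_map k))"
    then have A[measurable]: "A \<in> sets borel" by simp
    have "emeasure (distr (density \<mu> (\<lambda>y. ennreal (indicator (branch k) y))) borel (branch_map k)) A =
      (\<integral>\<^sup>+z. indicator A z \<partial>distr (density \<mu> (\<lambda>y. ennreal (indicator (branch k) y))) borel (branch_map k))"
      by simp
    also have "\<dots> = (\<integral>\<^sup>+y. ennreal (indicator (branch k) y) * indicator A (branch_map k y) \<partial>\<mu>)"
      by (subst nn_integral_distr) (auto simp: nn_integral_density)
    also have "\<dots> = (\<integral>\<^sup>+y. ennreal (indicator A (branch_map k y) * indicator (branch k) y) \<partial>\<mu>)"
      by (intro nn_integral_cong) (auto simp: indicator_def)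
    also have "\<dots> = ennreal (1 / pint 2) * (\<integral>\<^sup>+y. ennreal (indicator A (branch_map k y) * h y * indicator (branch k) y) \<partial>lborel)"
    proof -
      have "branch k \<subseteq> {b..1}"
      proof -
        have p: "0 < 1 + xs n" "1 + xs n \<le> 2" for n using xs_pos[of n] xs_le_1[of n] by auto
        have "b \<le> linv (1 + xs (Suc k))"
          using linv_le_iff[OF _ _ p, of 1 "Suc k"] xs_pos[of "Suc k"] by simp
        then show ?thesis using linv(2)[OF p, of k] by (auto simp: branch_def)
      qed
      then show ?thesis
        by (subst nn_integral_mu)
           (auto intro!: arg_cong[where f = "(*) _"] nn_integral_cong simp: indicator_def)
    qed
    also have "\<dots> = ennreal (1 / pint 2) *
        (\<integral>\<^sup>+y. ennreal (indicator A y * mass k y * h y * indicator {b..1} y) \<partial>lborel)"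
      by (subst branch_transfer) auto
    also have "\<dots> = (\<integral>\<^sup>+y. ennreal (indicator A y * p y) \<partial>\<mu>)"
      using p0 by (subst nn_integral_mu)
         (auto intro!: arg_cong[where f = "(*) _"] nn_integral_cong simp: indicator_def p_def)
    also have "\<dots> = (\<integral>\<^sup>+y. ennreal (p y) * indicator A y \<partial>\<mu>)"
      by (intro nn_integral_cong) (auto simp: indicator_def)
    also have "\<dots> = (\<integral>\<^sup>+z. indicator A z \<partial>distr (density \<mu> (\<lambda>y. ennreal (p y))) borel (\<lambda>y. y))"
      by (subst nn_integral_distr) (auto simp: nn_integral_density)
    also have "\<dots> = emeasure (distr (density \<mu> (\<lambda>y. ennreal (p y))) borel (\<lambda>y. y)) A" by simp
    finally show "emeasure (distr (density \<mu> (\<lambda>y. ennreal (indicator (branch k) y))) borel (branch_map k)) A =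
      emeasure (distr (density \<mu> (\<lambda>y. ennreal (p y))) borel (\<lambda>y. y)) A" .
  qed simp
  then have "(\<integral>z. U z \<partial>distr (density \<mu> (\<lambda>y. ennreal (indicator (branch k) y))) borel (branch_map k)) =
      (\<integral>z. U z \<partial>distr (density \<mu> (\<lambda>y. ennreal (p y))) borel (\<lambda>y. y))" by simp
  moreover have "(\<integral>z. U z \<partial>distr (density \<mu> (\<lambda>y. ennreal (indicator (branch k) y))) borel (branch_map k)) =
      (\<integral>y. indicator (branch k) y *\<^sub>R U (branch_map k y) \<partial>\<mu>)"
    by (subst integral_distr) (auto simp: integral_density)
  moreover have "(\<integral>z. U z \<partial>distr (density \<mu> (\<lambda>y. ennreal (p y))) borel (\<lambda>y. y)) = (\<integral>y. p y *\<^sub>R U y \<partial>\<mu>)"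
    using p0 by (subst integral_distr) (auto simp: integral_density)
  moreover have "\<dots> = (\<integral>y. mass k y *\<^sub>R U y \<partial>\<mu>)"
    by (intro Bochner_Integration.integral_cong) (auto simp: p_def space_mu)
  ultimately show ?thesis by simp
qed

lemma integrable_mu_bounded:
  fixes f :: "real \<Rightarrow> 'a::{banach, second_countable_topology}"
  assumes [measurable]: "f \<in> borel_measurable borel" and "\<And>y. y \<in> {b<..1} \<Longrightarrow> norm (f y) \<le> B"
  shows "integrable \<mu> f"
proof -
  interpret prob_space \<mu> by (rule prob_space_mu)
  show ?thesis using assms(2) by (intro integrable_const_bound[where B=B]) (auto simp: space_mu intro!: AE_I2)
qed

text \<open>\<open>kernel.E\<close> weighted by \<open>g\<close> is the transfer operator of the
  first return map, that is, the adjoint of composition with \<open>ret_map\<close>. Almost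
  everywhere the old point is recovered from the new one as
  \<open>\<sigma> (ret y) (ret_map y)\<close>.\<close>

lemma transfer:
  fixes w V :: "real \<Rightarrow> complex" and g :: "nat \<Rightarrow> complex"
  assumes [measurable]: "w \<in> borel_measurable borel" "V \<in> borel_measurable borel"
    and w: "\<And>z. z \<in> {b..1} \<Longrightarrow> norm (w z) \<le> 1" and V: "\<And>z. z \<in> {b..1} \<Longrightarrow> norm (V z) \<le> 1"
    and g: "\<And>k. norm (g k) \<le> B"
  shows "(\<integral>y. w y * g (ret y) * V (ret_map y) \<partial>\<mu>) = (\<Sum>k. \<integral>y. mass k y *\<^sub>R (g k * w (\<sigma> k y) * V y) \<partial>\<mu>)"
    and "(\<integral>y. w y * g (ret y) * V (ret_map y) \<partial>\<mu>) = (\<integral>y. kernel.E (\<lambda>k z. g k * w z) y * V y \<partial>\<mu>)"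
proof -
  define U where "U k z = g k * w (\<sigma> k z) * V z" for k z
  define f where "f k y = indicator (branch k) y *\<^sub>R U k (branch_map k y)" for k y
  have [measurable]: "U k \<in> borel_measurable borel" for k unfolding U_def by measurable
  have [measurable]: "f k \<in> borel_measurable borel" for k unfolding f_def by measurable
  have B: "0 \<le> B" using order_trans[OF norm_ge_zero g[of 0]] .
  have U: "norm (U k z) \<le> B" if "z \<in> {b..1}" for k z
  proof -
    have "norm (U k z) \<le> B * 1 * 1"
      unfolding U_def norm_mult using g[of k] w[OF kernel.\<sigma>_in[OF that]] V[OF that] B
      by (intro mult_mono) auto
    then show ?thesis by simp
  qed
  have QU: "(\<integral>y. norm (mass k y *\<^sub>R U k y) \<partial>\<mu>) \<le> (tail k - tail (Suc k)) * B"
    and QU_int: "integrable \<mu> (\<lambda>y. mass k y *\<^sub>R U k y)" for k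
  proof -
    have *: "norm (mass k y *\<^sub>R U k y) \<le> mass k y * B" if "y \<in> {b<..1}" for y
      using U[of y k] Q_diff_nonneg[of y k] that by (auto intro!: mult_left_mono)
    have int: "integrable \<mu> (\<lambda>y. mass k y * B)"
      by (intro integrable_mult_left Bochner_Integration.integrable_diff integrable_Q)
    show int': "integrable \<mu> (\<lambda>y. mass k y *\<^sub>R U k y)"
      using order_trans[OF * abs_ge_self]
      by (intro Bochner_Integration.integrable_bound[OF int]) (auto simp: space_mu intro!: AE_I2)
    have "(\<integral>y. norm (mass k y *\<^sub>R U k y) \<partial>\<mu>) \<le> (\<integral>y. mass k y * B \<partial>\<mu>)"
      using * by (intro integral_mono integrable_norm int int') (auto simp: space_mu)
    also have "\<dots> = (tail k - tail (Suc k)) * B"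
      by (simp add: integral_Q integrable_Q)
    finally show "(\<integral>y. norm (mass k y *\<^sub>R U k y) \<partial>\<mu>) \<le> (tail k - tail (Suc k)) * B" .
  qed
  have sum_tail: "summable (\<lambda>k. (tail k - tail (Suc k)) * B)"
    using telescope_summable'[OF tail_lim] by (rule summable_mult2)
  have f_int: "(\<integral>y. f k y \<partial>\<mu>) = (\<integral>y. mass k y *\<^sub>R U k y \<partial>\<mu>)" for k
    unfolding f_def by (rule branch_integral) measurable
  \<comment> \<open>Almost every point lies in exactly one branch, so the series over branches has
    at most one nonzero term.\<close>
  have AE_single: "AE y in \<mu>. (\<exists>m. \<forall>k. k \<noteq> m \<longrightarrow> f k y = 0) \<and> norm (f k y) \<le> B * indicator (branch k) y \<and>
      w y * g (ret y) * V (ret_map y) = (\<Sum>k. f k y)" for k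
    using AE_branch_interior
  proof eventually_elim
    case (elim y)
    then obtain m where m: "linv (1 + xs (Suc m)) < y" "y < linv (1 + xs m)" by blast
    note br = branch_interior[OF m]
    have "f j y = 0" if "j \<noteq> m" for j using br(6)[of j] that by (simp add: f_def)
    moreover from this have "(\<Sum>k. f k y) = f m y"
      by (subst suminf_finite[of "{m}"]) auto
    moreover have "f m y = w y * g (ret y) * V (ret_map y)"
      using br by (simp add: f_def U_def mult_ac)
    moreover have "norm (f k y) \<le> B * indicator (branch k) y"
      using br(4) br(6)[of k] U[of "branch_map m y" m] by (cases "k = m") (auto simp: f_def)
    ultimately show ?case by auto
  qed
  have ind: "(\<integral>y. indicator (branch k) y \<partial>\<mu>) = tail k - tail (Suc k)"
    and ind_int: "integrable \<mu> (indicator (branch k) :: real \<Rightarrow> real)" for k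
  proof -
    show int: "integrable \<mu> (indicator (branch k) :: real \<Rightarrow> real)"
      by (rule integrable_mu_bounded[where B=1]) (auto simp: indicator_def)
    have "complex_of_real (\<integral>y. indicator (branch k) y \<partial>\<mu>) = (\<integral>y. indicator (branch k) y *\<^sub>R (1::complex) \<partial>\<mu>)"
      by (simp add: scaleR_conv_of_real)
    also have "\<dots> = (\<integral>y. mass k y *\<^sub>R (1::complex) \<partial>\<mu>)"
      using branch_integral[of "\<lambda>_. 1" k] by simp
    also have "\<dots> = complex_of_real (tail k - tail (Suc k))"
      by (simp add: scaleR_conv_of_real integral_Q integrable_Q del: of_real_diff)
    finally show "(\<integral>y. indicator (branch k) y \<partial>\<mu>) = tail k - tail (Suc k)"
      by (simp only: of_real_eq_iff)
  qed
  have f_integrable: "integrable \<mu> (f k)" for k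
  proof (rule Bochner_Integration.integrable_bound)
    show "integrable \<mu> (\<lambda>y. B * indicator (branch k) y)"
      by (intro integrable_mult_right ind_int)
    show "AE y in \<mu>. norm (f k y) \<le> norm (B * indicator (branch k) y :: real)"
      using AE_single[of k]
    proof eventually_elim
      case (elim y)
      then show ?case using B by (simp add: abs_mult)
    qed
  qed measurable
  have "(\<integral>y. w y * g (ret y) * V (ret_map y) \<partial>\<mu>) = (\<integral>y. (\<Sum>k. f k y) \<partial>\<mu>)"
    using AE_single[of 0] by (intro integral_cong_AE) (auto elim!: eventually_mono)
  also have "\<dots> = (\<Sum>k. \<integral>y. f k y \<partial>\<mu>)"
  proof (rule integral_suminf[OF f_integrable])
    show "AE y in \<mu>. summable (\<lambda>k. norm (f k y))"
      using AE_single[of 0]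
    proof eventually_elim
      case (elim y)
      then obtain m where "\<forall>k. k \<noteq> m \<longrightarrow> f k y = 0" by blast
      then show ?case by (intro summable_finite[of "{m}"]) auto
    qed
    show "summable (\<lambda>k. \<integral>y. norm (f k y) \<partial>\<mu>)"
    proof (rule summable_comparison_test'[OF sum_tail])
      fix k
      have "(\<integral>y. norm (f k y) \<partial>\<mu>) \<le> (\<integral>y. B * indicator (branch k) y \<partial>\<mu>)"
        using AE_single[of k] by (intro integral_mono_AE integrable_norm f_integrable integrable_mult_right ind_int)
          (auto elim!: eventually_mono)
      then show "norm (\<integral>y. norm (f k y) \<partial>\<mu>) \<le> (tail k - tail (Suc k)) * B"
        unfolding integral_mult_right_zero ind by (simp add: mult.commute)
    qed
  qed
  also have "\<dots> = (\<Sum>k. \<integral>y. mass k y *\<^sub>R U k y \<partial>\<mu>)" by (simp add: f_int)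
  finally have 1: "(\<integral>y. w y * g (ret y) * V (ret_map y) \<partial>\<mu>) = (\<Sum>k. \<integral>y. mass k y *\<^sub>R U k y \<partial>\<mu>)" .
  then show "(\<integral>y. w y * g (ret y) * V (ret_map y) \<partial>\<mu>) = (\<Sum>k. \<integral>y. mass k y *\<^sub>R (g k * w (\<sigma> k y) * V y) \<partial>\<mu>)"
    by (simp add: U_def)
  have gw: "norm (g k * w z) \<le> B" if "z \<in> {b..1}" for k z
    using mult_mono[OF g[of k] w[OF that] B] by (simp add: norm_mult)
  have "(\<Sum>k. \<integral>y. mass k y *\<^sub>R U k y \<partial>\<mu>) = (\<integral>y. (\<Sum>k. mass k y *\<^sub>R U k y) \<partial>\<mu>)"
  proof (rule integral_suminf[OF QU_int, symmetric])
    show "AE y in \<mu>. summable (\<lambda>k. norm (mass k y *\<^sub>R U k y))"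
    proof (rule AE_I2)
      fix y assume "y \<in> space \<mu>"
      then have y: "y \<in> {b..1}" by (auto simp: space_mu)
      have "summable (\<lambda>k. norm (mass k y *\<^sub>R (g k * w (\<sigma> k y))) * norm (V y))"
        by (intro summable_mult2 kernel.norm_summable_E[OF _ y, of "\<lambda>k z. g k * w z" B] gw)
      then show "summable (\<lambda>k. norm (mass k y *\<^sub>R U k y))"
        by (simp add: U_def norm_mult mult_ac)
    qed
    show "summable (\<lambda>k. \<integral>y. norm (mass k y *\<^sub>R U k y) \<partial>\<mu>)"
      by (rule summable_comparison_test'[OF sum_tail]) (use QU in simp)
  qed
  also have "\<dots> = (\<integral>y. kernel.E (\<lambda>k z. g k * w z) y * V y \<partial>\<mu>)"
  proof (rule Bochner_Integration.integral_cong[OF refl])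
    fix y assume "y \<in> space \<mu>"
    then have y: "y \<in> {b..1}" by (auto simp: space_mu)
    have "kernel.E (\<lambda>k z. g k * w z) y * V y = (\<Sum>k. mass k y *\<^sub>R (g k * w (\<sigma> k y)) * V y)"
      unfolding kernel.E_def
      by (rule suminf_mult2[OF kernel.summable_E[OF _ y, of "\<lambda>k z. g k * w z" B]]) (rule gw)
    then show "(\<Sum>k. mass k y *\<^sub>R U k y) = kernel.E (\<lambda>k z. g k * w z) y * V y"
      by (simp add: U_def mult_ac)
  qed
  finally show "(\<integral>y. w y * g (ret y) * V (ret_map y) \<partial>\<mu>) = (\<integral>y. kernel.E (\<lambda>k z. g k * w z) y * V y \<partial>\<mu>)"
    unfolding 1 .
qed

end

section \<open>Approximate factorisation of expectations of products\<close>

lemma (in prob_space) norm_diff_expectation_le: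
  fixes f :: "'a \<Rightarrow> 'b::{banach, second_countable_topology}"
  assumes f: "integrable M f" and D: "\<And>x. x \<in> space M \<Longrightarrow> norm (c - f x) \<le> D"
  shows "norm (c - expectation f) \<le> D"
proof -
  have "c - expectation f = expectation (\<lambda>x. c - f x)"
    using f by (simp add: prob_space)
  also have "norm \<dots> \<le> expectation (\<lambda>x. norm (c - f x))"
    by (rule integral_norm_bound)
  also have "\<dots> \<le> expectation (\<lambda>x. D)"
    using f D by (intro integral_mono) auto
  finally show ?thesis by (simp add: prob_space)
qed

context thaler
begin

lemma E_measurable [measurable (raw)]:
  fixes H :: "nat \<Rightarrow> real \<Rightarrow> 'a::{banach, second_countable_topology}"
  assumes [measurable]: "\<And>k. H k \<in> borel_measurable borel"
  shows "kernel.E H \<in> borel_measurable borel"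
  unfolding kernel.E_def[abs_def] by measurable

lemma iter_measurable [measurable]: "kernel.iter g m \<in> borel_measurable borel"
proof (induction m)
  case (Suc m)
  note [measurable] = Suc
  show ?case by simp
qed simp

lemma E_const: "y \<in> {b..1} \<Longrightarrow> kernel.E (\<lambda>_ _. c) y = (c :: complex)"
  using sums_scaleR_left[OF kernel.p_sums, of y c] by (simp add: kernel.E_def sums_iff)

lemma integral_ret:
  fixes g :: "nat \<Rightarrow> complex"
  assumes g: "\<And>k. norm (g k) \<le> B"
  shows "(\<integral>y. g (ret y) \<partial>\<mu>) = (\<Sum>k. (tail k - tail (Suc k)) *\<^sub>R g k)"
  using transfer(1)[of "\<lambda>_. 1" "\<lambda>_. 1" g B] g by (simp add: integral_Q integrable_Q)

lemma integral_ret_E: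
  fixes g :: "nat \<Rightarrow> complex"
  assumes g: "\<And>k. norm (g k) \<le> B"
  shows "(\<integral>y. g (ret y) \<partial>\<mu>) = (\<integral>y. kernel.E (\<lambda>k _. g k) y \<partial>\<mu>)"
  using transfer(2)[of "\<lambda>_. 1" "\<lambda>_. 1" g B] g by simp

lemma of_real_of_bool_complex: "complex_of_real (of_bool P) = of_bool P"
  by (cases P) auto

lemma integral_ret_ge: "(\<integral>y. of_bool (M \<le> ret y) \<partial>\<mu>) = tail M"
proof -
  have "(\<lambda>k. tail (k + M) - tail (Suc (k + M))) sums tail M"
    using telescope_sums'[of "\<lambda>k. tail (k + M)" 0] LIMSEQ_ignore_initial_segment[OF tail_lim] by simp
  then have "(\<lambda>k. (\<lambda>k. (tail k - tail (Suc k)) * of_bool (M \<le> k)) (k + M)) sums tail M" by simp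
  then have "(\<lambda>k. (tail k - tail (Suc k)) * of_bool (M \<le> k)) sums tail M"
    by (subst (asm) sums_iff_shift) simp
  then have "(\<lambda>k. complex_of_real ((tail k - tail (Suc k)) * of_bool (M \<le> k))) sums of_real (tail M)"
    by (rule sums_of_real)
  then have "(\<Sum>k. (tail k - tail (Suc k)) *\<^sub>R (of_bool (M \<le> k) :: complex)) = of_real (tail M)"
    by (simp add: sums_iff scaleR_conv_of_real of_real_of_bool_complex)
  moreover have "complex_of_real (\<integral>y. of_bool (M \<le> ret y) \<partial>\<mu>) = (\<integral>y. (of_bool (M \<le> ret y) :: complex) \<partial>\<mu>)"
    by (subst integral_complex_of_real[symmetric]) (simp only: of_real_of_bool_complex)
  ultimately have "complex_of_real (\<integral>y. of_bool (M \<le> ret y) \<partial>\<mu>) = of_real (tail M)"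
    using integral_ret[of "\<lambda>k. of_bool (M \<le> k)" 1] by simp
  then show ?thesis by (simp only: of_real_eq_iff)
qed

text \<open>Invariance of the measure under the first return map: by duality it amounts to the
  kernel preserving constants.\<close>

lemma integral_ret_map_pow:
  fixes V :: "real \<Rightarrow> complex"
  assumes [measurable]: "V \<in> borel_measurable borel" and V: "\<And>z. norm (V z) \<le> 1"
  shows "(\<integral>y. V ((ret_map ^^ j) y) \<partial>\<mu>) = (\<integral>y. V y \<partial>\<mu>)"
proof (induction j)
  case (Suc j)
  have "(\<integral>y. V ((ret_map ^^ Suc j) y) \<partial>\<mu>) = (\<integral>y. 1 * 1 * (\<lambda>y. V ((ret_map ^^ j) y)) (ret_map y) \<partial>\<mu>)"
    by (simp add: funpow_swap1)
  also have "\<dots> = (\<integral>y. kernel.E (\<lambda>k z. 1 * 1) y * V ((ret_map ^^ j) y) \<partial>\<mu>)"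
    by (rule transfer(2)[of "\<lambda>_. 1" "\<lambda>y. V ((ret_map ^^ j) y)" "\<lambda>_. 1" 1]) (use V in auto)
  also have "\<dots> = (\<integral>y. V ((ret_map ^^ j) y) \<partial>\<mu>)"
    by (intro Bochner_Integration.integral_cong) (auto simp: space_mu E_const)
  finally show ?case using Suc by simp
qed simp

text \<open>Duality moves the earliest factor of the product into the iterate, reversing time. The
  general \<open>m\<close> keeps the factors already moved.\<close>

lemma integral_prod_iter:
  assumes g: "\<And>k. norm (g k) \<le> 1"
  shows "(\<integral>y. kernel.iter g m y * (\<Prod>j<n. g (ret_at j y)) \<partial>\<mu>) = (\<integral>y. kernel.iter g (m + n) y \<partial>\<mu>)"
proof (induction n arbitrary: m)
  case (Suc n)
  have "(\<integral>y. kernel.iter g m y * (\<Prod>j<Suc n. g (ret_at j y)) \<partial>\<mu>) =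
    (\<integral>y. kernel.iter g m y * g (ret y) * (\<lambda>y. \<Prod>j<n. g (ret_at j y)) (ret_map y) \<partial>\<mu>)"
    by (simp add: prod.lessThan_Suc_shift funpow_swap1 mult.assoc del: prod.lessThan_Suc)
  also have "\<dots> = (\<integral>y. kernel.E (\<lambda>k z. g k * kernel.iter g m z) y * (\<Prod>j<n. g (ret_at j y)) \<partial>\<mu>)"
  proof (rule transfer(2)[where B=1])
    show "norm (\<Prod>j<n. g (ret ((ret_map ^^ j) z))) \<le> 1" for z
      unfolding prod_norm[symmetric] using g by (intro prod_le_1) auto
    show "norm (kernel.iter g m z) \<le> 1" if "z \<in> {b..1}" for z
      using kernel.norm_iter_le[OF g that] .
  qed (use g in measurable)
  also have "\<dots> = (\<integral>y. kernel.iter g (Suc m) y * (\<Prod>j<n. g (ret_at j y)) \<partial>\<mu>)" by simp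
  also have "\<dots> = (\<integral>y. kernel.iter g (m + Suc n) y \<partial>\<mu>)" using Suc[of "Suc m"] by simp
  finally show ?case .
qed simp

lemma integrable_ret:
  fixes c :: "nat \<Rightarrow> 'c::{banach, second_countable_topology}"
  assumes "\<And>k. norm (c k) \<le> B"
  shows "integrable \<mu> (\<lambda>y. c (ret_at j y))"
  by (rule integrable_mu_bounded[where B=B]) (use assms in auto)

text \<open>The error \<open>A (Suc m) - a * A m\<close> is a covariance of
  \<open>kernel.iter g m\<close> and \<open>g (ret y)\<close>. The former deviates from its mean by
  at most \<open>\<kappa> / gap\<close>, the latter from 1 by at most \<kappa> on average. Here
  \<kappa> is \<open>s\<close> times the truncated mean return time from the worst point
  \<open>b\<close>; the \<open>n\<close> errors add up since all factors have norm at most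
  1.\<close>

lemma truncated_mixing:
  fixes g :: "nat \<Rightarrow> complex"
  assumes g: "\<And>k. norm (g k) \<le> 1" and s: "0 \<le> s"
    and G: "\<And>k. norm (g (Suc k) - g k) \<le> s * real (min (Suc (Suc k)) M) - s * real (min (Suc k) M)"
    and g1: "\<And>k. norm (g k - 1) \<le> s * real (min (Suc k) M)"
  defines "\<kappa> \<equiv> s * (\<Sum>k<M. Q k b)"
  shows "norm ((\<integral>y. (\<Prod>j<n. g (ret_at j y)) \<partial>\<mu>) - (\<integral>y. g (ret y) \<partial>\<mu>) ^ n) \<le> real n * (\<kappa>\<^sup>2 / gap)"
proof -
  interpret prob_space \<mu> by (rule prob_space_mu)
  define G where "G k = s * real (min (Suc k) M)" for k
  have G_bd: "norm (G k) \<le> s * real M" for k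
    using s by (auto simp: G_def abs_mult intro!: mult_left_mono)
  have bb: "b \<in> {b..1}" using b_bounds(1,2) by simp
  have EG: "kernel.E (\<lambda>k _. G k) b = \<kappa>" unfolding G_def \<kappa>_def by (rule kernel.E_min[OF bb])
  have \<kappa>0: "0 \<le> \<kappa>"
    unfolding \<kappa>_def using s Q_pos[of b] b_bounds(1,2) by (intro mult_nonneg_nonneg sum_nonneg) (auto intro: less_imp_le)
  define A where "A m = (\<integral>y. kernel.iter g m y \<partial>\<mu>)" for m
  define a where "a = (\<integral>y. g (ret y) \<partial>\<mu>)"
  define D where "D = \<kappa> / gap"
  have D0: "0 \<le> D" using \<kappa>0 kernel.e_pos by (simp add: D_def)
  have osc: "norm (kernel.iter g m y - kernel.iter g m y') \<le> D" if "y \<in> {b..1}" "y' \<in> {b..1}" for m y y'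
    unfolding D_def EG[symmetric]
  proof (rule kernel.iter_osc[OF g _ _ _ that])
    show "norm (g (Suc k) - g k) \<le> G (Suc k) - G k" for k using G[of k] by (simp add: G_def)
    show "0 \<le> G k" for k using s by (simp add: G_def)
    show "G k \<le> s * real M" for k using G_bd[of k] by (simp add: abs_le_iff)
  qed
  have iter1: "norm (kernel.iter g m y) \<le> 1" if "y \<in> {b<..1}" for m y
    using that by (intro kernel.norm_iter_le[OF g]) auto
  have iter_int: "integrable \<mu> (kernel.iter g m)" for m
    by (rule integrable_mu_bounded[where B=1]) (use iter1 in auto)
  have gr_int: "integrable \<mu> (\<lambda>y. g (ret y))"
    by (rule integrable_mu_bounded[where B=1]) (use g in auto)
  have dev: "norm (kernel.iter g m y - A m) \<le> D" if "y \<in> {b<..1}" for m y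
    unfolding A_def
  proof (rule norm_diff_expectation_le[OF iter_int])
    show "norm (kernel.iter g m y - kernel.iter g m y') \<le> D" if "y' \<in> space \<mu>" for y'
      by (rule osc) (use \<open>y \<in> {b<..1}\<close> that in \<open>auto simp: space_mu\<close>)
  qed
  have G_int: "integrable \<mu> (\<lambda>y. G (ret y))"
    by (rule integrable_mu_bounded[where B="s * real M"]) (use G_bd in auto)
  \<comment> \<open>By duality this is the mean of \<open>kernel.E\<close> applied to
    \<open>G\<close>, which is largest at \<open>b\<close> because \<open>G\<close> increases. The
    detour through complex numbers is due to duality being stated for complex
    \<open>g\<close>.\<close>
  have G_mean: "(\<integral>y. G (ret y) \<partial>\<mu>) \<le> \<kappa>"
  proof -
    have EGB: "norm (kernel.E (\<lambda>k _. G k) y) \<le> s * real M" if "y \<in> {b..1}" for y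
      by (rule kernel.norm_E_le[OF G_bd that])
    have "complex_of_real (\<integral>y. G (ret y) \<partial>\<mu>) = (\<integral>y. complex_of_real (G (ret y)) \<partial>\<mu>)"
      by (rule integral_complex_of_real[symmetric])
    also have "\<dots> = (\<integral>y. kernel.E (\<lambda>k _. complex_of_real (G k)) y \<partial>\<mu>)"
      by (rule integral_ret_E[where B="s * real M"]) (use G_bd in simp)
    also have "\<dots> = (\<integral>y. complex_of_real (kernel.E (\<lambda>k _. G k) y) \<partial>\<mu>)"
    proof (rule Bochner_Integration.integral_cong[OF refl])
      fix y assume "y \<in> space \<mu>"
      then have "y \<in> {b..1}" by (auto simp: space_mu)
      then show "kernel.E (\<lambda>k _. complex_of_real (G k)) y = complex_of_real (kernel.E (\<lambda>k _. G k) y)"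
        using kernel.E_bounded_linear[where T = complex_of_real and H = "\<lambda>k _. G k" and B = "s * real M" and y = y,
            OF bounded_linear_of_real] G_bd by simp
    qed
    also have "\<dots> = complex_of_real (\<integral>y. kernel.E (\<lambda>k _. G k) y \<partial>\<mu>)" by (rule integral_complex_of_real)
    finally have "(\<integral>y. G (ret y) \<partial>\<mu>) = (\<integral>y. kernel.E (\<lambda>k _. G k) y \<partial>\<mu>)" by (simp only: of_real_eq_iff)
    also have "\<dots> \<le> (\<integral>y. \<kappa> \<partial>\<mu>)"
    proof (rule integral_mono)
      show "integrable \<mu> (kernel.E (\<lambda>k _. G k))"
        by (rule integrable_mu_bounded[where B="s * real M"]) (use EGB in auto)
      fix y assume "y \<in> space \<mu>"
      then have y: "y \<in> {b..1}" "b \<le> y" by (auto simp: space_mu)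
      have G_le: "G k \<le> G (Suc k)" for k using s by (simp add: G_def mult_left_mono)
      have "kernel.E (\<lambda>k _. G k) y \<le> kernel.E (\<lambda>k _. G k) b"
        using G_bd G_le bb y by (intro kernel.E_antimono[where B = "s * real M"]) auto
      then show "kernel.E (\<lambda>k _. G k) y \<le> \<kappa>" by (simp only: EG)
    qed simp
    finally show ?thesis by (simp add: prob_space)
  qed
  have step: "norm (A (Suc m) - a * A m) \<le> \<kappa> * D" for m
  proof -
    have "A (Suc m) = (\<integral>y. kernel.iter g m y * g (ret y) * 1 \<partial>\<mu>)"
      unfolding A_def kernel.iter.simps using iter1
      by (subst transfer(2)[where B=1]) (auto simp: g intro!: kernel.norm_iter_le)
    moreover have "integrable \<mu> (\<lambda>y. kernel.iter g m y * g (ret y))"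
    proof (rule integrable_mu_bounded[where B=1])
      show "norm (kernel.iter g m y * g (ret y)) \<le> 1" if "y \<in> {b<..1}" for y
        unfolding norm_mult using iter1[OF that] g by (intro mult_le_one) auto
    qed measurable
    \<comment> \<open>Subtracting 1 from the second factor changes nothing, as the first has mean
      zero, but it makes the second factor small.\<close>
    ultimately have "A (Suc m) - a * A m = (\<integral>y. (kernel.iter g m y - A m) * (g (ret y) - 1) \<partial>\<mu>)"
      using iter_int gr_int
      by (simp add: algebra_simps prob_space a_def) (simp add: A_def)
    also have "norm \<dots> \<le> (\<integral>y. norm ((kernel.iter g m y - A m) * (g (ret y) - 1)) \<partial>\<mu>)"
      by (rule integral_norm_bound)
    also have "\<dots> \<le> (\<integral>y. D * G (ret y) \<partial>\<mu>)"
    proof (rule integral_mono_AE)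
      have le: "norm ((kernel.iter g m y - A m) * (g (ret y) - 1)) \<le> D * G (ret y)" if "y \<in> {b<..1}" for y
        unfolding norm_mult using dev[OF that, of m] g1[of "ret y"] D0 by (intro mult_mono) (auto simp: G_def)
      show "integrable \<mu> (\<lambda>y. D * G (ret y))" by (intro integrable_mult_right G_int)
      then show "integrable \<mu> (\<lambda>y. norm ((kernel.iter g m y - A m) * (g (ret y) - 1)))"
        by (rule Bochner_Integration.integrable_bound) (use order_trans[OF le abs_ge_self] in \<open>auto simp: space_mu intro!: AE_I2\<close>)
      show "AE y in \<mu>. norm ((kernel.iter g m y - A m) * (g (ret y) - 1)) \<le> D * G (ret y)"
        by (rule AE_I2) (use le in \<open>simp add: space_mu\<close>)
    qed
    also have "\<dots> = D * (\<integral>y. G (ret y) \<partial>\<mu>)" by simp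
    also have "\<dots> \<le> D * \<kappa>" by (rule mult_left_mono[OF G_mean D0])
    finally show ?thesis by (simp add: mult.commute)
  qed
  have a1: "norm a \<le> 1"
  proof -
    have "norm a \<le> (\<integral>y. norm (g (ret y)) \<partial>\<mu>)" unfolding a_def by (rule integral_norm_bound)
    also have "\<dots> \<le> (\<integral>y. 1 \<partial>\<mu>)" using g gr_int by (intro integral_mono) auto
    finally show ?thesis by (simp add: prob_space)
  qed
  have "norm (A n - a ^ n) \<le> real n * (\<kappa> * D)" for n
  proof (induction n)
    case (Suc n)
    have "A (Suc n) - a ^ Suc n = (A (Suc n) - a * A n) + a * (A n - a ^ n)" by (simp add: algebra_simps)
    then have "norm (A (Suc n) - a ^ Suc n) \<le> norm (A (Suc n) - a * A n) + norm a * norm (A n - a ^ n)"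
      using norm_triangle_ineq norm_mult by metis
    also have "\<dots> \<le> \<kappa> * D + 1 * (real n * (\<kappa> * D))"
      using step[of n] Suc a1 by (intro add_mono mult_mono) auto
    finally show ?case by (simp add: algebra_simps)
  qed (simp add: A_def prob_space)
  moreover have "(\<integral>y. (\<Prod>j<n. g (ret_at j y)) \<partial>\<mu>) = A n"
    using integral_prod_iter[where g = g and m = 0 and n = n] g by (simp add: A_def)
  ultimately show ?thesis by (simp add: a_def D_def power2_eq_square)
qed

text \<open>Freezing \<open>g\<close> from index \<open>M - 1\<close> on makes
  \<open>truncated_mixing\<close> applicable. It alters each factor by at most 2, and only if its
  index is at least \<open>M\<close>; the joint expectation and the \<open>n\<close>-th power thus
  each contribute \<open>2 * tail M\<close> per factor.\<close>

theorem mixing: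
  fixes g :: "nat \<Rightarrow> complex"
  assumes g: "\<And>k. norm (g k) \<le> 1" and s: "0 \<le> s" and M: "0 < M"
    and gs: "\<And>k. norm (g (Suc k) - g k) \<le> s" and g1: "\<And>k. norm (g k - 1) \<le> s * real (Suc k)"
  shows "norm ((\<integral>y. (\<Prod>j<n. g (ret_at j y)) \<partial>\<mu>) - (\<integral>y. g (ret y) \<partial>\<mu>) ^ n) \<le>
    real n * (4 * tail M + (s * (\<Sum>k<M. Q k b))\<^sup>2 / gap)"
proof -
  interpret prob_space \<mu> by (rule prob_space_mu)
  define f where "f k = g (min k (M - 1))" for k
  have f: "norm (f k) \<le> 1" for k using g by (simp add: f_def)
  have main: "norm ((\<integral>y. (\<Prod>j<n. f (ret_at j y)) \<partial>\<mu>) - (\<integral>y. f (ret y) \<partial>\<mu>) ^ n)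
      \<le> real n * ((s * (\<Sum>k<M. Q k b))\<^sup>2 / gap)"
  proof (rule truncated_mixing[OF f s])
    fix k
    show "norm (f (Suc k) - f k) \<le> s * real (min (Suc (Suc k)) M) - s * real (min (Suc k) M)"
    proof (cases "Suc k < M")
      case True
      then show ?thesis using gs[of k] by (simp add: f_def min_def algebra_simps)
    next
      case False
      then have "min (Suc k) (M - 1) = M - 1" "min k (M - 1) = M - 1"
        "min (Suc (Suc k)) M = M" "min (Suc k) M = M" by auto
      then show ?thesis by (simp add: f_def)
    qed
    have "Suc (min k (M - 1)) = min (Suc k) M" using M by auto
    then show "norm (f k - 1) \<le> s * real (min (Suc k) M)"
      using g1[of "min k (M - 1)"] by (simp only: f_def)
  qed
  have diff: "norm (g k - f k) \<le> 2 * of_bool (M \<le> k)" for k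
  proof (cases "M \<le> k")
    case True
    then show ?thesis using norm_triangle_ineq4[of "g k" "f k"] g[of k] f[of k] by simp
  next
    case False
    then have "min k (M - 1) = k" by auto
    then show ?thesis by (simp add: f_def)
  qed
  have int_ge: "(\<integral>y. of_bool (M \<le> ret_at j y) \<partial>\<mu>) = tail M" for j
  proof -
    have "complex_of_real (\<integral>y. of_bool (M \<le> ret_at j y) \<partial>\<mu>) =
        (\<integral>y. (of_bool (M \<le> ret_at j y) :: complex) \<partial>\<mu>)"
      by (subst integral_complex_of_real[symmetric]) (simp only: of_real_of_bool_complex)
    also have "\<dots> = (\<integral>y. (of_bool (M \<le> ret y) :: complex) \<partial>\<mu>)"
      by (rule integral_ret_map_pow) auto
    also have "\<dots> = complex_of_real (\<integral>y. of_bool (M \<le> ret y) \<partial>\<mu>)"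
      by (subst integral_complex_of_real[symmetric]) (simp only: of_real_of_bool_complex)
    finally show ?thesis unfolding of_real_eq_iff integral_ret_ge .
  qed
  have diff_int: "(\<integral>y. norm (g (ret_at j y) - f (ret_at j y)) \<partial>\<mu>) \<le> 2 * tail M" for j
  proof -
    have "(\<integral>y. norm (g (ret_at j y) - f (ret_at j y)) \<partial>\<mu>)
        \<le> (\<integral>y. 2 * of_bool (M \<le> ret_at j y) \<partial>\<mu>)"
      by (intro integral_mono integrable_norm Bochner_Integration.integrable_diff integrable_mult_right
          integrable_ret[where B=1]) (use g f diff in auto)
    then show ?thesis by (simp add: int_ge)
  qed
  have 1: "norm ((\<integral>y. (\<Prod>j<n. g (ret_at j y)) \<partial>\<mu>) - (\<integral>y. (\<Prod>j<n. f (ret_at j y)) \<partial>\<mu>))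
     \<le> real n * (2 * tail M)"
  proof -
    have prod_int: "integrable \<mu> (\<lambda>y. \<Prod>j<n. c (ret_at j y))" if "\<And>k. norm (c k) \<le> 1" for c :: "nat \<Rightarrow> complex"
    proof (rule integrable_mu_bounded[where B=1])
      show "norm (\<Prod>j<n. c (ret_at j y)) \<le> 1" for y
        unfolding prod_norm[symmetric] using that by (intro prod_le_1) auto
    qed measurable
    have "(\<integral>y. (\<Prod>j<n. g (ret_at j y)) \<partial>\<mu>) - (\<integral>y. (\<Prod>j<n. f (ret_at j y)) \<partial>\<mu>)
      = (\<integral>y. (\<Prod>j<n. g (ret_at j y)) - (\<Prod>j<n. f (ret_at j y)) \<partial>\<mu>)"
      by (subst Bochner_Integration.integral_diff) (use prod_int g f in auto)
    also have "norm \<dots> \<le> (\<integral>y. norm ((\<Prod>j<n. g (ret_at j y)) - (\<Prod>j<n. f (ret_at j y))) \<partial>\<mu>)"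
      by (rule integral_norm_bound)
    also have "\<dots> \<le> (\<integral>y. (\<Sum>j<n. norm (g (ret_at j y) - f (ret_at j y))) \<partial>\<mu>)"
      by (intro integral_mono integrable_norm Bochner_Integration.integrable_diff Bochner_Integration.integrable_sum
          prod_int integrable_ret[where B=1] norm_prod_diff) (use g f in auto)
    also have "\<dots> = (\<Sum>j<n. \<integral>y. norm (g (ret_at j y) - f (ret_at j y)) \<partial>\<mu>)"
      by (intro Bochner_Integration.integral_sum integrable_norm Bochner_Integration.integrable_diff integrable_ret[where B=1]) (use g f in auto)
    also have "\<dots> \<le> (\<Sum>j<n. 2 * tail M)" by (intro sum_mono diff_int)
    finally show ?thesis by simp
  qed
  have norm_int: "norm (\<integral>y. c (ret y) \<partial>\<mu>) \<le> 1" if c: "\<And>k. norm (c k) \<le> 1" for c :: "nat \<Rightarrow> complex"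
  proof -
    have "norm (\<integral>y. c (ret y) \<partial>\<mu>) \<le> (\<integral>y. norm (c (ret y)) \<partial>\<mu>)" by (rule integral_norm_bound)
    also have "\<dots> \<le> (\<integral>y. 1 \<partial>\<mu>)" using c integrable_ret[where c = c and B = 1 and j = 0] by (intro integral_mono) auto
    finally show ?thesis by (simp add: prob_space)
  qed
  have 2: "norm ((\<integral>y. f (ret y) \<partial>\<mu>) ^ n - (\<integral>y. g (ret y) \<partial>\<mu>) ^ n) \<le> real n * (2 * tail M)"
  proof -
    have "norm ((\<integral>y. f (ret y) \<partial>\<mu>) ^ n - (\<integral>y. g (ret y) \<partial>\<mu>) ^ n)
        \<le> real n * norm ((\<integral>y. f (ret y) \<partial>\<mu>) - (\<integral>y. g (ret y) \<partial>\<mu>))"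
      by (intro norm_power_diff norm_int f g)
    also have "norm ((\<integral>y. f (ret y) \<partial>\<mu>) - (\<integral>y. g (ret y) \<partial>\<mu>)) = norm (\<integral>y. g (ret y) - f (ret y) \<partial>\<mu>)"
      using integrable_ret[where c = f and B = 1 and j = 0] integrable_ret[where c = g and B = 1 and j = 0] f g by (simp add: norm_minus_commute)
    also have "\<dots> \<le> (\<integral>y. norm (g (ret y) - f (ret y)) \<partial>\<mu>)" by (rule integral_norm_bound)
    also have "\<dots> \<le> 2 * tail M" using diff_int[of 0] by simp
    finally show ?thesis by (simp add: mult_left_mono)
  qed
  have "norm ((\<integral>y. (\<Prod>j<n. g (ret_at j y)) \<partial>\<mu>) - (\<integral>y. g (ret y) \<partial>\<mu>) ^ n) \<le>
    real n * (2 * tail M) + (real n * ((s * (\<Sum>k<M. Q k b))\<^sup>2 / gap) + real n * (2 * tail M))"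
    using norm_triangle_mono[OF 1 norm_triangle_mono[OF main 2]] by simp
  then show ?thesis by (simp add: algebra_simps)
qed

end

section \<open>The stable limit\<close>

locale thaler_stable = thaler +
  fixes \<alpha> :: real
  assumes \<alpha>: "0 < \<alpha>" "\<alpha> < 2" "\<alpha> \<noteq> 1" and \<gamma>_eq: "\<gamma> = 1 / \<alpha>"
begin

lemma xs_order: "(\<lambda>k. xs k * real k powr \<alpha>) \<longlonglongrightarrow> \<alpha> powr \<alpha>"
proof -
  have "\<gamma> powr (- 1 / \<gamma>) = \<alpha> powr \<alpha>"
    using \<alpha> by (simp add: \<gamma>_eq powr_divide powr_minus)
  then show ?thesis using xs_asymp \<alpha> by (simp add: \<gamma>_eq)
qed

text \<open>To first order \<open>pint (1 + x)\<close> is \<open>x\<close>, so the tail inherits the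
  decay of \<open>xs\<close>.\<close>

lemma tail_order: "(\<lambda>k. tail k * real k powr \<alpha>) \<longlonglongrightarrow> \<alpha> powr \<alpha> / pint 2"
proof (rule tendsto_sandwich)
  have p2: "pint 2 > 0" by (rule pint_pos) simp
  have u: "tail k * real k powr \<alpha> \<le> xs k * real k powr \<alpha> / pint 2" for k
    using mult_right_mono[OF pint_1_plus_le[OF xs_pos[of k]], of "real k powr \<alpha>"] p2
    by (simp add: tail_def divide_right_mono)
  have l: "(1 + xs k) powr (- \<gamma>) * (xs k * real k powr \<alpha>) / pint 2 \<le> tail k * real k powr \<alpha>" for k
  proof -
    have "xs k * (1 + xs k) powr (- \<gamma>) \<le> pint (1 + xs k)"
      using pint_diff_ge[of 1 "1 + xs k"] xs_pos[of k] by (simp add: pint_1)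
    from mult_right_mono[OF this, of "real k powr \<alpha>"] p2 show ?thesis
      by (simp add: tail_def divide_right_mono mult_ac)
  qed
  show "eventually (\<lambda>k. tail k * real k powr \<alpha> \<le> xs k * real k powr \<alpha> / pint 2) sequentially"
    using u by simp
  show "eventually (\<lambda>k. (1 + xs k) powr (- \<gamma>) * (xs k * real k powr \<alpha>) / pint 2 \<le> tail k * real k powr \<alpha>) sequentially"
    using l by simp
  show "(\<lambda>k. xs k * real k powr \<alpha> / pint 2) \<longlonglongrightarrow> \<alpha> powr \<alpha> / pint 2"
    using p2 by (intro tendsto_divide xs_order tendsto_const) auto
  have "(\<lambda>k. (1 + xs k) powr (- \<gamma>) * (xs k * real k powr \<alpha>) / pint 2) \<longlonglongrightarrow>
      (1 + 0) powr (- \<gamma>) * (\<alpha> powr \<alpha>) / pint 2"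
    using p2 by (intro tendsto_divide tendsto_mult tendsto_powr tendsto_add xs_order xs_lim tendsto_const) auto
  then show "(\<lambda>k. (1 + xs k) powr (- \<gamma>) * (xs k * real k powr \<alpha>) / pint 2) \<longlonglongrightarrow> \<alpha> powr \<alpha> / pint 2" by simp
qed

definition \<kappa> :: complex where
  "\<kappa> = of_real (\<alpha> powr \<alpha> / pint 2 * Gamma (1 - \<alpha>)) * cis (- pi * \<alpha> / 2)"

lemma char_defect_tail_asymp:
  "((\<lambda>s. (char_defect tail s + \<i> * of_real (ell_const \<alpha> * s)) / of_real (s powr \<alpha>)) \<longlongrightarrow> \<kappa>) (at_right 0)"
proof (cases "\<alpha> < 1")
  case True
  then show ?thesis
    using char_defect_asymp[OF _ True decseq_tail less_imp_le[OF tail_pos] tail_order] \<alpha>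
    by (simp add: ell_const_def \<kappa>_def)
next
  case False
  then have \<alpha>1: "1 < \<alpha>" and \<gamma>1: "\<gamma> < 1" using \<alpha> by (auto simp: \<gamma>_eq)
  have p2: "pint 2 > 0" by (rule pint_pos) simp
  \<comment> \<open>This is \<open>pint (xs k)\<close> shifted so that it tends to 0 and divided by
    \<open>pint 2\<close>; by \<open>pint_xs\<close> its decrements are the tail
    probabilities.\<close>
  define G where "G k = xs k powr (1 - \<gamma>) / ((1 - \<gamma>) * pint 2)" for k
  have den: "(1 - \<gamma>) * pint 2 > 0" using \<gamma>1 p2 by simp
  have tail_G: "tail (Suc k) = G k - G (Suc k)" for k
  proof -
    have "tail (Suc k) = (pint (xs k) - pint (xs (Suc k))) / pint 2"
      unfolding tail_def pint_xs ..
    also have "\<dots> = G k - G (Suc k)"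
      using \<gamma>1 p2 by (simp add: G_def pint_def diff_divide_distrib)
    finally show ?thesis .
  qed
  have G0: "0 \<le> G k" for k using den by (simp add: G_def)
  have "decseq G"
  proof (rule decseq_SucI)
    show "G (Suc k) \<le> G k" for k using tail_G[of k] tail_pos[of "Suc k"] by simp
  qed
  have G_lim: "(\<lambda>k. G k * real k powr (\<alpha> - 1)) \<longlonglongrightarrow> \<alpha> powr (\<alpha> - 1) / ((1 - \<gamma>) * pint 2)"
  proof -
    have e: "\<alpha> * (1 - \<gamma>) = \<alpha> - 1" using \<alpha> by (simp add: \<gamma>_eq right_diff_distrib)
    have "(\<lambda>k. (xs k * real k powr \<alpha>) powr (1 - \<gamma>) / ((1 - \<gamma>) * pint 2)) \<longlonglongrightarrow>
        (\<alpha> powr \<alpha>) powr (1 - \<gamma>) / ((1 - \<gamma>) * pint 2)"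
      using den \<alpha> by (intro tendsto_divide tendsto_powr xs_order tendsto_const) auto
    moreover have "(xs k * real k powr \<alpha>) powr (1 - \<gamma>) / ((1 - \<gamma>) * pint 2) = G k * real k powr (\<alpha> - 1)" for k
      using xs_pos[of k] by (simp add: G_def powr_mult powr_powr e)
    ultimately show ?thesis by (simp add: powr_powr e)
  qed
  have "((\<lambda>s. (char_defect tail s + \<i> * of_real ((1 + G 0) * s)) / of_real (s powr \<alpha>)) \<longlongrightarrow>
    of_real (\<alpha> powr (\<alpha> - 1) / ((1 - \<gamma>) * pint 2) * (\<alpha> - 1) * Gamma (1 - \<alpha>)) * cis (- pi * \<alpha> / 2)) (at_right 0)"
    by (rule char_defect_asymp_finite_mean[OF \<alpha>1 \<alpha>(2) decseq_tail tail_lim tail_0 \<open>decseq G\<close> G0 tail_G G_lim])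
  \<comment> \<open>So the centring constant is the mean return time.\<close>
  moreover have "1 + G 0 = ell_const \<alpha>"
  proof -
    have e: "(1 - \<gamma>) * pint 2 = 2 powr (1 - \<gamma>) - 1" using \<gamma>1 by (simp add: pint_def)
    have "2 powr (\<gamma> - 1) = inverse (2 powr (1 - \<gamma>))" using powr_minus[of 2 "1 - \<gamma>"] by simp
    moreover have "1 + 1 / (P - 1) = inverse (1 - inverse P)" if "1 < P" for P :: real
      using that by (simp add: field_simps)
    moreover have "2 powr (1 - \<gamma>) > 1" using den unfolding e by simp
    ultimately show ?thesis
      using \<alpha>1 unfolding G_def e by (simp add: ell_const_def Let_def \<gamma>_eq[symmetric])
  qed
  moreover have "\<alpha> powr (\<alpha> - 1) / ((1 - \<gamma>) * pint 2) * (\<alpha> - 1) = \<alpha> powr \<alpha> / pint 2"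
  proof -
    have "\<alpha> - 1 = \<alpha> * (1 - \<gamma>)" using \<alpha> by (simp add: \<gamma>_eq right_diff_distrib)
    moreover have "\<alpha> powr (\<alpha> - 1) * \<alpha> = \<alpha> powr \<alpha>" using \<alpha> by (simp add: powr_diff)
    ultimately show ?thesis using \<gamma>1 by (simp add: mult.commute)
  qed
  ultimately show ?thesis by (simp only: \<kappa>_def)
qed

text \<open>For \<alpha> above 1 both factors are negative.\<close>

lemma g_const_pos: "0 < g_const \<alpha>"
proof (cases "\<alpha> < 1")
  case True
  then have "0 < \<alpha> * pi / 2" "\<alpha> * pi / 2 < pi / 2" using \<alpha> by simp_all
  then have "0 < cos (\<alpha> * pi / 2)" by (intro cos_gt_zero_pi) linarith+
  then show ?thesis unfolding g_const_def using True by (intro mult_pos_pos Gamma_real_pos) auto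
next
  case False
  then have \<alpha>1: "1 < \<alpha>" using \<alpha> by simp
  have "1 - \<alpha> \<notin> \<int>\<^sub>\<le>\<^sub>0"
  proof
    assume "1 - \<alpha> \<in> \<int>\<^sub>\<le>\<^sub>0"
    then obtain n where "1 - \<alpha> = of_int n" by (auto elim!: nonpos_Ints_cases)
    then have "-1 < n" "n < 0" using \<alpha> \<alpha>1 by linarith+
    then show False by simp
  qed
  then have "Gamma (2 - \<alpha>) = (1 - \<alpha>) * Gamma (1 - \<alpha>)"
    using Gamma_plus1[of "1 - \<alpha>"] by simp
  moreover have "Gamma (2 - \<alpha>) > 0" using \<alpha> by (intro Gamma_real_pos) auto
  ultimately have "Gamma (1 - \<alpha>) < 0" using \<alpha>1 by (simp add: zero_less_mult_iff)
  moreover have "cos (\<alpha> * pi / 2) < 0"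
  proof -
    have "0 < cos (\<alpha> * pi / 2 - pi)" using \<alpha> \<alpha>1 by (intro cos_gt_zero_pi) (auto simp: field_simps)
    then show ?thesis by (simp add: cos_diff)
  qed
  ultimately show ?thesis unfolding g_const_def by (rule mult_neg_neg)
qed

lemma d_const_eq: "d_const \<alpha> = \<alpha> powr \<alpha> / pint 2 * g_const \<alpha>"
  unfolding d_const_def Let_def \<gamma>_eq[symmetric] density_const by simp

lemma d_const_pos: "0 < d_const \<alpha>"
  unfolding d_const_eq using \<alpha> g_const_pos pint_pos[of 2] by simp

lemma Re_\<kappa>: "Re \<kappa> = d_const \<alpha>"
  unfolding d_const_eq by (simp add: \<kappa>_def g_const_def mult_ac)

lemma Im_\<kappa>: "Im \<kappa> = - d_const \<alpha> * tan (\<alpha> * pi / 2)"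
proof -
  have "cos (\<alpha> * pi / 2) \<noteq> 0" using g_const_pos by (auto simp: g_const_def)
  then show ?thesis
    unfolding d_const_eq by (simp add: \<kappa>_def g_const_def tan_def mult_ac)
qed

text \<open>The sum is a truncated mean return time from the worst starting point. Bounded through
  \<open>Q_b_le\<close> by tail probabilities, it telescopes to a multiple of
  \<open>- pint (xs M)\<close>, which stays bounded for \<alpha> > 1 and is of order
  \<open>M powr (1 - \<alpha>)\<close> for \<alpha> < 1.\<close>

lemma sum_Q_order: "\<exists>C\<ge>0. \<forall>M>0. (\<Sum>k<M. Q k b) \<le> C * real M powr max 0 (1 - \<alpha>)"
proof -
  have p2: "pint 2 > 0" by (rule pint_pos) simp
  define c where "c = 1 / (pint 2 * lprob 1)"
  have c: "0 \<le> c" using p2 lprob_pos[of 1] by (simp add: c_def)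
  have sum_le: "(\<Sum>k<M. Q k b) \<le> - pint (xs M) * c" for M
  proof -
    have "(\<Sum>k<M. Q k b) \<le> (\<Sum>k<M. tail (Suc k) / lprob 1)" by (intro sum_mono Q_b_le)
    also have "\<dots> = (\<Sum>k<M. pint (xs k) - pint (xs (Suc k))) * c"
      unfolding sum_distrib_right by (intro sum.cong) (auto simp: tail_def pint_xs c_def)
    also have "(\<Sum>k<M. pint (xs k) - pint (xs (Suc k))) = - pint (xs M)"
      using sum_lessThan_telescope'[of "\<lambda>k. pint (xs k)" M] by (simp add: pint_1)
    finally show ?thesis .
  qed
  show ?thesis
  proof (cases "\<alpha> < 1")
    case False
    then have \<gamma>1: "\<gamma> < 1" using \<alpha> by (simp add: \<gamma>_eq)
    have "- pint (xs M) \<le> 1 / (1 - \<gamma>)" for M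
    proof -
      have "- pint (xs M) = (1 - xs M powr (1 - \<gamma>)) / (1 - \<gamma>)" by (simp add: pint_def minus_divide_left)
      then show ?thesis using \<gamma>1 by (simp add: divide_right_mono)
    qed
    then have "(\<Sum>k<M. Q k b) \<le> 1 / (1 - \<gamma>) * c" for M
      using sum_le[of M] c by (meson mult_right_mono order_trans)
    then show ?thesis using False \<gamma>1 c by (intro exI[of _ "1 / (1 - \<gamma>) * c"]) (auto simp: max_def)
  next
    case True
    then have \<gamma>1: "\<gamma> > 1" using \<alpha> by (simp add: \<gamma>_eq)
    have e: "\<alpha> * (1 - \<gamma>) = \<alpha> - 1" using \<alpha> by (simp add: \<gamma>_eq right_diff_distrib)
    have "(\<lambda>k. (xs k * real k powr \<alpha>) powr (1 - \<gamma>)) \<longlonglongrightarrow> (\<alpha> powr \<alpha>) powr (1 - \<gamma>)"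
      using \<alpha> by (intro tendsto_powr xs_order tendsto_const) auto
    then have "Bseq (\<lambda>k. (xs k * real k powr \<alpha>) powr (1 - \<gamma>))" by (intro convergent_imp_Bseq convergentI)
    then obtain K where K: "0 < K" "\<And>k. (xs k * real k powr \<alpha>) powr (1 - \<gamma>) \<le> K"
      by (auto simp: Bseq_def)
    have "(\<Sum>k<M. Q k b) \<le> K / (\<gamma> - 1) * c * real M powr (1 - \<alpha>)" if "M > 0" for M
    proof -
      have "xs M powr (1 - \<gamma>) * real M powr (\<alpha> - 1) \<le> K"
        using K(2)[of M] xs_pos[of M] by (simp add: powr_mult powr_powr e)
      then have "xs M powr (1 - \<gamma>) * real M powr (\<alpha> - 1) * real M powr (1 - \<alpha>) \<le> K * real M powr (1 - \<alpha>)"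
        by (rule mult_right_mono) simp
      also have "xs M powr (1 - \<gamma>) * real M powr (\<alpha> - 1) * real M powr (1 - \<alpha>) = xs M powr (1 - \<gamma>)"
        using that by (simp add: mult.assoc flip: powr_add)
      finally have "xs M powr (1 - \<gamma>) \<le> K * real M powr (1 - \<alpha>)" .
      moreover have "- pint (xs M) \<le> xs M powr (1 - \<gamma>) / (\<gamma> - 1)"
        using \<gamma>1 by (simp add: pint_def field_simps)
      ultimately have "- pint (xs M) \<le> K * real M powr (1 - \<alpha>) / (\<gamma> - 1)"
        using \<gamma>1 by (meson divide_right_mono less_imp_le diff_gt_0_iff_gt order_trans)
      from order_trans[OF sum_le[of M] mult_right_mono[OF this c]] show ?thesis by (simp add: mult_ac)
    qed
    then show ?thesis using True \<gamma>1 c K by (intro exI[of _ "K / (\<gamma> - 1) * c"]) (auto simp: max_def)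
  qed
qed

text \<open>Return times are truncated at \<open>cutoff n\<close>. An exponent slightly above \<open>\<gamma>\<close> makes both the probability
  of any truncation and the coupling error vanish.\<close>

definition scale :: "real \<Rightarrow> nat \<Rightarrow> real" where
  "scale t n = t * (real n * d_const \<alpha>) powr (- \<gamma>)"

definition cutoff :: "nat \<Rightarrow> nat" where
  "cutoff n = nat \<lceil>real n powr (\<gamma> + 1 / 4)\<rceil>"

lemma cutoff_bounds:
  assumes "n > 0"
  shows "real n powr (\<gamma> + 1 / 4) \<le> real (cutoff n)" "real (cutoff n) \<le> 2 * real n powr (\<gamma> + 1 / 4)" "0 < cutoff n"
proof -
  have 1: "1 \<le> real n powr (\<gamma> + 1 / 4)" using assms \<gamma>_pos by (intro ge_one_powr_ge_zero) auto
  show l: "real n powr (\<gamma> + 1 / 4) \<le> real (cutoff n)" unfolding cutoff_def by (rule real_nat_ceiling_ge)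
  have "real (cutoff n) \<le> real n powr (\<gamma> + 1 / 4) + 1"
    unfolding cutoff_def using 1 by linarith
  then show "real (cutoff n) \<le> 2 * real n powr (\<gamma> + 1 / 4)" using 1 by simp
  show "0 < cutoff n" using l 1 by linarith
qed

text \<open>Since \<open>(\<gamma> + 1 / 4) * \<alpha>\<close> is \<open>1 + \<alpha> / 4\<close>,
  the power \<open>n powr (- \<alpha> / 4)\<close> remains.\<close>

lemma tail_error: "(\<lambda>n. real n * (4 * tail (cutoff n))) \<longlonglongrightarrow> 0"
proof -
  have "Bseq (\<lambda>k. tail k * real k powr \<alpha>)"
    using tail_order by (intro convergent_imp_Bseq convergentI)
  then obtain K where K: "0 < K" "\<And>k. tail k * real k powr \<alpha> \<le> K" by (auto simp: Bseq_def abs_le_iff)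
  show ?thesis
  proof (rule Lim_null_comparison)
    show "eventually (\<lambda>n. norm (real n * (4 * tail (cutoff n))) \<le> 4 * K * real n powr (- \<alpha> / 4)) sequentially"
      using eventually_gt_at_top[of 0]
    proof eventually_elim
      case (elim n)
      note c = cutoff_bounds[OF elim]
      have "real n powr (1 + \<alpha> / 4) = (real n powr (\<gamma> + 1 / 4)) powr \<alpha>"
      proof -
        have "(\<gamma> + 1 / 4) * \<alpha> = 1 + \<alpha> / 4" using \<alpha> by (simp add: \<gamma>_eq distrib_right)
        then show ?thesis by (simp add: powr_powr)
      qed
      also have "\<dots> \<le> real (cutoff n) powr \<alpha>" using c(1) \<alpha> by (intro powr_mono2) auto
      finally have "tail (cutoff n) * real n powr (1 + \<alpha> / 4) \<le> K"
        using mult_left_mono[OF _ less_imp_le[OF tail_pos[of "cutoff n"]]] K(2)[of "cutoff n"] by (meson order_trans)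
      then have "tail (cutoff n) * real n powr (1 + \<alpha> / 4) * real n powr (- \<alpha> / 4) \<le> K * real n powr (- \<alpha> / 4)"
        by (rule mult_right_mono) simp
      also have "tail (cutoff n) * real n powr (1 + \<alpha> / 4) * real n powr (- \<alpha> / 4) = tail (cutoff n) * real n"
        using elim by (simp add: mult.assoc flip: powr_add)
      finally show ?case using tail_pos[of "cutoff n"] by (simp add: abs_mult mult.commute)
    qed
    have "(\<lambda>n. real n powr (- \<alpha> / 4)) \<longlonglongrightarrow> 0" using \<alpha> by real_asymp
    from tendsto_mult[OF tendsto_const this, of "4 * K"]
    show "(\<lambda>n. 4 * K * real n powr (- \<alpha> / 4)) \<longlonglongrightarrow> 0" by simp
  qed
qed

text \<open>The order is \<open>n\<close> to the power
  \<open>1 + 2 * (q * \<theta> - \<gamma>)\<close>. For \<alpha> < 1 this exponent is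
  \<open>- 1 / 2 - \<alpha> / 2\<close>, so the extra 1/4 in the cutoff is affordable; for \<alpha>
  > 1 it is \<open>1 - 2 * \<gamma>\<close>, negative because \<alpha> < 2.\<close>

lemma coupling_error: "(\<lambda>n. real n * ((scale t n * (\<Sum>k<cutoff n. Q k b))\<^sup>2 / gap)) \<longlonglongrightarrow> 0"
proof -
  define \<theta> where "\<theta> = max 0 (1 - \<alpha>)"
  define q where "q = \<gamma> + 1 / 4"
  obtain C where C: "C \<ge> 0" "\<And>M. M > 0 \<Longrightarrow> (\<Sum>k<M. Q k b) \<le> C * real M powr \<theta>"
    using sum_Q_order unfolding \<theta>_def by blast
  define K where "K = (t * d_const \<alpha> powr (- \<gamma>) * (C * 2 powr \<theta>))\<^sup>2 / gap"
  have \<theta>: "0 \<le> \<theta>" by (simp add: \<theta>_def)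
  have e: "1 + 2 * (q * \<theta> - \<gamma>) < 0"
  proof (cases "\<alpha> < 1")
    case True
    then have "1 + 2 * (q * \<theta> - \<gamma>) = 1 + 2 * ((1 / \<alpha> + 1 / 4) * (1 - \<alpha>) - 1 / \<alpha>)"
      by (simp add: q_def \<theta>_def \<gamma>_eq)
    also have "\<dots> = - 1 / 2 - \<alpha> / 2" using \<alpha> by (simp add: field_simps)
    finally show ?thesis using \<alpha> by simp
  next
    case False
    then have "1 / 2 < \<gamma>" using \<alpha> by (simp add: \<gamma>_eq field_simps)
    then show ?thesis using False by (simp add: \<theta>_def)
  qed
  have "norm (real n * ((scale t n * (\<Sum>k<cutoff n. Q k b))\<^sup>2 / gap)) \<le> K * real n powr (1 + 2 * (q * \<theta> - \<gamma>))"
    if n: "n > 0" for n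
  proof -
    note c = cutoff_bounds[OF n, folded q_def]
    let ?S = "\<Sum>k<cutoff n. Q k b"
    have S0: "0 \<le> ?S" using Q_pos[OF b_bounds(1)] b_bounds by (intro sum_nonneg) (auto intro: less_imp_le)
    have "?S \<le> C * real (cutoff n) powr \<theta>" by (rule C(2)[OF c(3)])
    also have "\<dots> \<le> C * (2 * real n powr q) powr \<theta>" using c \<theta> C by (intro mult_left_mono powr_mono2) auto
    also have "\<dots> = C * 2 powr \<theta> * real n powr (q * \<theta>)" by (simp add: powr_mult powr_powr)
    finally have S: "?S \<le> C * 2 powr \<theta> * real n powr (q * \<theta>)" .
    have "(scale t n * ?S)\<^sup>2 = (scale t n)\<^sup>2 * ?S\<^sup>2" by (simp add: power_mult_distrib)
    also have "\<dots> \<le> (scale t n)\<^sup>2 * (C * 2 powr \<theta> * real n powr (q * \<theta>))\<^sup>2"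
      using S S0 by (intro mult_left_mono power_mono) auto
    also have "\<dots> = (t * d_const \<alpha> powr (- \<gamma>) * (C * 2 powr \<theta>))\<^sup>2 * (real n powr (- \<gamma>) * real n powr (q * \<theta>))\<^sup>2"
      using d_const_pos by (simp add: scale_def powr_mult power_mult_distrib mult_ac)
    also have "(real n powr (- \<gamma>) * real n powr (q * \<theta>))\<^sup>2 = real n powr (2 * (q * \<theta> - \<gamma>))"
    proof -
      have "2 * (q * \<theta> - \<gamma>) = (- \<gamma> + q * \<theta>) + (- \<gamma> + q * \<theta>)" by simp
      then show ?thesis using n by (simp only: powr_add power2_eq_square)
    qed
    finally have "(scale t n * ?S)\<^sup>2 / gap \<le> K * real n powr (2 * (q * \<theta> - \<gamma>))"
      using kernel.e_pos by (simp add: K_def divide_right_mono)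
    then have "real n * ((scale t n * ?S)\<^sup>2 / gap) \<le> real n * (K * real n powr (2 * (q * \<theta> - \<gamma>)))"
      by (rule mult_left_mono) simp
    also have "\<dots> = K * real n powr (1 + 2 * (q * \<theta> - \<gamma>))" using n by (simp add: powr_add)
    finally show ?thesis using kernel.e_pos by simp
  qed
  then have "eventually (\<lambda>n. norm (real n * ((scale t n * (\<Sum>k<cutoff n. Q k b))\<^sup>2 / gap))
      \<le> K * real n powr (1 + 2 * (q * \<theta> - \<gamma>))) sequentially"
    using eventually_gt_at_top[of 0] by (rule eventually_mono[rotated])
  moreover have "(\<lambda>n. K * real n powr (1 + 2 * (q * \<theta> - \<gamma>))) \<longlonglongrightarrow> 0"
    using tendsto_mult[OF tendsto_const tendsto_neg_powr[OF e filterlim_real_sequentially], of K] by simp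
  ultimately show ?thesis by (rule Lim_null_comparison)
qed

end

section \<open>Random signs\<close>

definition sign_char :: "real \<Rightarrow> real \<Rightarrow> complex" where
  "sign_char \<beta> x = of_real ((1 + \<beta>) / 2) * cis x + of_real ((1 - \<beta>) / 2) * cis (- x)"

lemma sign_char_minus: "sign_char \<beta> (- x) = sign_char (- \<beta>) x"
  by (simp add: sign_char_def)

lemma sign_weights: "complex_of_real ((1 + \<beta>) / 2) + of_real ((1 - \<beta>) / 2) = 1"
proof -
  have "(1 + \<beta>) / 2 + (1 - \<beta>) / 2 = 1" by (simp add: field_simps)
  then show ?thesis by (simp only: of_real_add[symmetric] of_real_1)
qed

lemma sign_char_0: "sign_char \<beta> 0 = 1"
  using sign_weights by (simp only: sign_char_def minus_zero cis_zero mult_1_right)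

lemma sign_char_measurable [measurable]: "sign_char \<beta> \<in> borel_measurable borel"
  unfolding sign_char_def cis_conv_exp by measurable

lemma sign_char_lipschitz:
  assumes "\<beta> \<in> {-1..1}" shows "norm (sign_char \<beta> x - sign_char \<beta> y) \<le> \<bar>x - y\<bar>"
proof -
  have "sign_char \<beta> x - sign_char \<beta> y =
      of_real ((1 + \<beta>) / 2) * (cis x - cis y) + of_real ((1 - \<beta>) / 2) * (cis (- x) - cis (- y))"
    by (simp add: sign_char_def algebra_simps del: of_real_divide of_real_add of_real_diff)
  also have "norm \<dots> \<le> (1 + \<beta>) / 2 * norm (cis x - cis y) + (1 - \<beta>) / 2 * norm (cis (- x) - cis (- y))"
  proof -
    have "norm (of_real ((1 + \<beta>) / 2) * (cis x - cis y)) = (1 + \<beta>) / 2 * norm (cis x - cis y)"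
      "norm (of_real ((1 - \<beta>) / 2) * (cis (- x) - cis (- y))) = (1 - \<beta>) / 2 * norm (cis (- x) - cis (- y))"
      unfolding norm_mult norm_of_real using assms by simp_all
    then show ?thesis by (metis norm_triangle_ineq)
  qed
  also have "\<dots> \<le> (1 + \<beta>) / 2 * \<bar>x - y\<bar> + (1 - \<beta>) / 2 * \<bar>x - y\<bar>"
    using norm_cis_diff_le[of x y] norm_cis_diff_le[of "- x" "- y"] assms
    by (intro add_mono mult_left_mono) auto
  finally show ?thesis by (simp add: field_simps)
qed

lemma norm_sign_char_le:
  assumes "\<beta> \<in> {-1..1}" shows "norm (sign_char \<beta> x) \<le> 1"
proof -
  have "norm (sign_char \<beta> x) \<le> norm (of_real ((1 + \<beta>) / 2) * cis x) + norm (of_real ((1 - \<beta>) / 2) * cis (- x))"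
    unfolding sign_char_def by (rule norm_triangle_ineq)
  also have "\<dots> = (1 + \<beta>) / 2 + (1 - \<beta>) / 2"
    unfolding norm_mult norm_of_real norm_cis using assms by simp
  finally show ?thesis by (simp flip: add_divide_distrib)
qed

context prob_space
begin

text \<open>The two given probabilities add up to 1, so almost surely no other value occurs.\<close>

lemma expectation_cis_sign:
  assumes [measurable]: "X \<in> borel_measurable M"
    and p: "prob {\<omega> \<in> space M. X \<omega> = 1} = (1 + \<beta>) / 2" and n: "prob {\<omega> \<in> space M. X \<omega> = - 1} = (1 - \<beta>) / 2"
  shows "expectation (\<lambda>\<omega>. cis (x * X \<omega>)) = sign_char \<beta> x"
proof -
  let ?P = "{\<omega> \<in> space M. X \<omega> = 1}" and ?N = "{\<omega> \<in> space M. X \<omega> = - 1}"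
  have [measurable]: "?P \<in> sets M" "?N \<in> sets M" by measurable
  have "prob (?P \<union> ?N) = prob ?P + prob ?N" by (rule finite_measure_Union) auto
  then have "prob (?P \<union> ?N) = 1" unfolding p n by (simp flip: add_divide_distrib)
  then have "AE \<omega> in M. \<omega> \<in> ?P \<union> ?N" by (subst (asm) prob_eq_1) auto
  then have "expectation (\<lambda>\<omega>. cis (x * X \<omega>)) =
      expectation (\<lambda>\<omega>. indicator ?P \<omega> *\<^sub>R cis x + indicator ?N \<omega> *\<^sub>R cis (- x))"
    unfolding cis_conv_exp by (intro integral_cong_AE) (auto elim!: eventually_mono simp: indicator_def)
  also have "\<dots> = prob ?P *\<^sub>R cis x + prob ?N *\<^sub>R cis (- x)"
    by (subst Bochner_Integration.integral_add) (auto simp: less_top[symmetric])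
  finally show ?thesis unfolding p n by (simp add: sign_char_def scaleR_conv_of_real)
qed

text \<open>Independence of the two sequences makes their joint law a product. Fubini then freezes
  the times at \<open>u\<close>, and independence of the signs factorises the inner
  expectation.\<close>

lemma expectation_cis_random_signs:
  fixes \<delta> \<tau> :: "nat \<Rightarrow> 'a \<Rightarrow> real"
  assumes \<delta>_meas [measurable]: "\<And>j. \<delta> j \<in> borel_measurable M"
    and p: "\<And>j. prob {\<omega> \<in> space M. \<delta> j \<omega> = 1} = (1 + \<beta>) / 2"
    and n: "\<And>j. prob {\<omega> \<in> space M. \<delta> j \<omega> = - 1} = (1 - \<beta>) / 2"
    and indep: "indep_vars (\<lambda>_. borel) \<delta> UNIV"
    and indep2: "indep_var (PiM UNIV (\<lambda>_. borel)) (\<lambda>\<omega> j. \<delta> j \<omega>) (PiM UNIV (\<lambda>_. borel)) (\<lambda>\<omega> j. \<tau> j \<omega>)"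
  shows "expectation (\<lambda>\<omega>. cis (s * (\<Sum>j<N. \<delta> j \<omega> * \<tau> j \<omega>))) = expectation (\<lambda>\<omega>. \<Prod>j<N. sign_char \<beta> (s * \<tau> j \<omega>))"
proof -
  let ?P = "PiM UNIV (\<lambda>_::nat. borel :: real measure)"
  let ?D = "\<lambda>\<omega> j. \<delta> j \<omega>" and ?T = "\<lambda>\<omega> j. \<tau> j \<omega>"
  define f :: "(nat \<Rightarrow> real) \<Rightarrow> (nat \<Rightarrow> real) \<Rightarrow> complex" where
    "f d u = exp (\<i> * of_real (s * (\<Sum>j<N. d j * u j)))" for d u
  have D [measurable]: "?D \<in> M \<rightarrow>\<^sub>M ?P" and T [measurable]: "?T \<in> M \<rightarrow>\<^sub>M ?P"
    and joint: "distr M ?P ?D \<Otimes>\<^sub>M distr M ?P ?T = distr M (?P \<Otimes>\<^sub>M ?P) (\<lambda>\<omega>. (?D \<omega>, ?T \<omega>))"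
    using indep2 unfolding indep_var_distribution_eq by auto
  have f_meas [measurable]: "case_prod f \<in> borel_measurable (?P \<Otimes>\<^sub>M ?P)"
    unfolding f_def by measurable
  interpret D: prob_space "distr M ?P ?D" by (rule prob_space_distr[OF D])
  interpret T: prob_space "distr M ?P ?T" by (rule prob_space_distr[OF T])
  interpret DT: pair_prob_space "distr M ?P ?D" "distr M ?P ?T" ..
  have f_int: "integrable (distr M ?P ?D \<Otimes>\<^sub>M distr M ?P ?T) (case_prod f)"
    by (rule DT.P.integrable_const_bound[where B=1]) (auto simp: f_def)
  have "expectation (\<lambda>\<omega>. cis (s * (\<Sum>j<N. \<delta> j \<omega> * \<tau> j \<omega>))) = expectation (\<lambda>\<omega>. case_prod f (?D \<omega>, ?T \<omega>))"
    by (simp add: f_def cis_conv_exp)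
  also have "\<dots> = integral\<^sup>L (distr M (?P \<Otimes>\<^sub>M ?P) (\<lambda>\<omega>. (?D \<omega>, ?T \<omega>))) (case_prod f)"
    by (rule integral_distr[symmetric]) measurable
  also have "\<dots> = (\<integral>u. (\<integral>d. f d u \<partial>distr M ?P ?D) \<partial>distr M ?P ?T)"
    unfolding joint[symmetric] by (rule DT.integral_snd[OF f_int, symmetric])
  also have "\<dots> = (\<integral>u. (\<Prod>j<N. sign_char \<beta> (s * u j)) \<partial>distr M ?P ?T)"
  proof (rule Bochner_Integration.integral_cong[OF refl])
    fix u :: "nat \<Rightarrow> real"
    have "(\<integral>d. f d u \<partial>distr M ?P ?D) = expectation (\<lambda>\<omega>. f (?D \<omega>) u)"
      unfolding f_def by (rule integral_distr) measurable
    also have "\<dots> = expectation (\<lambda>\<omega>. \<Prod>j<N. cis (s * u j * \<delta> j \<omega>))"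
      unfolding f_def cis_conv_exp exp_sum[OF finite_lessThan, symmetric]
      by (simp add: sum_distrib_left mult_ac)
    also have "\<dots> = (\<Prod>j<N. expectation (\<lambda>\<omega>. cis (s * u j * \<delta> j \<omega>)))"
    proof (rule indep_vars_lebesgue_integral)
      have "indep_vars (\<lambda>_. borel) (\<lambda>j \<omega>. (\<lambda>x. cis (s * u j * x)) (\<delta> j \<omega>)) UNIV"
        by (rule indep_vars_compose2[OF indep]) (simp add: cis_conv_exp)
      then show "indep_vars (\<lambda>_. borel) (\<lambda>j \<omega>. cis (s * u j * \<delta> j \<omega>)) {..<N}"
        by (rule indep_vars_subset) simp
      show "integrable M (\<lambda>\<omega>. cis (s * u j * \<delta> j \<omega>))" for j
        by (rule integrable_const_bound[where B=1]) (auto simp: cis_conv_exp)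
    qed simp
    also have "\<dots> = (\<Prod>j<N. sign_char \<beta> (s * u j))"
      by (intro prod.cong refl expectation_cis_sign \<delta>_meas p n)
    finally show "(\<integral>d. f d u \<partial>distr M ?P ?D) = (\<Prod>j<N. sign_char \<beta> (s * u j))" .
  qed
  also have "\<dots> = expectation (\<lambda>\<omega>. \<Prod>j<N. sign_char \<beta> (s * \<tau> j \<omega>))"
    by (rule integral_distr) measurable
  finally show ?thesis .
qed

end

context thaler
begin

text \<open>\<open>ret\<close> is a truncated subtraction, so the equation needs a nonzero return
  time, which an unspecified \<open>LEAST\<close> need not provide. The case \<open>j = 0\<close>
  follows from the branches, all others from invariance of the measure.\<close>

lemma AE_return_time: "AE y in \<mu>. \<forall>j. return_time \<gamma> j y = Suc (ret_at j y)"
proof -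
  have "AE y in \<mu>. return_time \<gamma> 0 ((ret_map ^^ j) y) \<noteq> 0" for j
  proof -
    let ?V = "\<lambda>y. of_bool (return_time \<gamma> 0 y = 0) :: real"
    have "AE y in \<mu>. return_time \<gamma> 0 y \<noteq> 0"
      using AE_branch_interior by eventually_elim (use branch_interior(2) in force)
    then have "(\<integral>y. ?V y \<partial>\<mu>) = 0"
      by (intro integral_eq_zero_AE) (auto elim!: eventually_mono)
    then have "complex_of_real (\<integral>y. ?V ((ret_map ^^ j) y) \<partial>\<mu>) = 0"
      using integral_ret_map_pow[of "\<lambda>y. complex_of_real (?V y)" j]
      by (simp add: integral_complex_of_real)
    then have "(\<integral>y. ?V ((ret_map ^^ j) y) \<partial>\<mu>) = 0" by (simp only: of_real_eq_0_iff)
    moreover have "integrable \<mu> (\<lambda>y. ?V ((ret_map ^^ j) y))"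
      by (rule integrable_mu_bounded[where B=1]) auto
    ultimately have "AE y in \<mu>. ?V ((ret_map ^^ j) y) = 0"
      by (subst (asm) integral_nonneg_eq_0_iff_AE) auto
    then show ?thesis by (auto elim!: eventually_mono)
  qed
  then have "AE y in \<mu>. \<forall>j. return_time \<gamma> 0 ((ret_map ^^ j) y) \<noteq> 0" by (simp add: AE_all_countable)
  then show ?thesis
  proof eventually_elim
    case (elim y)
    then show ?case by (auto simp: ret_def return_time_iterate[of _ y])
  qed
qed

lemma integral_sign_char_ret:
  assumes \<beta>: "\<beta> \<in> {-1..1}"
  shows "(\<integral>y. sign_char \<beta> (s * real (Suc (ret y))) \<partial>\<mu>) =
    1 - (of_real ((1 + \<beta>) / 2) * char_defect tail s + of_real ((1 - \<beta>) / 2) * cnj (char_defect tail s))"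
proof -
  have sums: "(\<lambda>k. (tail k - tail (Suc k)) *\<^sub>R cis (s * real (Suc k))) sums (1 - char_defect tail s)"
    using char_defect_sums[OF decseq_tail tail_lim tail_0, of s]
    by (simp only: Complex.DeMoivre mult.commute[of s])
  have sums': "(\<lambda>k. (tail k - tail (Suc k)) *\<^sub>R cis (- (s * real (Suc k)))) sums cnj (1 - char_defect tail s)"
  proof -
    have "(\<lambda>k. cnj ((tail k - tail (Suc k)) *\<^sub>R cis (s * real (Suc k)))) sums cnj (1 - char_defect tail s)"
      using sums by (subst sums_cnj)
    then show ?thesis by (simp add: scaleR_conv_of_real cis_cnj)
  qed
  have "(\<lambda>k. of_real ((1 + \<beta>) / 2) * ((tail k - tail (Suc k)) *\<^sub>R cis (s * real (Suc k))) +
      of_real ((1 - \<beta>) / 2) * ((tail k - tail (Suc k)) *\<^sub>R cis (- (s * real (Suc k))))) sums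
      (of_real ((1 + \<beta>) / 2) * (1 - char_defect tail s) + of_real ((1 - \<beta>) / 2) * cnj (1 - char_defect tail s))"
    by (intro sums_add sums_mult sums sums')
  moreover have "of_real ((1 + \<beta>) / 2) * ((tail k - tail (Suc k)) *\<^sub>R cis (s * real (Suc k))) +
      of_real ((1 - \<beta>) / 2) * ((tail k - tail (Suc k)) *\<^sub>R cis (- (s * real (Suc k)))) =
      (tail k - tail (Suc k)) *\<^sub>R sign_char \<beta> (s * real (Suc k))" for k
    by (simp add: sign_char_def scaleR_right_distrib)
  ultimately have "(\<lambda>k. (tail k - tail (Suc k)) *\<^sub>R sign_char \<beta> (s * real (Suc k))) sums
      (of_real ((1 + \<beta>) / 2) * (1 - char_defect tail s) + of_real ((1 - \<beta>) / 2) * cnj (1 - char_defect tail s))"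
    by simp
  moreover have "(\<integral>y. sign_char \<beta> (s * real (Suc (ret y))) \<partial>\<mu>) =
      (\<Sum>k. (tail k - tail (Suc k)) *\<^sub>R sign_char \<beta> (s * real (Suc k)))"
    by (rule integral_ret[where B=1]) (rule norm_sign_char_le[OF \<beta>])
  ultimately have "(\<integral>y. sign_char \<beta> (s * real (Suc (ret y))) \<partial>\<mu>) =
      of_real ((1 + \<beta>) / 2) * (1 - char_defect tail s) + of_real ((1 - \<beta>) / 2) * cnj (1 - char_defect tail s)"
    by (simp add: sums_iff)
  also have "\<dots> = of_real ((1 + \<beta>) / 2) + of_real ((1 - \<beta>) / 2) -
      (of_real ((1 + \<beta>) / 2) * char_defect tail s + of_real ((1 - \<beta>) / 2) * cnj (char_defect tail s))"
    by (simp add: algebra_simps del: of_real_divide of_real_add of_real_diff)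
  also have "of_real ((1 + \<beta>) / 2) + of_real ((1 - \<beta>) / 2) = (1 :: complex)"
    by (rule sign_weights)
  finally show ?thesis .
qed

end

context thaler_stable
begin

section \<open>Limits of the characteristic functions\<close>

abbreviation centre :: "real \<Rightarrow> real \<Rightarrow> nat \<Rightarrow> complex" where
  "centre \<beta> t n \<equiv> cis (- real n * scale t n * \<beta> * ell_const \<alpha>)"

text \<open>The centring has norm 1, so the mixing error between the joint expectation and the
  \<open>n\<close>-th power passes through it unchanged. What remains is the independent
  case.\<close>

lemma char_limit_pos:
  assumes \<beta>: "\<beta> \<in> {-1..1}" and t: "0 < t"
  shows "(\<lambda>n. centre \<beta> t n *
      (\<integral>y. (\<Prod>j<n. sign_char \<beta> (scale t n * real (Suc (ret_at j y)))) \<partial>\<mu>)) \<longlonglongrightarrow> stable_char \<alpha> 1 \<beta> t"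
proof -
  define p where "p x = 1 - (of_real ((1 + \<beta>) / 2) * char_defect tail x + of_real ((1 - \<beta>) / 2) * cnj (char_defect tail x))" for x
  define g where "g n k = sign_char \<beta> (scale t n * real (Suc k))" for n k
  have g: "norm (g n k) \<le> 1" for n k unfolding g_def by (rule norm_sign_char_le[OF \<beta>])
  have scale0: "0 \<le> scale t n" for n using t by (simp add: scale_def)
  have p_eq: "p (scale t n) = (\<integral>y. g n (ret y) \<partial>\<mu>)" for n
    unfolding p_def g_def by (rule integral_sign_char_ret[OF \<beta>, symmetric])
  have norm_p: "norm (p (scale t n)) \<le> 1" for n
  proof -
    interpret prob_space \<mu> by (rule prob_space_mu)
    have "norm (0 - p (scale t n)) \<le> 1"
      unfolding p_eq
      by (rule norm_diff_expectation_le) (use integrable_ret[where c = "g n" and B = 1 and j = 0] g in auto)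
    then show ?thesis by simp
  qed
  have "(\<lambda>n. centre \<beta> t n * p (scale t n) ^ n) \<longlonglongrightarrow>
      exp (- of_real (t powr \<alpha> / d_const \<alpha>) * (of_real (Re \<kappa>) + \<i> * of_real (\<beta> * Im \<kappa>)))"
  proof -
    have sc: "scale t n = t * (real n * d_const \<alpha>) powr (- 1 / \<alpha>)" for n
      unfolding scale_def by (simp add: \<gamma>_eq)
    show ?thesis
      by (rule signed_char_power_tendsto[OF \<alpha>(1,2) d_const_pos t char_defect_tail_asymp, of \<beta>,
            folded p_def, folded sc, OF norm_p])
  qed
  also have "exp (- of_real (t powr \<alpha> / d_const \<alpha>) * (of_real (Re \<kappa>) + \<i> * of_real (\<beta> * Im \<kappa>))) = stable_char \<alpha> 1 \<beta> t"
  proof -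
    have "- of_real (t powr \<alpha> / d_const \<alpha>) * (of_real (Re \<kappa>) + \<i> * of_real (\<beta> * Im \<kappa>)) =
        - (of_real (1 powr \<alpha> * \<bar>t\<bar> powr \<alpha>) * (1 - \<i> * of_real (\<beta> * sgn t * tan (\<alpha> * pi / 2))))"
      unfolding Re_\<kappa> Im_\<kappa> using d_const_pos t by (simp add: complex_eq_iff)
    then show ?thesis by (simp only: stable_char_def)
  qed
  finally have 1: "(\<lambda>n. centre \<beta> t n * p (scale t n) ^ n) \<longlonglongrightarrow> stable_char \<alpha> 1 \<beta> t" .
  have "(\<lambda>n. centre \<beta> t n * (\<integral>y. (\<Prod>j<n. g n (ret_at j y)) \<partial>\<mu>) -
      centre \<beta> t n * p (scale t n) ^ n) \<longlonglongrightarrow> 0"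
  proof (rule Lim_null_comparison)
    show "eventually (\<lambda>n. norm (centre \<beta> t n * (\<integral>y. (\<Prod>j<n. g n (ret_at j y)) \<partial>\<mu>) -
        centre \<beta> t n * p (scale t n) ^ n) \<le>
        real n * (4 * tail (cutoff n)) + real n * ((scale t n * (\<Sum>k<cutoff n. Q k b))\<^sup>2 / gap)) sequentially"
      using eventually_gt_at_top[of 0]
    proof eventually_elim
      case (elim n)
      have "norm (centre \<beta> t n * (\<integral>y. (\<Prod>j<n. g n (ret_at j y)) \<partial>\<mu>) -
          centre \<beta> t n * p (scale t n) ^ n) =
          norm ((\<integral>y. (\<Prod>j<n. g n (ret_at j y)) \<partial>\<mu>) - (\<integral>y. g n (ret y) \<partial>\<mu>) ^ n)"
        unfolding p_eq right_diff_distrib[symmetric] norm_mult norm_cis by simp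
      also have "\<dots> \<le> real n * (4 * tail (cutoff n) + (scale t n * (\<Sum>k<cutoff n. Q k b))\<^sup>2 / gap)"
      proof (rule mixing[OF g scale0 cutoff_bounds(3)[OF elim]])
        fix k
        have "norm (g n (Suc k) - g n k) \<le> \<bar>scale t n * real (Suc (Suc k)) - scale t n * real (Suc k)\<bar>"
          unfolding g_def by (rule sign_char_lipschitz[OF \<beta>])
        also have "\<dots> = scale t n" using scale0[of n] by (simp add: algebra_simps)
        finally show "norm (g n (Suc k) - g n k) \<le> scale t n" .
        have "norm (g n k - 1) \<le> \<bar>scale t n * real (Suc k) - 0\<bar>"
          using sign_char_lipschitz[OF \<beta>, of "scale t n * real (Suc k)" 0] by (simp only: g_def sign_char_0)
        then show "norm (g n k - 1) \<le> scale t n * real (Suc k)" using scale0[of n] by (simp add: abs_mult)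
      qed
      finally show ?case by (simp only: distrib_left)
    qed
    show "(\<lambda>n. real n * (4 * tail (cutoff n)) + real n * ((scale t n * (\<Sum>k<cutoff n. Q k b))\<^sup>2 / gap)) \<longlonglongrightarrow> 0"
      using tendsto_add[OF tail_error coupling_error] by simp
  qed
  from tendsto_add[OF this 1] show ?thesis by (simp add: g_def)
qed

lemma stable_char_minus: "stable_char \<alpha> 1 \<beta> (- t) = stable_char \<alpha> 1 (- \<beta>) t"
  by (simp add: stable_char_def sgn_minus)

text \<open>Reversing the signs of both \<beta> and \<open>t\<close> leaves the two sides unchanged,
  which reduces negative \<open>t\<close> to positive \<open>t\<close>.\<close>

lemma char_limit:
  assumes \<beta>: "\<beta> \<in> {-1..1}"
  shows "(\<lambda>n. centre \<beta> t n *
      (\<integral>y. (\<Prod>j<n. sign_char \<beta> (scale t n * real (Suc (ret_at j y)))) \<partial>\<mu>)) \<longlonglongrightarrow> stable_char \<alpha> 1 \<beta> t"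
proof (cases t "0::real" rule: linorder_cases)
  case less
  have s: "scale t n = - scale (- t) n" for n by (simp add: scale_def)
  have "(\<lambda>n. centre (- \<beta>) (- t) n *
      (\<integral>y. (\<Prod>j<n. sign_char (- \<beta>) (scale (- t) n * real (Suc (ret_at j y)))) \<partial>\<mu>)) \<longlonglongrightarrow> stable_char \<alpha> 1 (- \<beta>) (- t)"
    by (rule char_limit_pos) (use \<beta> less in auto)
  then show ?thesis
    unfolding stable_char_minus s sign_char_minus mult_minus_left by simp
next
  case equal
  interpret prob_space \<mu> by (rule prob_space_mu)
  show ?thesis using \<alpha> by (simp add: equal scale_def sign_char_0 stable_char_def prob_space)
next
  case greater
  then show ?thesis by (rule char_limit_pos[OF \<beta>])
qed

end

section \<open>Convergence in distribution by Levy continuity\<close>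

theorem theorem2p5:
  fixes \<alpha> \<beta> \<gamma> :: real
    and M :: "'a measure" and y\<^sub>0 :: "'a \<Rightarrow> real" and \<delta> :: "nat \<Rightarrow> 'a \<Rightarrow> real"
    and N :: "'b measure" and X :: "'b \<Rightarrow> real"
  assumes alpha: "\<alpha> \<in> {0<..<1} \<union> {1<..<2}"
    and beta: "\<beta> \<in> {-1..1}"
    and gamma: "\<gamma> = 1 / \<alpha>"
    and M: "prob_space M"
    and y0_meas: "y\<^sub>0 \<in> measurable M (thaler_mu \<gamma>)"
    and y0_law: "distr M (thaler_mu \<gamma>) y\<^sub>0 = thaler_mu \<gamma>"
    and delta_meas: "\<And>j. \<delta> j \<in> borel_measurable M"
    and delta_pos: "\<And>j. measure M {\<omega> \<in> space M. \<delta> j \<omega> = 1} = (1 + \<beta>) / 2"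
    and delta_neg: "\<And>j. measure M {\<omega> \<in> space M. \<delta> j \<omega> = - 1} = (1 - \<beta>) / 2"
    and delta_indep: "prob_space.indep_vars M (\<lambda>_. borel) \<delta> UNIV"
    and delta_tau_indep:
      "prob_space.indep_var M
         (PiM UNIV (\<lambda>_. borel)) (\<lambda>\<omega> j. \<delta> j \<omega>)
         (PiM UNIV (\<lambda>_. borel)) (\<lambda>\<omega> j. real (return_time \<gamma> j (y\<^sub>0 \<omega>)))"
    and N: "prob_space N"
    and X_meas: "X \<in> borel_measurable N"
    and X_char: "\<And>t. char (distr N borel X) t = stable_char \<alpha> 1 \<beta> t"
  shows "weak_conv_m
     (\<lambda>n. distr M borel (\<lambda>\<omega>.
        real n powr (- \<gamma>) * d_const \<alpha> powr (- \<gamma>)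
          * ((\<Sum>j<n. \<delta> j \<omega> * real (return_time \<gamma> j (y\<^sub>0 \<omega>)))
             - real n * \<beta> * ell_const \<alpha>)))
     (distr N borel X)"
proof -
  interpret thaler_stable \<gamma> \<alpha>
    by unfold_locales (use alpha gamma in auto)
  interpret M: prob_space M by (rule M)
  interpret N: prob_space N by (rule N)
  note [measurable] = delta_meas X_meas y0_meas
  have tau_meas [measurable]: "(\<lambda>\<omega>. real (return_time \<gamma> j (y\<^sub>0 \<omega>))) \<in> borel_measurable M" for j
  proof -
    have "(\<lambda>y. real (return_time \<gamma> j y)) \<in> borel_measurable \<mu>" by measurable
    from measurable_compose[OF y0_meas this] show ?thesis .
  qed
  define Z where "Z n \<omega> = real n powr (- \<gamma>) * d_const \<alpha> powr (- \<gamma>)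
      * ((\<Sum>j<n. \<delta> j \<omega> * real (return_time \<gamma> j (y\<^sub>0 \<omega>))) - real n * \<beta> * ell_const \<alpha>)" for n \<omega>
  have Z_meas [measurable]: "Z n \<in> borel_measurable M" for n unfolding Z_def by measurable
  have char_Z: "char (distr M borel (Z n)) t = centre \<beta> t n *
      (\<integral>y. (\<Prod>j<n. sign_char \<beta> (scale t n * real (Suc (ret_at j y)))) \<partial>\<mu>)" for n t
  proof -
    have "char (distr M borel (Z n)) t = M.expectation (\<lambda>\<omega>. iexp (t * Z n \<omega>))"
      unfolding char_def by (rule integral_distr) measurable
    also have "\<dots> = M.expectation (\<lambda>\<omega>. centre \<beta> t n *
        cis (scale t n * (\<Sum>j<n. \<delta> j \<omega> * real (return_time \<gamma> j (y\<^sub>0 \<omega>)))))"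
    proof (rule Bochner_Integration.integral_cong[OF refl])
      fix \<omega>
      have "t * Z n \<omega> = - real n * scale t n * \<beta> * ell_const \<alpha> +
          scale t n * (\<Sum>j<n. \<delta> j \<omega> * real (return_time \<gamma> j (y\<^sub>0 \<omega>)))"
        using d_const_pos by (simp add: Z_def scale_def powr_mult algebra_simps)
      then show "iexp (t * Z n \<omega>) = centre \<beta> t n *
        cis (scale t n * (\<Sum>j<n. \<delta> j \<omega> * real (return_time \<gamma> j (y\<^sub>0 \<omega>))))"
        by (simp only: cis_mult cis_conv_exp[symmetric])
    qed
    also have "\<dots> = centre \<beta> t n *
        M.expectation (\<lambda>\<omega>. cis (scale t n * (\<Sum>j<n. \<delta> j \<omega> * real (return_time \<gamma> j (y\<^sub>0 \<omega>)))))"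
      by (rule integral_mult_right_zero)
    also have "M.expectation (\<lambda>\<omega>. cis (scale t n * (\<Sum>j<n. \<delta> j \<omega> * real (return_time \<gamma> j (y\<^sub>0 \<omega>))))) =
        M.expectation (\<lambda>\<omega>. \<Prod>j<n. sign_char \<beta> (scale t n * real (return_time \<gamma> j (y\<^sub>0 \<omega>))))"
      by (rule M.expectation_cis_random_signs[OF delta_meas delta_pos delta_neg delta_indep delta_tau_indep])
    also have "\<dots> = (\<integral>y. (\<Prod>j<n. sign_char \<beta> (scale t n * real (return_time \<gamma> j y))) \<partial>distr M \<mu> y\<^sub>0)"
      by (rule integral_distr[symmetric]) measurable
    also have "\<dots> = (\<integral>y. (\<Prod>j<n. sign_char \<beta> (scale t n * real (return_time \<gamma> j y))) \<partial>\<mu>)"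
      unfolding y0_law ..
    \<comment> \<open>The passage from \<open>return_time\<close> to \<open>Suc\<close> of
      \<open>ret\<close> is valid only off a null set.\<close>
    also have "\<dots> = (\<integral>y. (\<Prod>j<n. sign_char \<beta> (scale t n * real (Suc (ret_at j y)))) \<partial>\<mu>)"
    proof (rule integral_cong_AE)
      show "AE y in \<mu>. (\<Prod>j<n. sign_char \<beta> (scale t n * real (return_time \<gamma> j y))) =
          (\<Prod>j<n. sign_char \<beta> (scale t n * real (Suc (ret_at j y))))"
        using AE_return_time by eventually_elim (simp only:)
    qed measurable
    finally show ?thesis .
  qed
  have "weak_conv_m (\<lambda>n. distr M borel (Z n)) (distr N borel X)"
  proof (rule levy_continuity)
    show "real_distribution (distr M borel (Z n))" for n by (rule M.real_distribution_distr) measurable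
    show "real_distribution (distr N borel X)" by (rule N.real_distribution_distr) measurable
    show "(\<lambda>n. char (distr M borel (Z n)) t) \<longlonglongrightarrow> char (distr N borel X) t" for t
      unfolding X_char char_Z by (rule char_limit[OF beta])
  qed
  then show ?thesis by (simp only: Z_def[abs_def])
qed

end
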